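(* Let $D_j^{(\ell)}(Y)$ ($\ell\ge0$, $0\le j\le\ell$), $D_j^{(-\ell)}(Y)$ ($\ell\ge0$, $0\le j\le\ell$) and $K_j^{(\ell)}(Y)$ ($\ell\ge1$, $0\le j\le\ell$) be the elements of $\mathbb{C}(Y)$ defined by the expansions $$E_\ell(X)\mathbf{1}_0=\sum_{j=0}^{\ell-1}\eta^{\ell-2j}D_j^{(\ell-1)}(Y)\mathbf{1}_0\ (\ell\ge1),\qquad E_{-\ell}(X)\mathbf{1}_0=\sum_{j=0}^{\ell}\eta^{-\ell+2j}D_j^{(-\ell)}(Y)\mathbf{1}_0\ (\ell\ge0),$$ $$\mathbf{1}_0E_\ell(X)\mathbf{1}_0=\sum_{j=0}^{\ell}\mathbf{1}_0\,\eta^{\ell-2j}K_j^{(\ell)}(Y)\ (\ell\ge1)$$ in the localized double affine Hecke algebra $\tilde H$. Then $$D_j^{(\ell)}(Y)=t^{-\frac12(\ell+1)}\,t^{\ell-j}\genfrac[]{0pt}{0}{\ell}{j}_{q,t}\genfrac(){0pt}{0}{\ell}{j}_{Y}\frac{(1-tq^{\ell-j})}{(1-tq^\ell)}\cdot\frac{(1-tY^{-2}q^{\ell-j})}{(1-tY^{-2}q^{\ell-2j})},$$ $$D_j^{(-\ell)}(Y)=t^{-\frac12\ell}(qt)^j\genfrac[]{0pt}{0}{\ell}{j}_{q,t}\genfrac(){0pt}{0}{\ell}{\ell-j}_{Y}\frac{(1-tq^{\ell-j})}{(1-tq^\ell)}\cdot\frac{(1-t^{-1}Y^{-2}q^{-(\ell-j)})}{(1-t^{-1}Y^{-2}q^{-(\ell-2j)})},$$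 $$K_j^{(\ell)}(Y)=t^{-\frac12(\ell-1)}\,t^{\ell-1-j}\genfrac[]{0pt}{0}{\ell}{j}_{q,t}\genfrac(){0pt}{0}{\ell}{j}_{Y}\frac{(1-Y^{-2}q^{\ell-2j})}{(1-t^{-1}Y^{-2}q^{\ell-2j})}\cdot\frac{(1-t^{-1}Y^{-2})}{(1-Y^{-2})}.$$
   Context: Fix $q^{\frac12},t^{\frac12}\in\mathbb{C}^\times$, with squares $q,t$, such that the only pair of integers $(a,b)$ with $q^at^b=1$ is $(0,0)$. The double affine Hecke algebra (DAHA) for $SL_2$ is the $\mathbb{C}$-algebra $\tilde H_{\mathrm{int}}$ generated by invertible elements $T_1,X,Y,T_\pi$ with relations $T_\pi=YT_1^{-1}=T_1Y^{-1}$, $T_\pi XT_\pi^{-1}=q^{\frac12}X^{-1}$, $T_1XT_1=X^{-1}$, $T_1Y^{-1}T_1=Y$, $(T_1-t^{\frac12})(T_1+t^{-\frac12})=0$. It is a free left $\mathbb{C}[Y,Y^{-1}]$-module with basis $\{X^k\}_{k\in\mathbb{Z}}\sqcup\{X^kT_1\}_{k\in\mathbb{Z}}$. The localized DAHA is $\tilde H=\mathbb{C}(Y)\otimes_{\mathbb{C}[Y,Y^{-1}]}\tilde H_{\mathrm{int}}$, the algebra with the same relations and the same basis as a left $\mathbb{C}(Y)$-module. In $\tilde H$ put $$\tau^\vee_1=T_1+t^{-\frac12}\frac{1-t}{1-Y^{-2}},\quad \tau^\vee_\pi=XT_1,\quad \mathbf{1}_0=T_1+t^{-\frac12},\quad \eta_\pi=\tau^\vee_\pi,\quad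 \eta_{s_1}=t^{\frac12}\frac{1-Y^{-2}}{1-tY^{-2}}\tau^\vee_1,$$ $\eta=\eta_\pi\eta_{s_1}$ and $\eta^{-1}=\eta_{s_1}\eta_\pi$ (mutually inverse in $\tilde H$). The set $\{\eta^k\mathbf{1}_0\mid k\in\mathbb{Z}\}$ is a left $\mathbb{C}(Y)$-basis of $\tilde H\mathbf{1}_0$. The polynomial representation $\tilde H_{\mathrm{int}}\mathbf{1}_Y$ is the $\tilde H_{\mathrm{int}}$-module generated by $\mathbf{1}_Y$ with relations $T_1\mathbf{1}_Y=t^{\frac12}\mathbf{1}_Y$, $T_\pi\mathbf{1}_Y=\mathbf{1}_Y$; it has $\mathbb{C}$-basis $\{X^k\mathbf{1}_Y\mid k\in\mathbb{Z}\}$. The electronic Macdonald polynomials $E_m(X)\in\mathbb{C}[X,X^{-1}]$, $m\in\mathbb{Z}$, are determined by $YE_m(X)\mathbf{1}_Y=t^{-\frac12}q^{-\frac m2}E_m(X)\mathbf{1}_Y$ for $m>0$, $YE_{-m}(X)\mathbf{1}_Y=t^{\frac12}q^{\frac m2}E_{-m}(X)\mathbf{1}_Y$ for $m\ge0$, with the coefficient of $X^m$ in $E_m(X)$ equal to $1$ for every $m\in\mathbb{Z}$. The superscript $(-\ell)$ is a label: $D_0^{(-0)}$ (from $E_0$, case $\ell=0$ of the second family) is not the same as $D_0^{(0)}$ (from $E_1$). Notation: $(z;q)_j=(1-z)(1-zq)\cdots(1-zq^{j-1})$, $(z;q)_0=1$; $$\genfrac[]{0pt}{0}{\ell}{j}_{q,t}=\frac{(q;q)_\ell/(t;q)_\ell}{\big((q;q)_j/(t;q)_j\big)\big((q;q)_{\ell-j}/(t;q)_{\ell-j}\big)},\qquad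 \genfrac(){0pt}{0}{\ell}{j}_{Y}=\frac{(t^{-1}Y^{-2}q^{-(j-1)};q)_{\ell-j}\,(tY^{-2}q^{\ell-2j};q)_j}{(Y^{-2}q;q)_{\ell-j}\,(Y^{-2}q^{-j};q)_j}\qquad(0\le j\le\ell).$$ *)

theory Defs
  imports
    "HOL.Complex"
    "HOL-Computational_Algebra.Polynomial"
    "HOL-Computational_Algebra.Fraction_Field"
    "HOL-Library.Poly_Mapping"
begin

text \<open>
  Throughout, \<open>qh\<close> and \<open>th\<close> are the chosen square roots of \<open>q = qh\<^sup>2\<close> and
  \<open>t = th\<^sup>2\<close>; all half-integral powers of \<open>q\<close> and \<open>t\<close> are integral powers of these.
\<close>

definition generic_parameters :: "complex \<Rightarrow> complex \<Rightarrow> bool" where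
  "generic_parameters qh th \<longleftrightarrow>
     qh \<noteq> 0 \<and> th \<noteq> 0 \<and>
     (\<forall>a b :: int. (qh\<^sup>2) powi a * (th\<^sup>2) powi b = 1 \<longrightarrow> a = 0 \<and> b = 0)"

type_synonym ratfun = "complex poly fract"

definition cst :: "complex \<Rightarrow> ratfun" where
  "cst c = Fract [:c:] 1"

definition Yvar :: ratfun where
  "Yvar = Fract [:0, 1:] 1"

type_synonym laurent = "int \<Rightarrow>\<^sub>0 complex"

text \<open>
  The data of an algebra with a copy of \<open>\<complex>(Y)\<close> (field \<open>emb\<close>) and the named generators with
  their inverses.  The left \<open>\<complex>(Y)\<close>-module structure is \<open>f \<cdot> h = emb f * h\<close>.
\<close>

record 'h daha =
  emb   :: "ratfun \<Rightarrow> 'h"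
  T1    :: 'h
  T1inv :: 'h
  X     :: 'h
  Xinv  :: 'h
  Tpi   :: 'h
  Tpiinv :: 'h

definition scal :: "('h, 'z) daha_scheme \<Rightarrow> complex \<Rightarrow> 'h" where
  "scal H c = emb H (cst c)"

definition Y :: "('h, 'z) daha_scheme \<Rightarrow> 'h" where
  "Y H = emb H Yvar"

definition Yinv :: "('h, 'z) daha_scheme \<Rightarrow> 'h" where
  "Yinv H = emb H (inverse Yvar)"

text \<open>Integral powers of an element \<open>a\<close> with inverse \<open>b\<close>.\<close>

definition zpow :: "'h::ring_1 \<Rightarrow> 'h \<Rightarrow> int \<Rightarrow> 'h" where
  "zpow a b k = (if 0 \<le> k then a ^ nat k else b ^ nat (- k))"

text \<open>
  The localized DAHA, characterized (uniquely up to isomorphism) as the \<open>\<complex>\<close>-algebra containing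
  \<open>\<complex>(Y)\<close> and satisfying the DAHA relations, with left \<open>\<complex>(Y)\<close>-basis
  \<open>X\<^sup>k\<close>, \<open>X\<^sup>k T\<^sub>1\<close> (\<open>k \<in> \<int>\<close>).
\<close>

definition localized_daha :: "complex \<Rightarrow> complex \<Rightarrow> ('h::ring_1) daha \<Rightarrow> bool" where
  "localized_daha qh th H \<longleftrightarrow>
     emb H 1 = 1 \<and>
     (\<forall>f g. emb H (f + g) = emb H f + emb H g) \<and>
     (\<forall>f g. emb H (f * g) = emb H f * emb H g) \<and>
     (\<forall>c h. scal H c * h = h * scal H c) \<and>
     T1 H * T1inv H = 1 \<and> T1inv H * T1 H = 1 \<and>
     X H * Xinv H = 1 \<and> Xinv H * X H = 1 \<and>
     Tpi H * Tpiinv H = 1 \<and> Tpiinv H * Tpi H = 1 \<and>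
     Tpi H = Y H * T1inv H \<and>
     Tpi H = T1 H * Yinv H \<and>
     Tpi H * X H * Tpiinv H = scal H qh * Xinv H \<and>
     T1 H * X H * T1 H = Xinv H \<and>
     T1 H * Yinv H * T1 H = Y H \<and>
     (T1 H - scal H th) * (T1 H + scal H (inverse th)) = 0 \<and>
     (\<forall>h. \<exists>!fg :: (int \<Rightarrow>\<^sub>0 ratfun) \<times> (int \<Rightarrow>\<^sub>0 ratfun).
        (case fg of (f, g) \<Rightarrow>
        h = (\<Sum>k\<in>Poly_Mapping.keys f. emb H (Poly_Mapping.lookup f k) * zpow (X H) (Xinv H) k)
          + (\<Sum>k\<in>Poly_Mapping.keys g. emb H (Poly_Mapping.lookup g k) * (zpow (X H) (Xinv H) k * T1 H))))"

definition laurent_X :: "('h::ring_1) daha \<Rightarrow> laurent \<Rightarrow> 'h" where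
  "laurent_X H p = (\<Sum>k\<in>Poly_Mapping.keys p. scal H (Poly_Mapping.lookup p k) * zpow (X H) (Xinv H) k)"

definition Ym2 :: ratfun where
  "Ym2 = inverse (Yvar ^ 2)"

definition tau1 :: "complex \<Rightarrow> ('h::ring_1) daha \<Rightarrow> 'h" where
  "tau1 th H = T1 H + emb H (cst (inverse th) * ((1 - cst (th\<^sup>2)) / (1 - Ym2)))"

definition tau_pi :: "('h::ring_1) daha \<Rightarrow> 'h" where
  "tau_pi H = X H * T1 H"

definition one0 :: "complex \<Rightarrow> ('h::ring_1) daha \<Rightarrow> 'h" where
  "one0 th H = T1 H + scal H (inverse th)"

definition eta_pi :: "('h::ring_1) daha \<Rightarrow> 'h" where
  "eta_pi H = tau_pi H"

definition eta_s1 :: "complex \<Rightarrow> ('h::ring_1) daha \<Rightarrow> 'h" where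
  "eta_s1 th H = emb H (cst th * ((1 - Ym2) / (1 - cst (th\<^sup>2) * Ym2))) * tau1 th H"

definition eta :: "complex \<Rightarrow> ('h::ring_1) daha \<Rightarrow> int \<Rightarrow> 'h" where
  "eta th H k = zpow (eta_pi H * eta_s1 th H) (eta_s1 th H * eta_pi H) k"

text \<open>
  The DAHA itself.  Being free over \<open>\<complex>[Y, Y\<^sup>-\<^sup>1]\<close>, it embeds in its localization as
  the subalgebra generated by the generators and their inverses.
\<close>

inductive_set daha_int :: "('h::ring_1) daha \<Rightarrow> 'h set" for H where
  scal: "scal H c \<in> daha_int H"
| T1: "T1 H \<in> daha_int H"
| T1inv: "T1inv H \<in> daha_int H"
| X: "X H \<in> daha_int H"
| Xinv: "Xinv H \<in> daha_int H"
| Y: "Y H \<in> daha_int H"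
| Yinv: "Yinv H \<in> daha_int H"
| Tpi: "Tpi H \<in> daha_int H"
| Tpiinv: "Tpiinv H \<in> daha_int H"
| add: "a \<in> daha_int H \<Longrightarrow> b \<in> daha_int H \<Longrightarrow> a + b \<in> daha_int H"
| mult: "a \<in> daha_int H \<Longrightarrow> b \<in> daha_int H \<Longrightarrow> a * b \<in> daha_int H"

text \<open>
  The module generated by \<open>\<one>\<^sub>Y\<close> with relations \<open>T\<^sub>1 \<one>\<^sub>Y = th \<one>\<^sub>Y\<close> and
  \<open>T\<^sub>\<pi> \<one>\<^sub>Y = \<one>\<^sub>Y\<close> is the quotient of the DAHA by the left ideal generated by
  \<open>T\<^sub>1 - th\<close> and \<open>T\<^sub>\<pi> - 1\<close>.  For \<open>a\<close>, \<open>b\<close> in the DAHA,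
  \<open>poly_rep_eq th H a b\<close> says \<open>a \<one>\<^sub>Y = b \<one>\<^sub>Y\<close>.
\<close>

definition ann_1Y :: "complex \<Rightarrow> ('h::ring_1) daha \<Rightarrow> 'h set" where
  "ann_1Y th H =
     {a * (T1 H - scal H th) + b * (Tpi H - 1) | a b. a \<in> daha_int H \<and> b \<in> daha_int H}"

definition poly_rep_eq :: "complex \<Rightarrow> ('h::ring_1) daha \<Rightarrow> 'h \<Rightarrow> 'h \<Rightarrow> bool" where
  "poly_rep_eq th H a b \<longleftrightarrow> a - b \<in> ann_1Y th H"

definition Y_eigenvalue :: "complex \<Rightarrow> complex \<Rightarrow> int \<Rightarrow> complex" where
  "Y_eigenvalue qh th m =
     (if m > 0 then inverse th * qh powi (- m) else th * qh powi (- m))"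

definition electronic :: "complex \<Rightarrow> complex \<Rightarrow> ('h::ring_1) daha \<Rightarrow> int \<Rightarrow> laurent" where
  "electronic qh th H m =
     (THE p. poly_rep_eq th H (Y H * laurent_X H p)
               (scal H (Y_eigenvalue qh th m) * laurent_X H p)
           \<and> Poly_Mapping.lookup p m = 1)"

definition E_X :: "complex \<Rightarrow> complex \<Rightarrow> ('h::ring_1) daha \<Rightarrow> int \<Rightarrow> 'h" where
  "E_X qh th H m = laurent_X H (electronic qh th H m)"

definition qpoch :: "'a::comm_ring_1 \<Rightarrow> 'a \<Rightarrow> nat \<Rightarrow> 'a" where
  "qpoch z q j = (\<Prod>i<j. 1 - z * q ^ i)"

definition qt_binom :: "complex \<Rightarrow> complex \<Rightarrow> nat \<Rightarrow> nat \<Rightarrow> complex" where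
  "qt_binom q t l j =
     (qpoch q q l / qpoch t q l) /
     ((qpoch q q j / qpoch t q j) * (qpoch q q (l - j) / qpoch t q (l - j)))"

definition Y_binom :: "complex \<Rightarrow> complex \<Rightarrow> nat \<Rightarrow> nat \<Rightarrow> ratfun" where
  "Y_binom q t l j =
     (qpoch (cst (inverse t) * Ym2 * cst (q powi (- (int j - 1)))) (cst q) (l - j) *
      qpoch (cst t * Ym2 * cst (q powi (int l - 2 * int j))) (cst q) j) /
     (qpoch (Ym2 * cst q) (cst q) (l - j) *
      qpoch (Ym2 * cst (q powi (- int j))) (cst q) j)"

definition D_plus :: "complex \<Rightarrow> complex \<Rightarrow> nat \<Rightarrow> nat \<Rightarrow> ratfun" where
  "D_plus qh th l j = (let q = qh\<^sup>2; t = th\<^sup>2 in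
     cst (th powi (- (int l + 1))) * cst (t ^ (l - j)) *
     cst (qt_binom q t l j) * Y_binom q t l j *
     (cst (1 - t * q ^ (l - j)) / cst (1 - t * q ^ l)) *
     ((1 - cst t * Ym2 * cst (q ^ (l - j))) /
      (1 - cst t * Ym2 * cst (q powi (int l - 2 * int j)))))"

definition D_minus :: "complex \<Rightarrow> complex \<Rightarrow> nat \<Rightarrow> nat \<Rightarrow> ratfun" where
  "D_minus qh th l j = (let q = qh\<^sup>2; t = th\<^sup>2 in
     cst (th powi (- int l)) * cst ((q * t) ^ j) *
     cst (qt_binom q t l j) * Y_binom q t l (l - j) *
     (cst (1 - t * q ^ (l - j)) / cst (1 - t * q ^ l)) *
     ((1 - cst (inverse t) * Ym2 * cst (q powi (- (int l - int j)))) /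
      (1 - cst (inverse t) * Ym2 * cst (q powi (- (int l - 2 * int j))))))"

definition K_coeff :: "complex \<Rightarrow> complex \<Rightarrow> nat \<Rightarrow> nat \<Rightarrow> ratfun" where
  "K_coeff qh th l j = (let q = qh\<^sup>2; t = th\<^sup>2 in
     cst (th powi (- (int l - 1))) * cst (t powi (int l - 1 - int j)) *
     cst (qt_binom q t l j) * Y_binom q t l j *
     ((1 - Ym2 * cst (q powi (int l - 2 * int j))) /
      (1 - cst (inverse t) * Ym2 * cst (q powi (int l - 2 * int j)))) *
     ((1 - cst (inverse t) * Ym2) / (1 - Ym2)))"

end

theory Submission
  imports Defs "HOL-Computational_Algebra.Fundamental_Theorem_Algebra"
begin

text \<open>
  Everything rests on the intertwiners \<open>p = \<eta>\<^sub>\<pi>\<close> and \<open>s = \<eta>\<^sub>s\<^sub>1\<close>. Both are involutions, and they move a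
  rational function across themselves by \<open>s f(Y) = f(1/Y) s\<close> and \<open>p f(Y) = f(1/(q\<^sup>1\<^sup>/\<^sup>2 Y)) p\<close>
  (lemmas \<open>s_commute\<close>, \<open>p_commute\<close>), so \<open>\<eta> = p s\<close> acts on \<open>\<complex>(Y)\<close> by rescaling \<open>Y\<close>. Written in terms of
  \<open>s\<close>, the generator \<open>T\<^sub>1\<close> has only the two coefficients \<open>phi\<close> and \<open>phi' - t\<^sup>-\<^sup>1\<^sup>/\<^sup>2\<close>, where
  \<open>phi' = phi(1/Y)\<close>, and \<open>\<one>\<^sub>0 = (1 + s) phi'\<close> absorbs \<open>s\<close> on its left.

  Uniqueness of the three expansions reduces to the fact that the elements \<open>\<eta>\<^sup>k\<close> and \<open>\<eta>\<^sup>k s\<close> are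
  independent over \<open>\<complex>(Y)\<close>. This follows by counting: the elements \<open>X\<^sup>k\<close> and \<open>X\<^sup>k T\<^sub>1\<close> with \<open>\<bar>k\<bar> \<le> n\<close> are
  part of a basis and lie in the span of as many elements \<open>\<eta>\<^sup>k\<close>, \<open>\<eta>\<^sup>k s\<close> (lemma \<open>eta_fam_independent\<close>).

  The polynomials \<open>E\<^sub>m\<close> are generated from \<open>E\<^sub>0 = 1\<close> by two moves, each of which changes an eigenvector
  of \<open>Y\<close> into another one: \<open>E\<^sub>l\<^sub>+\<^sub>1\<close> is \<open>t\<^sup>-\<^sup>1\<^sup>/\<^sup>2 p E\<^sub>-\<^sub>l\<close>, and \<open>E\<^sub>-\<^sub>l\<close> is \<open>t\<^sup>1\<^sup>/\<^sup>2 (T\<^sub>1 + c) E\<^sub>l\<close> where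
  \<open>c\<close> is the value that \<open>t\<^sup>-\<^sup>1\<^sup>/\<^sup>2 (1 - t)/(1 - Y\<^sup>-\<^sup>2)\<close> takes at the eigenvalue. Both identities hold modulo the left
  ideal generated by \<open>T\<^sub>1 - t\<^sup>1\<^sup>/\<^sup>2\<close>. This ideal annihilates \<open>\<one>\<^sub>0\<close>, so they become exact identities in
  \<open>H \<one>\<^sub>0\<close> (lemmas \<open>E_up\<close>, \<open>E_down\<close>).

  That these eigenvectors really are the \<open>E\<^sub>m\<close> requires the eigenspaces of \<open>Y\<close> in the polynomial
  representation to be one-dimensional, hence some control of the ideal annihilating \<open>\<one>\<^sub>Y\<close>. Inside
  the localized algebra that ideal cannot be seen directly, because \<open>Y - t\<^sup>1\<^sup>/\<^sup>2\<close> has become invertible.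
  Instead, its product with \<open>\<one>\<^sub>0\<close> is contained in the set \<open>vanishing\<close> of combinations of the
  \<open>\<eta>\<^sup>k \<one>\<^sub>0\<close> whose coefficient at \<open>\<eta>\<^sup>k \<one>\<^sub>0\<close> is regular on the spectrum and vanishes at the \<open>k\<close>-th eigenvalue
  (lemma \<open>ann_one0\<close>). Modulo \<open>vanishing\<close>, the \<open>m\<close>-th eigenvector is a nonzero multiple of \<open>\<eta>\<^sup>m \<one>\<^sub>0\<close>.

  Applied to expansions in \<open>\<eta>\<^sup>k f(Y) \<one>\<^sub>0\<close>, the first move inverts \<open>Y\<close> in the coefficients and the second
  gives a two-term recursion. The product formulas satisfy both: after cancellation of common
  linear factors in \<open>Y\<^sup>-\<^sup>2\<close>, the recursion is a quadratic identity in \<open>Y\<^sup>-\<^sup>2\<close> (lemma \<open>D_minus_rec\<close>).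
  Multiplying by \<open>\<one>\<^sub>0\<close> from the left and moving \<open>s\<close> through gives the symmetrized coefficients by a
  similar linear identity (lemma \<open>K_rec\<close>).
\<close>

section \<open>Substitution and evaluation of rational functions\<close>

lemma cst_0 [simp]: "cst 0 = 0" and cst_1 [simp]: "cst 1 = 1"
  by (simp_all add: cst_def Zero_fract_def One_fract_def one_pCons)

lemma cst_add: "cst (a + b) = cst a + cst b"
  and cst_mult: "cst (a * b) = cst a * cst b"
  and cst_minus: "cst (- a) = - cst a"
  by (simp_all add: cst_def mult.commute)

lemma cst_diff: "cst (a - b) = cst a - cst b"
  using cst_add[of a "- b"] by (simp add: cst_minus)

lemma cst_eq_iff [simp]: "cst a = cst b \<longleftrightarrow> a = b"
  by (simp add: cst_def eq_fract)

lemma cst_eq_0_iff [simp]: "cst a = 0 \<longleftrightarrow> a = 0"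
  using cst_eq_iff[of a 0] by simp

lemma cst_inverse: "cst (inverse a) = inverse (cst a)"
proof (cases "a = 0")
  case False
  then have "cst (inverse a) * cst a = 1"
    by (simp flip: cst_mult)
  then show ?thesis
    by (metis inverse_unique mult.commute)
qed simp

lemma cst_divide: "cst (a / b) = cst a / cst b"
  by (simp add: divide_inverse cst_mult cst_inverse)

lemma cst_power: "cst (a ^ n) = cst a ^ n"
  by (induction n) (simp_all add: cst_mult)

lemma Yvar_neq_cst: "Yvar \<noteq> cst c"
  by (simp add: Yvar_def cst_def eq_fract)

lemma Yvar_neq_0 [simp]: "Yvar \<noteq> 0"
  using Yvar_neq_cst[of 0] by simp

definition peval :: "complex poly \<Rightarrow> ratfun \<Rightarrow> ratfun" where
  "peval a g = poly (map_poly cst a) g"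

lemma peval_pCons [simp]: "peval (pCons c a) g = cst c + g * peval a g"
  by (simp add: peval_def map_poly_pCons)

lemma peval_0 [simp]: "peval 0 g = 0"
  by (simp add: peval_def)

lemma peval_1 [simp]: "peval 1 g = 1"
  by (simp add: one_pCons)

lemma peval_add: "peval (a + b) g = peval a g + peval b g"
  by (induction a b rule: poly_induct2) (simp_all add: cst_add algebra_simps)

lemma peval_smult: "peval (smult c a) g = cst c * peval a g"
  by (induction a) (simp_all add: cst_mult algebra_simps)

lemma peval_mult: "peval (a * b) g = peval a g * peval b g"
  by (induction a) (simp_all add: peval_add peval_smult algebra_simps)

lemma peval_Yvar: "peval a Yvar = Fract a 1"
proof (induction a)
  case (pCons c a)
  have "Fract (pCons c a) 1 = Fract [:c:] 1 + Fract [:0, 1:] 1 * Fract a 1"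
    by simp
  then show ?case
    using pCons by (simp add: cst_def Yvar_def)
qed (simp add: Zero_fract_def)

text \<open>
  Since \<open>\<complex>\<close> is algebraically closed, a nonconstant rational function is transcendental over it: a
  polynomial splits into linear factors, and none of them vanishes at a nonconstant \<open>g\<close>.
\<close>

lemma peval_neq_0:
  assumes g: "\<And>r. g \<noteq> cst r" and "b \<noteq> 0"
  shows "peval b g \<noteq> 0"
  using \<open>b \<noteq> 0\<close>
proof (induction "degree b" arbitrary: b)
  case 0
  then obtain c where "b = [:c:]" "c \<noteq> 0"
    by (metis degree_eq_zeroE pCons_0_0)
  then show ?case by simp
next
  case (Suc n)
  then have "\<not> constant (poly b)"
    by (simp add: constant_degree)
  then obtain r where "poly b r = 0"
    using fundamental_theorem_of_algebra by blast
  then obtain b' where b': "b = [:-r, 1:] * b'"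
    by (meson poly_eq_0_iff_dvd dvdE)
  with Suc have "b' \<noteq> 0" by auto
  moreover from this b' Suc have "degree b' = n"
    by (simp add: degree_mult_eq del: mult_pCons_left)
  ultimately have "peval b' g \<noteq> 0" using Suc by blast
  moreover have "peval [:-r, 1:] g \<noteq> 0"
    using g[of r] by (simp add: cst_minus)
  ultimately show ?case by (simp add: b' peval_mult del: mult_pCons_left)
qed

text \<open>
  The value at \<open>f\<close> of the field homomorphism \<open>f(Y) \<mapsto> f(g)\<close>. It is well defined when \<open>g\<close> is not a
  constant, which is the assumption of the locale \<open>nonconstant\<close>.
\<close>

definition subst :: "ratfun \<Rightarrow> ratfun \<Rightarrow> ratfun" where
  "subst g f = (THE r. \<exists>a b. b \<noteq> 0 \<and> f = Fract a b \<and> r = peval a g / peval b g)"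

locale nonconstant =
  fixes g :: ratfun
  assumes nonconst: "\<And>r. g \<noteq> cst r"
begin

lemma subst_Fract:
  assumes "b \<noteq> 0" shows "subst g (Fract a b) = peval a g / peval b g"
  unfolding subst_def
proof (rule the_equality)
  fix r assume "\<exists>a' b'. b' \<noteq> 0 \<and> Fract a b = Fract a' b' \<and> r = peval a' g / peval b' g"
  then obtain a' b' where *: "b' \<noteq> 0" "Fract a b = Fract a' b'" "r = peval a' g / peval b' g"
    by blast
  then have "a * b' = a' * b" using assms by (simp add: eq_fract)
  then have "peval a g * peval b' g = peval a' g * peval b g"
    by (metis peval_mult)
  moreover have "peval b g \<noteq> 0" "peval b' g \<noteq> 0"
    using peval_neq_0[OF nonconst] assms * by blast+
  ultimately show "r = peval a g / peval b g"
    using * by (simp add: frac_eq_eq)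
qed (use assms in blast)

lemma subst_cst [simp]: "subst g (cst c) = cst c"
  by (simp add: cst_def subst_Fract)

lemma subst_0 [simp]: "subst g 0 = 0" and subst_1 [simp]: "subst g 1 = 1"
  using subst_cst[of 0] subst_cst[of 1] by simp_all

lemma subst_Yvar [simp]: "subst g Yvar = g"
  by (simp add: Yvar_def subst_Fract)

lemma subst_add: "subst g (f + f') = subst g f + subst g f'"
proof -
  obtain a b where f: "f = Fract a b" "b \<noteq> 0" by (cases f) auto
  obtain a' b' where f': "f' = Fract a' b'" "b' \<noteq> 0" by (cases f') auto
  show ?thesis
    using peval_neq_0[OF nonconst] f f'
    by (simp add: subst_Fract peval_add peval_mult add_frac_eq)
qed

lemma subst_mult: "subst g (f * f') = subst g f * subst g f'"
proof -
  obtain a b where f: "f = Fract a b" "b \<noteq> 0" by (cases f) auto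
  obtain a' b' where f': "f' = Fract a' b'" "b' \<noteq> 0" by (cases f') auto
  show ?thesis
    using peval_neq_0[OF nonconst] f f'
    by (simp add: subst_Fract peval_add peval_mult)
qed

lemma subst_minus: "subst g (- f) = - subst g f"
  using subst_add[of f "- f"] by (simp add: minus_unique)

lemma subst_diff: "subst g (f - f') = subst g f - subst g f'"
  using subst_add[of f "- f'"] by (simp add: subst_minus)

lemma subst_inverse: "subst g (inverse f) = inverse (subst g f)"
proof (cases "f = 0")
  case False
  then have "subst g (inverse f) * subst g f = 1"
    by (simp flip: subst_mult)
  then show ?thesis by (metis inverse_unique mult.commute)
qed simp

lemma subst_divide: "subst g (f / f') = subst g f / subst g f'"
  by (simp add: divide_inverse subst_mult subst_inverse)

lemma subst_power: "subst g (f ^ n) = subst g f ^ n"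
  by (induction n) (simp_all add: subst_mult)

lemma subst_eq_0_iff [simp]: "subst g f = 0 \<longleftrightarrow> f = 0"
proof
  assume "subst g f = 0"
  then have "subst g (f * inverse f) = 0"
    by (simp add: subst_mult)
  then show "f = 0" by (cases "f = 0") simp_all
qed simp

lemmas subst_simps = subst_add subst_mult subst_minus subst_diff subst_inverse
  subst_divide subst_power

end

text \<open>
  Regularity and value of a rational function at a point, stated through some fraction whose
  denominator does not vanish there, so that no reduced representative has to be chosen.
\<close>

definition has_value :: "ratfun \<Rightarrow> complex \<Rightarrow> complex \<Rightarrow> bool" where
  "has_value f x v \<longleftrightarrow> (\<exists>a b. poly b x \<noteq> 0 \<and> f = Fract a b \<and> v = poly a x / poly b x)"

lemma has_value_cst: "has_value (cst c) x c"
  unfolding has_value_def cst_def by (intro exI[of _ "[:c:]"] exI[of _ 1]) simp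

lemma has_value_Yvar: "has_value Yvar x x"
  unfolding has_value_def Yvar_def by (intro exI[of _ "[:0, 1:]"] exI[of _ 1]) simp

lemma has_value_add:
  assumes "has_value f x v" "has_value g x w" shows "has_value (f + g) x (v + w)"
proof -
  obtain a b c d where
    "poly b x \<noteq> 0" "f = Fract a b" "v = poly a x / poly b x"
    "poly d x \<noteq> 0" "g = Fract c d" "w = poly c x / poly d x"
    using assms unfolding has_value_def by blast
  moreover from this have "b \<noteq> 0" "d \<noteq> 0" by auto
  ultimately show ?thesis
    unfolding has_value_def
    by (intro exI[of _ "a * d + c * b"] exI[of _ "b * d"]) (simp add: add_frac_eq)
qed

lemma has_value_mult:
  assumes "has_value f x v" "has_value g x w" shows "has_value (f * g) x (v * w)"
proof -
  obtain a b c d where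
    "poly b x \<noteq> 0" "f = Fract a b" "v = poly a x / poly b x"
    "poly d x \<noteq> 0" "g = Fract c d" "w = poly c x / poly d x"
    using assms unfolding has_value_def by blast
  then show ?thesis
    unfolding has_value_def
    by (intro exI[of _ "a * c"] exI[of _ "b * d"]) simp
qed

lemma has_value_inverse:
  assumes "has_value f x v" "v \<noteq> 0" shows "has_value (inverse f) x (inverse v)"
proof -
  obtain a b where
    "poly b x \<noteq> 0" "f = Fract a b" "v = poly a x / poly b x"
    using assms unfolding has_value_def by blast
  then show ?thesis
    using \<open>v \<noteq> 0\<close> unfolding has_value_def
    by (intro exI[of _ b] exI[of _ a]) auto
qed

lemma has_value_divide:
  "has_value f x v \<Longrightarrow> has_value g x w \<Longrightarrow> w \<noteq> 0 \<Longrightarrow> has_value (f / g) x (v / w)"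
  by (simp add: divide_inverse has_value_mult has_value_inverse)

lemma has_value_minus: "has_value f x v \<Longrightarrow> has_value (- f) x (- v)"
  using has_value_mult[OF has_value_cst[of "- 1"], of f x v] by (simp add: cst_minus)

lemma has_value_diff:
  "has_value f x v \<Longrightarrow> has_value g x w \<Longrightarrow> has_value (f - g) x (v - w)"
  using has_value_add[OF _ has_value_minus[of g x w], of f v] by simp

lemma has_value_power: "has_value f x v \<Longrightarrow> has_value (f ^ n) x (v ^ n)"
  using has_value_cst[of 1] by (induction n) (simp_all add: has_value_mult)

lemma has_value_cst_unique:
  assumes "has_value (cst c) x v" shows "v = c"
proof -
  obtain a b where *: "poly b x \<noteq> 0" "cst c = Fract a b" "v = poly a x / poly b x"
    using assms unfolding has_value_def by blast
  then have "b \<noteq> 0" by auto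
  with * have "a = smult c b" by (simp add: cst_def eq_fract)
  with * show ?thesis by simp
qed

lemma has_value_peval:
  assumes "has_value g x y" shows "has_value (peval a g) x (poly a y)"
  using has_value_cst[of 0]
  by (induction a) (simp_all add: assms has_value_add has_value_mult has_value_cst)

lemma has_value_subst:
  assumes g: "\<And>r. g \<noteq> cst r" and "has_value g x y" "has_value f y v"
  shows "has_value (subst g f) x v"
proof -
  interpret nonconstant g by unfold_locales (rule g)
  obtain a b where "poly b y \<noteq> 0" "f = Fract a b" "v = poly a y / poly b y"
    using assms unfolding has_value_def by blast
  moreover from this have "b \<noteq> 0" by auto
  ultimately show ?thesis
    using assms(2) by (simp add: subst_Fract has_value_divide has_value_peval)
qed

section \<open>Intertwiners in the localized algebra\<close>

lemma Ym2_neq_cst: "Ym2 \<noteq> cst c"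
proof
  assume "Ym2 = cst c"
  then have "Ym2 * Yvar ^ 2 = cst c * Yvar ^ 2" by simp
  then have "1 = cst c * Yvar ^ 2" by (simp add: Ym2_def)
  then show False
    by (simp add: cst_def Yvar_def One_fract_def eq_fract power2_eq_square one_pCons)
qed

lemma Ym2_neq_0 [simp]: "Ym2 \<noteq> 0"
  by (simp add: Ym2_def)

lemma one_minus_cst_Ym2_neq_0 [simp]:
  shows "1 - cst c * Ym2 \<noteq> 0" "1 - Ym2 * cst c \<noteq> 0" "1 - Ym2 \<noteq> 0"
proof -
  show *: "1 - cst c * Ym2 \<noteq> 0" for c
  proof
    assume *: "1 - cst c * Ym2 = 0"
    then have "cst c * Ym2 = 1" by simp
    then have "Ym2 = cst (inverse c)" by (simp add: cst_inverse inverse_unique)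
    then show False using Ym2_neq_cst by blast
  qed
  from *[of c] show "1 - Ym2 * cst c \<noteq> 0" by (simp add: mult.commute)
  from *[of 1] show "1 - Ym2 \<noteq> 0" by simp
qed

lemma cst_Ym2_neq_1 [simp]:
  "cst c * Ym2 \<noteq> 1" "Ym2 * cst c \<noteq> 1" "Ym2 \<noteq> 1"
  "1 \<noteq> cst c * Ym2" "1 \<noteq> Ym2 * cst c" "1 \<noteq> Ym2"
  using one_minus_cst_Ym2_neq_0(1)[of c] one_minus_cst_Ym2_neq_0(3)
  by (auto simp: mult.commute)

lemma nonconstant_inverse:
  assumes "\<And>r. g \<noteq> cst r" shows "inverse g \<noteq> cst r"
proof
  assume "inverse g = cst r"
  then have "g = cst (inverse r)" by (metis cst_inverse inverse_inverse_eq)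
  then show False using assms by blast
qed

lemma nonconstant_mult:
  assumes "\<And>r. g \<noteq> cst r" "c \<noteq> 0" shows "cst c * g \<noteq> cst r"
proof
  assume "cst c * g = cst r"
  then have "g = cst (r / c)" using assms(2) by (simp add: cst_divide field_simps)
  then show False using assms by blast
qed

lemmas cst_simps = cst_add cst_diff cst_mult cst_power cst_inverse cst_divide cst_minus

lemma zpow_0 [simp]: "zpow a b 0 = 1" and zpow_1 [simp]: "zpow a b 1 = a"
  and zpow_m1 [simp]: "zpow a b (- 1) = b"
  by (simp_all add: zpow_def)

context
  fixes a b :: "'a::ring_1"
  assumes ab: "a * b = 1" and ba: "b * a = 1"
begin

lemma zpow_succ: "zpow a b (k + 1) = a * zpow a b k"
proof (cases "0 \<le> k")
  case True
  then show ?thesis by (simp add: zpow_def nat_add_distrib)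
next
  case False
  then have *: "nat (- k) = Suc (nat (- k - 1))" by linarith
  have "zpow a b k = b * zpow a b (k + 1)"
    using False * by (cases "k = - 1") (auto simp: zpow_def minus_diff_commute)
  then show ?thesis by (simp add: ab flip: mult.assoc)
qed

lemma zpow_pred: "zpow a b (k - 1) = b * zpow a b k"
  using zpow_succ[of "k - 1"] by (simp add: ba flip: mult.assoc)

lemma zpow_add: "zpow a b (j + k) = zpow a b j * zpow a b k"
proof (induction j rule: int_induct[where k = 0])
  case (step1 i)
  then show ?case
    using zpow_succ[of "i + k"] zpow_succ[of i] by (simp add: mult.assoc algebra_simps)
next
  case (step2 i)
  have "zpow a b (i - 1 + k) = zpow a b (i + k - 1)" by (simp add: algebra_simps)
  then show ?case
    using step2 by (simp add: zpow_pred mult.assoc)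
qed simp

end

text \<open>
  Turns an equation between products into a rewrite rule for right-associated products.
\<close>

lemma mult_assoc_cong: "a * b = c \<Longrightarrow> a * (b * x) = c * (x::'a::semigroup_mult)"
  by (metis mult.assoc)

locale localized_DAHA =
  fixes qh th :: complex and H :: "('h::ring_1) daha"
  assumes generic: "generic_parameters qh th" and daha: "localized_daha qh th H"
begin

abbreviation q :: complex where "q \<equiv> qh\<^sup>2"
abbreviation t :: complex where "t \<equiv> th\<^sup>2"
abbreviation e :: "ratfun \<Rightarrow> 'h" where "e \<equiv> emb H"
abbreviation u0 :: 'h where "u0 \<equiv> one0 th H"
abbreviation s :: 'h where "s \<equiv> eta_s1 th H"
abbreviation p :: 'h where "p \<equiv> eta_pi H"
abbreviation et :: "int \<Rightarrow> 'h" where "et \<equiv> eta th H"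
abbreviation \<delta> :: complex where "\<delta> \<equiv> th - inverse th"

lemma qh_neq_0 [simp]: "qh \<noteq> 0" and th_neq_0 [simp]: "th \<noteq> 0"
  using generic by (simp_all add: generic_parameters_def)

lemma q_t_indep: "q powi a * t powi b = 1 \<Longrightarrow> a = 0 \<and> b = 0"
  using generic unfolding generic_parameters_def by blast

lemma e_1 [simp]: "e 1 = 1" and e_add: "e (f + g) = e f + e g"
  and e_mult: "e (f * g) = e f * e g"
  using daha unfolding localized_daha_def by blast+

lemma e_0 [simp]: "e 0 = 0"
  using e_add[of 0 0] by simp

lemma e_minus: "e (- f) = - e f"
  using e_add[of f "- f"] by (simp add: minus_unique)

lemma e_diff: "e (f - g) = e f - e g"
  using e_add[of f "- g"] by (simp add: e_minus)

lemma e_inverse: "f \<noteq> 0 \<Longrightarrow> e f * e (inverse f) = 1" "f \<noteq> 0 \<Longrightarrow> e (inverse f) * e f = 1"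
  by (simp_all flip: e_mult)

lemma e_cst_central: "e (cst c) * h = h * e (cst c)"
  using daha unfolding localized_daha_def scal_def by blast

lemma T1_T1inv: "T1 H * T1inv H = 1" and T1inv_T1: "T1inv H * T1 H = 1"
  and X_Xinv: "X H * Xinv H = 1" and Xinv_X: "Xinv H * X H = 1"
  and Tpi_Tpiinv: "Tpi H * Tpiinv H = 1"
  and Tpi_eq: "Tpi H = e Yvar * T1inv H"
  and Tpi_eq': "Tpi H = T1 H * e (inverse Yvar)"
  and Tpi_X: "Tpi H * X H * Tpiinv H = e (cst qh) * Xinv H"
  and T1_X_T1: "T1 H * X H * T1 H = Xinv H"
  and T1_Yinv_T1: "T1 H * e (inverse Yvar) * T1 H = e Yvar"
  and quadratic: "(T1 H - e (cst th)) * (T1 H + e (cst (inverse th))) = 0"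
  using daha unfolding localized_daha_def scal_def Y_def Yinv_def by blast+

lemma T1_sq: "T1 H * T1 H = e (cst \<delta>) * T1 H + 1"
proof -
  have "T1 H * T1 H + T1 H * e (cst (inverse th)) - e (cst th) * T1 H - e (cst th * cst (inverse th)) = 0"
    using quadratic by (simp add: algebra_simps e_mult)
  moreover have "cst th * cst (inverse th) = 1"
    by (simp flip: cst_mult)
  ultimately show ?thesis
    by (simp add: e_cst_central[of _ "T1 H"] cst_diff e_diff left_diff_distrib)
       (simp add: algebra_simps)
qed

lemma T1inv_eq: "T1inv H = T1 H - e (cst \<delta>)"
proof -
  have "(T1 H * T1 H) * T1inv H = (e (cst \<delta>) * T1 H + 1) * T1inv H"
    by (simp add: T1_sq)
  then show ?thesis by (simp add: mult.assoc T1_T1inv algebra_simps)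
qed

text \<open>
  If \<open>u Y = g u\<close> then \<open>u\<close> carries every \<open>f(Y)\<close> to \<open>f(g)\<close>: for polynomials by linearity, and for a
  quotient by inverting the relation for the denominator, which stays nonzero because \<open>g\<close> is
  transcendental. The commutation rules of all intertwiners are instances.
\<close>

lemma e_commute_subst:
  assumes g: "\<And>r. g \<noteq> cst r" and u: "u * e Yvar = e g * u"
  shows "u * e f = e (subst g f) * u"
proof -
  interpret nonconstant g by unfold_locales (rule g)
  have poly: "u * e (peval a Yvar) = e (peval a g) * u" for a
  proof (induction a)
    case (pCons c a)
    have "u * e (peval (pCons c a) Yvar) = u * e (cst c) + u * e Yvar * e (peval a Yvar)"
      by (simp add: e_add e_mult algebra_simps)
    also have "\<dots> = e (cst c) * u + e g * (u * e (peval a Yvar))"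
      by (simp only: u e_cst_central[of c u] mult.assoc)
    finally show ?case by (simp add: pCons e_add e_mult algebra_simps)
  qed simp
  obtain a b where f: "f = Fract a b" "b \<noteq> 0" by (cases f) auto
  have fab: "f = peval a Yvar * inverse (peval b Yvar)"
    using f by (simp add: peval_Yvar)
  have b: "peval b g \<noteq> 0" "peval b Yvar \<noteq> 0"
    using peval_neq_0[OF g \<open>b \<noteq> 0\<close>] peval_neq_0[OF Yvar_neq_cst \<open>b \<noteq> 0\<close>] by auto
  have "e (inverse (peval b g)) * (u * e (peval b Yvar)) * e (inverse (peval b Yvar))
      = e (inverse (peval b g)) * (e (peval b g) * u) * e (inverse (peval b Yvar))"
    by (simp add: poly)
  then have "e (inverse (peval b g)) * u = u * e (inverse (peval b Yvar))"
    by (simp add: mult.assoc e_inverse b mult_assoc_cong[OF e_inverse(2)])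
  then have "u * e f = e (peval a g) * (e (inverse (peval b g)) * u)"
    unfolding fab by (simp add: e_mult poly flip: mult.assoc)
  then show ?thesis
    by (simp add: f subst_Fract divide_inverse e_mult mult.assoc)
qed

text \<open>
  The images of \<open>Y\<close> when it is moved to the left of \<open>s\<close>, of \<open>p\<close> and of \<open>\<eta>\<^sup>k\<close>.
\<close>

definition gs :: ratfun where "gs = inverse Yvar"
definition gp :: ratfun where "gp = cst (inverse qh) * inverse Yvar"
definition gsh :: "int \<Rightarrow> ratfun" where "gsh k = cst (qh powi k) * Yvar"

lemma gs_nonconst: "gs \<noteq> cst r" and gp_nonconst: "gp \<noteq> cst r" and gsh_nonconst: "gsh k \<noteq> cst r"
  unfolding gs_def gp_def gsh_def
  by (intro nonconstant_inverse nonconstant_mult Yvar_neq_cst; simp)+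

sublocale gs: nonconstant gs by unfold_locales (rule gs_nonconst)
sublocale gp: nonconstant gp by unfold_locales (rule gp_nonconst)
sublocale gsh: nonconstant "gsh k" for k by unfold_locales (rule gsh_nonconst)

declare gs.subst_Yvar [simp del] gp.subst_Yvar [simp del] gsh.subst_Yvar [simp del]

lemma subst_Yvar_simps [simp]:
  "subst gs Yvar = inverse Yvar"
  "subst gp Yvar = cst (inverse qh) * inverse Yvar"
  "subst (gsh k) Yvar = cst (qh powi k) * Yvar"
  using gs.subst_Yvar gp.subst_Yvar gsh.subst_Yvar[of k]
  unfolding gs_def gp_def gsh_def .

lemma subst_gs_Ym2: "subst gs Ym2 = inverse Ym2"
  and subst_gsh_Ym2: "subst (gsh k) Ym2 = cst (q powi (- k)) * Ym2"
proof -
  show "subst gs Ym2 = inverse Ym2"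
    unfolding Ym2_def by (simp add: gs.subst_simps power_inverse)
  have "inverse ((qh powi k)\<^sup>2) = q powi (- k)"
    by (simp add: power_int_minus power_int_power power_int_power' mult.commute)
  then show "subst (gsh k) Ym2 = cst (q powi (- k)) * Ym2"
    unfolding Ym2_def
    by (simp add: gsh.subst_simps power_mult_distrib flip: cst_power cst_inverse)
qed

text \<open>
  The coefficients of \<open>\<one>\<^sub>0\<close> in the basis \<open>s, 1\<close>; inversion of \<open>Y\<close> exchanges them.
\<close>

definition phi :: ratfun where
  "phi = (1 - cst t * Ym2) / (cst th * (1 - Ym2))"
definition phi' :: ratfun where
  "phi' = (cst t - Ym2) / (cst th * (1 - Ym2))"

lemma subst_gs_phi: "subst gs phi = phi'" and subst_gs_phi': "subst gs phi' = phi"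
proof -
  have "inverse Ym2 \<noteq> 1"
    using cst_Ym2_neq_1(3) inverse_eq_1_iff by blast
  then show "subst gs phi = phi'" "subst gs phi' = phi"
    unfolding phi_def phi'_def
    by (simp_all add: gs.subst_simps subst_gs_Ym2 divide_simps) (auto simp: algebra_simps)
qed

lemma phi_neq_0 [simp]: "phi \<noteq> 0"
  by (simp add: phi_def)

lemma phi'_neq_0 [simp]: "phi' \<noteq> 0"
  using subst_gs_phi by (metis gs.subst_eq_0_iff phi_neq_0)

definition tau1_coeff :: ratfun where "tau1_coeff = cst (inverse th) * ((1 - cst t) / (1 - Ym2))"

lemma tau1_eq: "tau1 th H = T1 H + e tau1_coeff"
  by (simp add: tau1_def tau1_coeff_def)

lemma tau1_coeff_alt: "tau1_coeff = - cst \<delta> / (1 - Ym2)"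
proof -
  have "cst (inverse th) * (1 - cst t) = - cst \<delta>"
    by (simp add: cst_simps divide_simps power2_eq_square)
  then show ?thesis by (simp add: tau1_coeff_def)
qed

text \<open>
  The correction \<open>tau1_coeff\<close> is the rational function for which the inhomogeneous term in
  \<open>T\<^sub>1 Y\<^sup>-\<^sup>1 = Y T\<^sub>1 - (t\<^sup>1\<^sup>/\<^sup>2 - t\<^sup>-\<^sup>1\<^sup>/\<^sup>2) Y\<close> disappears.
\<close>

lemma tau1_commute: "tau1 th H * e f = e (subst gs f) * tau1 th H"
proof (rule e_commute_subst[OF gs_nonconst])
  let ?u = "tau1 th H"
  have "T1 H * e (inverse Yvar) = T1 H * e (inverse Yvar) * T1 H * T1inv H"
    by (simp add: mult.assoc T1_T1inv)
  also have "\<dots> = e Yvar * T1 H - e (Yvar * cst \<delta>)"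
    by (simp add: T1_Yinv_T1 T1inv_eq e_mult right_diff_distrib)
  finally have "?u * e (inverse Yvar) = e Yvar * T1 H + e (tau1_coeff * inverse Yvar - Yvar * cst \<delta>)"
    by (simp add: tau1_eq algebra_simps e_diff flip: e_mult)
  also have "tau1_coeff * inverse Yvar - Yvar * cst \<delta> = Yvar * tau1_coeff"
    using one_minus_cst_Ym2_neq_0(3)
    unfolding tau1_coeff_alt by (simp add: Ym2_def field_simps power2_eq_square)
  finally have *: "?u * e (inverse Yvar) = e Yvar * ?u"
    by (simp add: tau1_eq algebra_simps e_mult)
  have "e (inverse Yvar) * (?u * e (inverse Yvar)) * e Yvar = e (inverse Yvar) * (e Yvar * ?u) * e Yvar"
    by (simp add: *)
  then show "?u * e Yvar = e gs * ?u"
    by (simp add: gs_def mult.assoc e_inverse mult_assoc_cong[OF e_inverse(2)])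
qed

lemma s_def': "s = e (inverse phi) * tau1 th H"
  unfolding eta_s1_def phi_def by (simp add: field_simps)

lemma tau1_eq_phi_s: "tau1 th H = e phi * s"
  by (simp add: s_def' mult_assoc_cong[OF e_inverse(1)])

lemma s_commute: "s * e f = e (subst gs f) * s"
  by (simp add: s_def' mult.assoc tau1_commute)
     (simp add: mult.commute flip: mult.assoc e_mult)

lemma tau1_coeff_phi: "phi' - cst (inverse th) = - tau1_coeff" 
  unfolding phi'_def tau1_coeff_def
  by (simp add: cst_simps divide_simps algebra_simps)

lemma T1_eq: "T1 H = e phi * s + e (phi' - cst (inverse th))"
  using tau1_eq tau1_eq_phi_s by (simp add: tau1_coeff_phi e_minus algebra_simps)

lemma one0_eq: "u0 = e phi * s + e phi'"
  by (simp add: one0_def T1_eq scal_def e_diff)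

text \<open>
  The quadratic relation and the commutation rule of \<open>\<tau>\<^sub>1\<close> show that \<open>\<tau>\<^sub>1\<^sup>2\<close> is the function \<open>phi phi'\<close>; dividing
  \<open>\<tau>\<^sub>1\<close> by \<open>phi\<close> therefore normalizes it to an involution.
\<close>

lemma s_s: "s * s = 1"
proof -
  let ?u = "tau1 th H" and ?c' = "subst gs tau1_coeff"
  have c': "tau1_coeff + ?c' = - cst \<delta>"
    using one_minus_cst_Ym2_neq_0(3)
    by (simp add: tau1_coeff_alt gs.subst_simps subst_gs_Ym2 divide_simps) (simp add: algebra_simps)
  have T1: "T1 H = ?u - e tau1_coeff" by (simp add: tau1_eq)
  have "T1 H * ?u = T1 H * T1 H + T1 H * e tau1_coeff"
    by (simp add: tau1_eq algebra_simps)
  also have "T1 H * e tau1_coeff = e ?c' * ?u - e (tau1_coeff * tau1_coeff)"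
    by (simp add: T1 left_diff_distrib tau1_commute e_mult)
  also have "T1 H * T1 H = e (cst \<delta>) * ?u - e (cst \<delta> * tau1_coeff) + 1"
    unfolding T1_sq by (simp add: T1 right_diff_distrib flip: e_mult)
  finally have "?u * ?u = e (cst \<delta> + ?c' + tau1_coeff) * ?u + e (1 - cst \<delta> * tau1_coeff - tau1_coeff * tau1_coeff)"
    by (subst (1) tau1_eq) (simp add: algebra_simps e_add e_diff flip: e_mult)
  then have uu: "?u * ?u = e (1 - cst \<delta> * tau1_coeff - tau1_coeff * tau1_coeff)"
    using c' by (simp add: add.assoc add.commute[of tau1_coeff])
  have "s * s = e (inverse phi * inverse phi') * (?u * ?u)"
    by (simp add: s_def' mult.assoc mult_assoc_cong[OF tau1_commute] e_mult gs.subst_simps subst_gs_phi)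
  also have "\<dots> = e (inverse phi * inverse phi' * (1 - cst \<delta> * tau1_coeff - tau1_coeff * tau1_coeff))"
    by (simp only: uu e_mult)
  also have "1 - cst \<delta> * tau1_coeff - tau1_coeff * tau1_coeff = phi * phi'"
    using one_minus_cst_Ym2_neq_0(3)
    unfolding tau1_coeff_alt phi_def phi'_def cst_simps
    by (simp add: divide_simps) (simp add: algebra_simps power2_eq_square)
  also have "inverse phi * inverse phi' * (phi * phi') = 1"
    by (simp add: field_simps)
  finally show ?thesis by simp
qed

lemma s_one0: "s * u0 = u0"
  by (simp add: one0_eq distrib_left s_commute subst_gs_phi subst_gs_phi' mult_assoc_cong[OF s_commute] s_s)
     (simp add: mult.assoc s_s add.commute)

lemma one0_alt: "u0 = (1 + s) * e phi'"
  by (simp add: one0_eq distrib_right s_commute subst_gs_phi' add.commute)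

lemma T1_one0: "T1 H * u0 = e (cst th) * u0"
proof -
  have "(T1 H - e (cst th)) * u0 = 0"
    using quadratic by (simp add: one0_def scal_def)
  then show ?thesis by (simp add: algebra_simps)
qed

lemma p_def': "p = X H * T1 H"
  by (simp add: eta_pi_def tau_pi_def)

lemma p_p: "p * p = 1"
  using T1_X_T1 X_Xinv by (simp add: p_def' mult.assoc)

lemma X_eq: "X H = p * T1inv H"
  by (simp add: p_def' mult.assoc T1_T1inv)

lemma Xinv_eq: "Xinv H = T1 H * p"
  by (simp add: p_def' flip: T1_X_T1 mult.assoc)

lemma Tpi_T1: "Tpi H * T1 H = e Yvar"
  by (simp add: Tpi_eq mult.assoc T1inv_T1)

lemma Tpi_Tpi: "Tpi H * Tpi H = 1"
  by (subst (2) Tpi_eq') (simp add: Tpi_T1 e_inverse flip: mult.assoc)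

lemma Tpiinv_eq: "Tpiinv H = Tpi H"
proof -
  have "Tpi H * Tpi H * Tpiinv H = Tpi H"
    by (simp add: mult.assoc Tpi_Tpiinv)
  then show ?thesis by (simp add: Tpi_Tpi)
qed

text \<open>
  Since \<open>Y = T\<^sub>\<pi> T\<^sub>1\<close>, the relation \<open>X T\<^sub>\<pi> X = q\<^sup>1\<^sup>/\<^sup>2 T\<^sub>\<pi>\<close> gives \<open>q\<^sup>1\<^sup>/\<^sup>2 Y p = p Y\<^sup>-\<^sup>1\<close>.
\<close>

lemma p_commute: "p * e f = e (subst gp f) * p"
proof (rule e_commute_subst[OF gp_nonconst])
  have "Tpi H * X H * Tpi H = e (cst qh) * Xinv H"
    using Tpi_X by (simp add: Tpiinv_eq)
  then have 1: "X H * Tpi H * X H = e (cst qh) * Tpi H"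
  proof -
    assume *: "Tpi H * X H * Tpi H = e (cst qh) * Xinv H"
    have "Tpi H * (Tpi H * X H * Tpi H) * X H = Tpi H * e (cst qh) * Xinv H * X H"
      unfolding * by (simp only: mult.assoc)
    then show ?thesis
      by (simp add: mult.assoc mult_assoc_cong[OF Tpi_Tpi] Xinv_X e_cst_central[of _ "Tpi H"])
  qed
  have "e (cst qh) * e Yvar * p = e (cst qh) * Tpi H * (T1 H * X H * T1 H)"
    by (simp add: p_def' mult.assoc flip: Tpi_T1)
  also have "\<dots> = X H * Tpi H * X H * Xinv H"
    by (simp add: T1_X_T1 1)
  also have "\<dots> = X H * Tpi H"
    by (simp add: mult.assoc X_Xinv)
  also have "\<dots> = p * e (inverse Yvar)"
    by (simp add: p_def' Tpi_eq' mult.assoc)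
  finally have 3: "e (cst qh * Yvar) * p = p * e (inverse Yvar)"
    by (simp add: e_mult)
  have "gp * (cst qh * Yvar) = 1"
    unfolding gp_def cst_inverse by (simp add: field_simps)
  then have "p * e Yvar = e gp * (e (cst qh * Yvar) * p) * e Yvar"
    by (simp flip: mult.assoc e_mult)
  also have "\<dots> = e gp * p"
    by (simp add: 3 mult.assoc e_inverse)
  finally show "p * e Yvar = e gp * p" .
qed

lemma et_def': "et k = zpow (p * s) (s * p) k"
  by (simp add: eta_def)

lemma ps_sp: "(p * s) * (s * p) = 1" "(s * p) * (p * s) = 1"
  by (simp_all add: mult.assoc mult_assoc_cong[OF s_s] mult_assoc_cong[OF p_p] s_s p_p)

lemma et_0 [simp]: "et 0 = 1" by (simp add: et_def')

lemma et_add: "et (j + k) = et j * et k"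
  unfolding et_def' by (rule zpow_add[OF ps_sp])

lemma et_1: "et 1 = p * s" and et_m1: "et (- 1) = s * p"
  by (simp_all add: et_def')

lemma s_et: "s * et k = et (- k) * s"
proof (induction k rule: int_induct[where k = 0])
  case (step1 i)
  have "s * et (i + 1) = et (- i) * (s * et 1)"
    by (simp add: et_add step1 flip: mult.assoc)
  also have "s * et 1 = et (- 1) * s"
    by (simp add: et_1 et_m1 mult.assoc)
  also have "et (- i) * (et (- 1) * s) = et (- (i + 1)) * s"
    by (simp add: mult_assoc_cong[OF et_add[symmetric]])
  finally show ?case .
next
  case (step2 i)
  have "s * et (i - 1) = et (- i) * (s * et (- 1))"
    using et_add[of i "- 1"] by (simp add: step2 flip: mult.assoc)
  also have "s * et (- 1) = et 1 * s"
    by (simp add: et_1 et_m1 mult.assoc s_s mult_assoc_cong[OF s_s])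
  also have "et (- i) * (et 1 * s) = et (- (i - 1)) * s"
    by (simp add: mult_assoc_cong[OF et_add[symmetric]] add.commute)
  finally show ?case .
qed simp

lemma p_et: "p * et k = et (1 - k) * s"
proof -
  have "p * et k = p * s * (s * et k)"
    by (simp add: mult.assoc mult_assoc_cong[OF s_s])
  also have "\<dots> = et (1 + (- k)) * s"
    by (simp only: s_et[of k] et_add et_1 mult.assoc)
  finally show ?thesis by simp
qed

lemma et_commute: "et k * e f = e (subst (gsh k) f) * et k"
proof (rule e_commute_subst[OF gsh_nonconst])
  have 1: "et 1 * e Yvar = e (cst qh) * e Yvar * et 1"
    by (simp add: et_1 mult.assoc s_commute mult_assoc_cong[OF p_commute]
        gp.subst_simps cst_inverse flip: e_mult)
  have m1: "et (- 1) * e Yvar = e (cst (inverse qh)) * e Yvar * et (- 1)"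
    by (simp add: et_m1 mult.assoc p_commute mult_assoc_cong[OF s_commute]
        gs.subst_simps flip: e_mult)
  show "et k * e Yvar = e (gsh k) * et k"
  proof (induction k rule: int_induct[where k = 0])
    case base show ?case by (simp add: gsh_def)
  next
    case (step1 i)
    have "et (i + 1) * e Yvar = et i * e (cst qh) * e Yvar * et 1"
      by (simp add: et_add mult.assoc 1)
    also have "\<dots> = e (cst qh) * (et i * e Yvar) * et 1"
      by (simp only: e_cst_central[of qh "et i", symmetric] mult.assoc)
    also have "\<dots> = e (cst qh) * e (cst (qh powi i)) * e Yvar * et (i + 1)"
      by (simp add: step1 et_add gsh_def e_mult mult.assoc)
    also have "e (cst qh) * e (cst (qh powi i)) = e (cst (qh powi (i + 1)))"
      by (simp add: power_int_add mult.commute flip: e_mult cst_mult)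
    finally show ?case by (simp add: gsh_def e_mult)
  next
    case (step2 i)
    have i: "et (i - 1) = et i * et (- 1)"
      using et_add[of i "- 1"] by simp
    then have "et (i - 1) * e Yvar = et i * e (cst (inverse qh)) * e Yvar * et (- 1)"
      by (simp add: mult.assoc m1)
    also have "\<dots> = e (cst (inverse qh)) * (et i * e Yvar) * et (- 1)"
      by (simp only: e_cst_central[of "inverse qh" "et i", symmetric] mult.assoc)
    also have "\<dots> = e (cst (inverse qh)) * e (cst (qh powi i)) * e Yvar * et (i - 1)"
      by (simp add: step2 i gsh_def e_mult mult.assoc)
    also have "e (cst (inverse qh)) * e (cst (qh powi i)) = e (cst (qh powi (i - 1)))"
      by (simp add: power_int_diff divide_inverse mult.commute flip: e_mult cst_mult)
    finally show ?case by (simp add: gsh_def e_mult)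
  qed
qed

end

section \<open>The intertwiner basis\<close>

text \<open>
  A family that spans an independent family over the same finite index set is itself independent:
  otherwise a proper part of it would span as many independent vectors as there are indices.
\<close>

lemma (in vector_space) spanning_family_independent:
  fixes v w :: "'i \<Rightarrow> 'b"
  assumes "finite I"
    and v: "\<And>c i. (\<Sum>i\<in>I. scale (c i) (v i)) = 0 \<Longrightarrow> i \<in> I \<Longrightarrow> c i = 0"
    and vw: "\<And>i. i \<in> I \<Longrightarrow> v i \<in> span (w ` I)"
    and w: "(\<Sum>i\<in>I. scale (c i) (w i)) = 0" and "i \<in> I"
  shows "c i = 0"
proof -
  have inj_v: "inj_on v I"
  proof (rule inj_onI, rule ccontr)
    fix i j assume ij: "i \<in> I" "j \<in> I" "v i = v j" "i \<noteq> j"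
    define c where "c k = (if k = i then 1 else if k = j then - 1 else (0::'a))" for k
    have "(\<Sum>k\<in>I. scale (c k) (v k)) = (\<Sum>k\<in>{i, j}. scale (c k) (v k))"
      using ij \<open>finite I\<close> by (intro sum.mono_neutral_right) (auto simp: c_def)
    also have "\<dots> = 0" using ij by (simp add: c_def)
    finally have "c i = 0" using v ij by blast
    then show False by (simp add: c_def)
  qed
  have indep_v: "independent (v ` I)"
  proof (rule independent_if_scalars_zero)
    fix f x assume "(\<Sum>x\<in>v ` I. scale (f x) x) = 0" "x \<in> v ` I"
    then show "f x = 0"
      using v[of "f \<circ> v"] inj_v by (auto simp: sum.reindex)
  qed (use \<open>finite I\<close> in simp)
  have "card I = card (v ` I)"
    using inj_v by (simp add: card_image)
  also have "\<dots> \<le> card (w ` I)"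
    using independent_span_bound[OF _ indep_v, of "w ` I"] vw \<open>finite I\<close> by blast
  finally have card_w: "card I = card (w ` I)"
    using card_image_le[OF \<open>finite I\<close>, of w] by simp
  then have inj_w: "inj_on w I"
    using \<open>finite I\<close> by (simp add: eq_card_imp_inj_on)
  have indep_w: "independent (w ` I)"
  proof
    assume "dependent (w ` I)"
    then obtain a where a: "a \<in> w ` I" "a \<in> span (w ` I - {a})"
      unfolding dependent_def by blast
    then have "span (w ` I) \<subseteq> span (w ` I - {a})"
      by (metis insert_Diff span_redundant subset_refl)
    then have "card (v ` I) \<le> card (w ` I - {a})"
      using independent_span_bound[OF _ indep_v, of "w ` I - {a}"] vw \<open>finite I\<close> by blast
    also have "\<dots> < card (w ` I)"
      using a \<open>finite I\<close> by (meson card_Diff1_less finite_imageI)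
    finally show False
      using inj_v card_w by (simp add: card_image)
  qed
  define d where "d x = c (inv_into I w x)" for x
  have "(\<Sum>x\<in>w ` I. scale (d x) x) = 0"
    using w inj_w by (simp add: sum.reindex d_def)
  then have "d (w i) = 0"
    using independentD[OF indep_w, of "w ` I" d] \<open>i \<in> I\<close> \<open>finite I\<close> by blast
  then show ?thesis
    using inj_w \<open>i \<in> I\<close> by (simp add: d_def)
qed

context localized_DAHA
begin

sublocale vs: vector_space "\<lambda>f h. e f * h"
  by unfold_locales (simp_all add: e_add e_mult algebra_simps)

abbreviation Xp :: "int \<Rightarrow> 'h" where "Xp \<equiv> zpow (X H) (Xinv H)"

text \<open>
  Two families with the same index set: the defining basis of the algebra and the intertwiner basis.
\<close>

definition X_fam :: "int \<times> bool \<Rightarrow> 'h" where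
  "X_fam i = Xp (fst i) * (if snd i then T1 H else 1)"

definition eta_fam :: "int \<times> bool \<Rightarrow> 'h" where
  "eta_fam i = et (fst i) * (if snd i then s else 1)"

text \<open>
  The defining property of the algebra asserts unique coefficients for every element; independence
  is the case of the element \<open>0\<close>.
\<close>

lemma X_fam_independent:
  assumes "finite A" and c: "(\<Sum>i\<in>A \<times> UNIV. e (c i) * X_fam i) = 0" and "i \<in> A \<times> UNIV"
  shows "c i = 0"
proof -
  define F where "F b = Poly_Mapping.Abs_poly_mapping (\<lambda>k. if k \<in> A then c (k, b) else 0)" for b
  have F: "Poly_Mapping.lookup (F b) k = (if k \<in> A then c (k, b) else 0)" for b k
    unfolding F_def by (subst lookup_Abs_poly_mapping) (auto intro: finite_subset[OF _ \<open>finite A\<close>])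
  have keys: "Poly_Mapping.keys (F b) \<subseteq> A" for b
  proof
    fix k assume "k \<in> Poly_Mapping.keys (F b)"
    then have "Poly_Mapping.lookup (F b) k \<noteq> 0" by (simp only: in_keys_iff not_False_eq_True)
    then show "k \<in> A" by (rule contrapos_np) (simp only: F if_False)
  qed
  have sum: "(\<Sum>k\<in>Poly_Mapping.keys (F b). e (Poly_Mapping.lookup (F b) k) * h k) = (\<Sum>k\<in>A. e (c (k, b)) * h k)" for b h
  proof -
    have "(\<Sum>k\<in>Poly_Mapping.keys (F b). e (Poly_Mapping.lookup (F b) k) * h k)
        = (\<Sum>k\<in>A. e (Poly_Mapping.lookup (F b) k) * h k)"
    proof (rule sum.mono_neutral_left[OF \<open>finite A\<close> keys], rule ballI)
      fix k assume "k \<in> A - Poly_Mapping.keys (F b)"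
      then have "Poly_Mapping.lookup (F b) k = 0"
        by (simp only: in_keys_iff Diff_iff not_not)
      then show "e (Poly_Mapping.lookup (F b) k) * h k = 0" by (simp only: e_0 mult_zero_left)
    qed
    also have "\<dots> = (\<Sum>k\<in>A. e (c (k, b)) * h k)"
      by (intro sum.cong refl) (simp add: F)
    finally show ?thesis .
  qed
  define P where "P fg \<longleftrightarrow> (case fg of (f, g) \<Rightarrow>
        0 = (\<Sum>k\<in>Poly_Mapping.keys f. e (Poly_Mapping.lookup f k) * Xp k)
          + (\<Sum>k\<in>Poly_Mapping.keys g. e (Poly_Mapping.lookup g k) * (Xp k * T1 H)))"
    for fg :: "(int \<Rightarrow>\<^sub>0 ratfun) \<times> (int \<Rightarrow>\<^sub>0 ratfun)"
  have "P (F False, F True)"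
  proof -
    have "0 = (\<Sum>k\<in>A. \<Sum>b\<in>UNIV. e (c (k, b)) * X_fam (k, b))"
      using c by (simp add: sum.cartesian_product split_def)
    also have "\<dots> = (\<Sum>k\<in>A. e (c (k, False)) * Xp k + e (c (k, True)) * (Xp k * T1 H))"
      by (intro sum.cong refl) (simp add: UNIV_bool X_fam_def)
    also have "\<dots> = (\<Sum>k\<in>A. e (c (k, False)) * Xp k) + (\<Sum>k\<in>A. e (c (k, True)) * (Xp k * T1 H))"
      by (rule sum.distrib)
    finally show ?thesis by (simp only: P_def prod.case sum)
  qed
  moreover have "P (0, 0)"
    by (simp add: P_def)
  moreover have "\<exists>!fg. P fg"
    using daha unfolding localized_daha_def P_def by (elim conjE) (erule spec)
  ultimately have "(F False, F True) = (0, 0)"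
    by blast
  then have "F b = 0" for b by (cases b) auto
  then show ?thesis
    using F[of "snd i" "fst i"] \<open>i \<in> A \<times> UNIV\<close> by auto
qed

text \<open>
  Left multiplication by \<open>T\<^sub>1\<close> preserves \<open>eta_span n\<close>, while \<open>p\<close> raises the bound by one because
  \<open>p \<eta>\<^sup>k = \<eta>\<^sup>1\<^sup>-\<^sup>k s\<close>. As \<open>X\<close> and \<open>X\<^sup>-\<^sup>1\<close> each contain \<open>p\<close> once, \<open>X\<^sup>k\<close> and \<open>X\<^sup>k T\<^sub>1\<close> lie in \<open>eta_span \<bar>k\<bar>\<close>.
\<close>

definition eta_span :: "nat \<Rightarrow> 'h set" where
  "eta_span n = vs.span (eta_fam ` ({- int n..int n} \<times> UNIV))"

lemma eta_span_add: "x \<in> eta_span n \<Longrightarrow> y \<in> eta_span n \<Longrightarrow> x + y \<in> eta_span n"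
  and eta_span_diff: "x \<in> eta_span n \<Longrightarrow> y \<in> eta_span n \<Longrightarrow> x - y \<in> eta_span n"
  and eta_span_scale: "x \<in> eta_span n \<Longrightarrow> e c * x \<in> eta_span n"
  and eta_span_0: "0 \<in> eta_span n"
  unfolding eta_span_def by (rule vs.span_add vs.span_diff vs.span_scale vs.span_zero; assumption?)+

lemma eta_span_mono: "m \<le> n \<Longrightarrow> eta_span m \<subseteq> eta_span n"
  unfolding eta_span_def by (intro vs.span_mono image_mono) auto

lemma eta_fam_in_eta_span: "\<bar>k\<bar> \<le> int n \<Longrightarrow> eta_fam (k, b) \<in> eta_span n"
  unfolding eta_span_def by (intro vs.span_base imageI) auto

lemma eta_fam_imageE:
  assumes "x \<in> eta_fam ` ({- int n..int n} \<times> UNIV)"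
  obtains k b where "x = eta_fam (k, b)" "\<bar>k\<bar> \<le> int n"
proof -
  from assms obtain i where i: "x = eta_fam i" "i \<in> {- int n..int n} \<times> (UNIV :: bool set)"
    by (rule imageE)
  obtain k b where "i = (k, b)" by (cases i)
  with i show thesis by (intro that[of k b]) auto
qed

lemma s_eta_fam: "s * eta_fam (k, b) = eta_fam (- k, \<not> b)"
  by (cases b) (simp_all add: eta_fam_def mult_assoc_cong[OF s_et] s_et s_s mult.assoc)

lemma p_eta_fam: "p * eta_fam (k, b) = eta_fam (1 - k, \<not> b)"
  by (cases b) (simp_all add: eta_fam_def mult_assoc_cong[OF p_et] p_et s_s mult.assoc)

lemma s_e_eta_fam: "s * (e c * eta_fam (k, b)) = e (subst gs c) * eta_fam (- k, \<not> b)"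
  by (simp only: mult_assoc_cong[OF s_commute] mult.assoc s_eta_fam)

lemma p_e_eta_fam: "p * (e c * eta_fam (k, b)) = e (subst gp c) * eta_fam (1 - k, \<not> b)"
  by (simp only: mult_assoc_cong[OF p_commute] mult.assoc p_eta_fam)

lemma T1_eta_span: assumes "h \<in> eta_span n" shows "T1 H * h \<in> eta_span n"
  using assms[unfolded eta_span_def]
proof (rule vs.span_induct_alt)
  show "T1 H * 0 \<in> eta_span n" by (simp only: mult_zero_right eta_span_0)
next
  fix c x y assume step: "x \<in> eta_fam ` ({- int n..int n} \<times> UNIV)" "T1 H * y \<in> eta_span n"
  from step(1) obtain k b where x: "x = eta_fam (k, b)" "\<bar>k\<bar> \<le> int n" by (rule eta_fam_imageE)
  have "T1 H * (e c * x) = e phi * (s * (e c * eta_fam (k, b))) + e (phi' - cst (inverse th)) * (e c * eta_fam (k, b))"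
    by (simp only: T1_eq distrib_right mult.assoc x(1))
  moreover have "e phi * (s * (e c * eta_fam (k, b))) \<in> eta_span n"
    unfolding s_e_eta_fam using x(2) by (intro eta_span_scale eta_fam_in_eta_span) simp
  moreover have "e (phi' - cst (inverse th)) * (e c * eta_fam (k, b)) \<in> eta_span n"
    by (intro eta_span_scale eta_fam_in_eta_span x(2))
  ultimately have "T1 H * (e c * x) \<in> eta_span n" by (simp only: eta_span_add)
  then show "T1 H * (e c * x + y) \<in> eta_span n"
    unfolding distrib_left using step(2) by (rule eta_span_add)
qed

lemma p_eta_span: assumes "h \<in> eta_span n" shows "p * h \<in> eta_span (Suc n)"
  using assms[unfolded eta_span_def]
proof (rule vs.span_induct_alt)
  show "p * 0 \<in> eta_span (Suc n)" by (simp only: mult_zero_right eta_span_0)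
next
  fix c x y assume step: "x \<in> eta_fam ` ({- int n..int n} \<times> UNIV)" "p * y \<in> eta_span (Suc n)"
  from step(1) obtain k b where x: "x = eta_fam (k, b)" "\<bar>k\<bar> \<le> int n" by (rule eta_fam_imageE)
  have "\<bar>1 - k\<bar> \<le> int (Suc n)" using x(2) by linarith
  then have "p * (e c * x) \<in> eta_span (Suc n)"
    unfolding x(1) p_e_eta_fam by (intro eta_span_scale eta_fam_in_eta_span)
  then show "p * (e c * x + y) \<in> eta_span (Suc n)"
    unfolding distrib_left using step(2) by (rule eta_span_add)
qed

lemma X_eta_span: assumes "h \<in> eta_span n" shows "X H * h \<in> eta_span (Suc n)"
proof -
  have "T1 H * h - e (cst \<delta>) * h \<in> eta_span n"
    by (intro eta_span_diff eta_span_scale T1_eta_span assms)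
  then have "p * (T1 H * h - e (cst \<delta>) * h) \<in> eta_span (Suc n)"
    by (rule p_eta_span)
  then show ?thesis
    by (simp add: X_eq T1inv_eq mult.assoc left_diff_distrib)
qed

lemma Xinv_eta_span: "h \<in> eta_span n \<Longrightarrow> Xinv H * h \<in> eta_span (Suc n)"
  by (simp add: Xinv_eq mult.assoc T1_eta_span p_eta_span)

lemma Xp_eta_span: assumes "h \<in> eta_span 0" "\<bar>k\<bar> \<le> int n" shows "Xp k * h \<in> eta_span n"
proof -
  have pos: "X H ^ m * h \<in> eta_span m" and neg: "Xinv H ^ m * h \<in> eta_span m" for m
    using assms(1) by (induction m) (simp_all add: X_eta_span Xinv_eta_span mult.assoc)
  show ?thesis
  proof (cases "0 \<le> k")
    case True
    then have "Xp k * h \<in> eta_span (nat k)" using pos by (simp add: zpow_def)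
    also have "\<dots> \<subseteq> eta_span n" using assms(2) by (intro eta_span_mono) simp
    finally show ?thesis .
  next
    case False
    then have "Xp k * h \<in> eta_span (nat (- k))" using neg by (simp add: zpow_def)
    also have "\<dots> \<subseteq> eta_span n" using assms(2) by (intro eta_span_mono) simp
    finally show ?thesis .
  qed
qed

lemma X_fam_eta_span: assumes "\<bar>k\<bar> \<le> int n" shows "X_fam (k, b) \<in> eta_span n"
proof -
  have 1: "1 \<in> eta_span 0" using eta_fam_in_eta_span[of 0 0 False] by (simp add: eta_fam_def)
  then have "T1 H \<in> eta_span 0" using T1_eta_span[of 1 0] by simp
  with 1 have "(if b then T1 H else 1) \<in> eta_span 0" by simp
  then show ?thesis
    using Xp_eta_span[OF _ assms] by (simp add: X_fam_def)
qed

lemma eta_fam_independent_box: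
  assumes "(\<Sum>i\<in>{- int n..int n} \<times> UNIV. e (c i) * eta_fam i) = 0" "i \<in> {- int n..int n} \<times> UNIV"
  shows "c i = 0"
proof (rule vs.spanning_family_independent[of "{- int n..int n} \<times> UNIV" X_fam eta_fam c i])
  fix j :: "int \<times> bool" assume "j \<in> {- int n..int n} \<times> UNIV"
  then show "X_fam j \<in> vs.span (eta_fam ` ({- int n..int n} \<times> UNIV))"
    using X_fam_eta_span[of "fst j" n "snd j"] unfolding eta_span_def by auto
qed (use assms X_fam_independent[of "{- int n..int n}"] in auto)

lemma eta_fam_independent:
  assumes "finite I" "(\<Sum>i\<in>I. e (c i) * eta_fam i) = 0" "i \<in> I"
  shows "c i = 0"
proof -
  define n where "n = (\<Sum>i\<in>I. nat \<bar>fst i\<bar>)"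
  have "nat \<bar>fst i\<bar> \<le> n" if "i \<in> I" for i
    unfolding n_def using that assms(1) by (intro member_le_sum) auto
  then have sub: "I \<subseteq> {- int n..int n} \<times> UNIV"
    by (fastforce simp: abs_le_iff nat_le_iff)
  define d where "d i = (if i \<in> I then c i else 0)" for i
  have "(\<Sum>i\<in>{- int n..int n} \<times> UNIV. e (d i) * eta_fam i) = (\<Sum>i\<in>I. e (c i) * eta_fam i)"
    using sub by (intro sum.mono_neutral_cong_right) (auto simp: d_def)
  then have "d i = 0"
    using eta_fam_independent_box[of d n i] assms sub by auto
  then show ?thesis using \<open>i \<in> I\<close> by (simp add: d_def)
qed

text \<open>
  The indices of the two kinds of terms may be ordered differently because products such as
  \<open>\<one>\<^sub>0 \<eta>\<^sup>k\<close> involve \<open>\<eta>\<^sup>k\<close> together with \<open>\<eta>\<^sup>-\<^sup>k s\<close>.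
\<close>

lemma eta_independent:
  assumes "finite J" "inj_on k J" "inj_on l J"
    and 0: "(\<Sum>j\<in>J. e (a j) * et (k j) + e (b j) * et (l j) * s) = 0" and "j \<in> J"
  shows "a j = 0"
proof -
  let ?I = "(\<lambda>j. (k j, False)) ` J" and ?I' = "(\<lambda>j. (l j, True)) ` J"
  define c where "c i = (if snd i then b (inv_into J l (fst i)) else a (inv_into J k (fst i)))" for i
  have inj: "inj_on (\<lambda>j. (k j, False)) J" "inj_on (\<lambda>j. (l j, True)) J"
    using assms by (auto simp: inj_on_def)
  have "(\<Sum>i\<in>?I \<union> ?I'. e (c i) * eta_fam i) = (\<Sum>i\<in>?I. e (c i) * eta_fam i) + (\<Sum>i\<in>?I'. e (c i) * eta_fam i)"
    using \<open>finite J\<close> by (intro sum.union_disjoint) auto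
  also have "\<dots> = (\<Sum>j\<in>J. e (a j) * et (k j)) + (\<Sum>j\<in>J. e (b j) * et (l j) * s)"
    using assms(2,3) by (simp add: sum.reindex[OF inj(1)] sum.reindex[OF inj(2)] c_def eta_fam_def mult.assoc)
  also have "\<dots> = 0" using 0 by (simp add: sum.distrib)
  finally have "c (k j, False) = 0"
    using eta_fam_independent[of "?I \<union> ?I'" c "(k j, False)"] \<open>finite J\<close> \<open>j \<in> J\<close> by auto
  then show ?thesis
    using assms by (simp add: c_def)
qed

lemma et_one0: "et k * u0 = e (subst (gsh k) phi') * et k + e (subst (gsh k) phi) * et k * s"
  by (simp add: one0_eq distrib_left mult_assoc_cong[OF et_commute] et_commute mult.assoc add.commute)

text \<open>
  Compare the coefficients of \<open>\<eta>\<^sup>k\<close>: since \<open>\<one>\<^sub>0\<close> contains \<open>1\<close> with the nonzero coefficient \<open>phi'\<close>, the terms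
  with \<open>s\<close> can be ignored. The same argument serves the other two expansions.
\<close>

lemma left_et_one0_independent:
  assumes "finite J" "inj_on k J" "(\<Sum>j\<in>J. e (f j) * et (k j) * u0) = 0" "j \<in> J"
  shows "f j = 0"
proof -
  have "e (f j) * et (k j) * u0 = e (f j * subst (gsh (k j)) phi') * et (k j)
      + e (f j * subst (gsh (k j)) phi) * et (k j) * s" for j
    by (simp only: mult.assoc et_one0 e_mult distrib_left)
  then have "(\<Sum>j\<in>J. e (f j * subst (gsh (k j)) phi') * et (k j)
      + e (f j * subst (gsh (k j)) phi) * et (k j) * s) = 0"
    using assms(3) by simp
  from eta_independent[OF assms(1,2,2) this assms(4)] show ?thesis by simp
qed

lemma et_one0_independent:
  assumes "finite J" "inj_on k J" "(\<Sum>j\<in>J. et (k j) * e (f j) * u0) = 0" "j \<in> J"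
  shows "f j = 0"
  using left_et_one0_independent[OF assms(1,2), of "\<lambda>j. subst (gsh (k j)) (f j)" j] assms(3,4)
  by (simp add: et_commute)

lemma one0_et_independent:
  assumes "finite J" "inj_on k J" "(\<Sum>j\<in>J. u0 * et (k j) * e (f j)) = 0" "j \<in> J"
  shows "f j = 0"
proof -
  have *: "u0 * et k * e f = e (phi' * subst (gsh k) f) * et k
      + e (phi * subst (gsh (- k)) (subst gs f)) * et (- k) * s" for k f
  proof -
    have "s * (et k * e f) = et (- k) * (s * e f)"
      by (simp only: mult_assoc_cong[OF s_et] mult.assoc)
    also have "\<dots> = (et (- k) * e (subst gs f)) * s"
      by (simp only: s_commute mult.assoc)
    also have "\<dots> = e (subst (gsh (- k)) (subst gs f)) * (et (- k) * s)"
      by (simp only: et_commute mult.assoc)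
    finally have "e phi * (s * (et k * e f)) = e (phi * subst (gsh (- k)) (subst gs f)) * et (- k) * s"
      by (simp only: e_mult mult.assoc)
    then show ?thesis
      by (simp only: one0_eq distrib_right mult.assoc et_commute[of k f] e_mult add.commute)
  qed
  have inj: "inj_on (\<lambda>j. - k j) J" using assms(2) by (simp add: inj_on_def)
  have "(\<Sum>j\<in>J. e (phi' * subst (gsh (k j)) (f j)) * et (k j)
      + e (phi * subst (gsh (- k j)) (subst gs (f j))) * et (- k j) * s) = 0"
    using assms(3) by (simp only: *)
  from eta_independent[OF assms(1,2) inj this assms(4)]
  have "phi' * subst (gsh (k j)) (f j) = 0" .
  then show ?thesis by simp
qed

end

section \<open>Vanishing on the spectrum of the polynomial representation\<close>

lemma has_value_Yinv: "x \<noteq> 0 \<Longrightarrow> has_value (inverse Yvar) x (inverse x)"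
  by (intro has_value_inverse has_value_Yvar)

lemma has_value_Ym2: "x \<noteq> 0 \<Longrightarrow> has_value Ym2 x (inverse (x\<^sup>2))"
  unfolding Ym2_def by (intro has_value_inverse has_value_power has_value_Yvar) simp

context localized_DAHA
begin

text \<open>
  The spectrum of \<open>Y\<close> on the principal series that has the polynomial representation as a quotient. It contains
  all eigenvalues \<open>ev k\<close> and is closed under inversion and under multiplication by powers of \<open>q\<^sup>1\<^sup>/\<^sup>2\<close>,
  hence under the substitutions made by \<open>s\<close> and \<open>p\<close>.
\<close>

definition spectrum :: "complex set" where
  "spectrum = {x. \<exists>k. x = th * qh powi k \<or> x = inverse th * qh powi k}"

abbreviation ev :: "int \<Rightarrow> complex" where "ev \<equiv> Y_eigenvalue qh th"

lemma spectrum_neq_0: "x \<in> spectrum \<Longrightarrow> x \<noteq> 0"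
  by (auto simp: spectrum_def)

lemma ev_in_spectrum: "ev k \<in> spectrum"
  unfolding spectrum_def Y_eigenvalue_def by auto

lemma ev_0: "ev 0 = th"
  by (simp add: Y_eigenvalue_def)

lemma ev_minus: "k \<noteq> 0 \<Longrightarrow> ev (- k) = inverse (ev k)"
  by (auto simp: Y_eigenvalue_def power_int_minus)

lemma ev_one_minus: "ev (1 - k) = inverse qh * inverse (ev k)"
  by (auto simp: Y_eigenvalue_def power_int_minus power_int_diff field_simps)

lemma ev_sq: "(ev k)\<^sup>2 = t powi (if k > 0 then - 1 else 1) * q powi (- k)"
  by (simp add: Y_eigenvalue_def power_mult_distrib power_int_power power_int_power' mult.commute
      power_int_minus power_inverse)

text \<open>
  Equality of two eigenvalues would, after squaring, be a relation between integral powers of \<open>q\<close> and \<open>t\<close>.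
\<close>

lemma ev_inj: assumes "ev k = ev m" shows "k = m"
proof -
  let ?a = "\<lambda>k. if k > 0 then - 1 else 1 :: int"
  have "t powi ?a k * q powi (- k) = t powi ?a m * q powi (- m)"
    using assms by (simp only: flip: ev_sq)
  then have "q powi (m - k) * t powi (?a k - ?a m) = 1"
    by (simp add: power_int_diff power_int_minus field_simps)
  from q_t_indep[OF this] show ?thesis by simp
qed

lemma spectrum_sq_neq_1: assumes "x \<in> spectrum" shows "x\<^sup>2 \<noteq> 1"
proof
  assume 1: "x\<^sup>2 = 1"
  obtain k where "x = th * qh powi k \<or> x = inverse th * qh powi k"
    using assms by (auto simp: spectrum_def)
  then have "q powi k * t powi 1 = 1 \<or> q powi k * t powi (- 1) = 1"
    using 1 by (auto simp: power_mult_distrib power_int_power power_int_power' mult.commute power_inverse)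
  then show False using q_t_indep by fastforce
qed

lemma spectrum_inverse: "x \<in> spectrum \<Longrightarrow> inverse x \<in> spectrum"
proof -
  assume "x \<in> spectrum"
  then obtain k where "x = th * qh powi k \<or> x = inverse th * qh powi k"
    by (auto simp: spectrum_def)
  then have "inverse x = inverse th * qh powi (- k) \<or> inverse x = th * qh powi (- k)"
    by (auto simp: power_int_minus)
  then show ?thesis unfolding spectrum_def by blast
qed

lemma spectrum_qh: "x \<in> spectrum \<Longrightarrow> inverse qh * x \<in> spectrum"
proof -
  assume "x \<in> spectrum"
  then obtain k where "x = th * qh powi k \<or> x = inverse th * qh powi k"
    by (auto simp: spectrum_def)
  then have "inverse qh * x = th * qh powi (k - 1) \<or> inverse qh * x = inverse th * qh powi (k - 1)"
    by (auto simp: power_int_diff field_simps)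
  then show ?thesis unfolding spectrum_def by blast
qed

definition regular :: "ratfun \<Rightarrow> bool" where
  "regular f \<longleftrightarrow> (\<forall>x\<in>spectrum. \<exists>v. has_value f x v)"

lemma regularE: assumes "regular f" "x \<in> spectrum" obtains v where "has_value f x v"
  using assms unfolding regular_def by blast

lemma regular_cst: "regular (cst c)"
  unfolding regular_def using has_value_cst by blast

lemma regular_Yvar: "regular Yvar"
  unfolding regular_def using has_value_Yvar by blast

lemma regular_Yinv: "regular (inverse Yvar)"
  unfolding regular_def using has_value_Yinv spectrum_neq_0 by blast

lemma regular_add: "regular f \<Longrightarrow> regular g \<Longrightarrow> regular (f + g)"
  unfolding regular_def using has_value_add by blast

lemma regular_diff: "regular f \<Longrightarrow> regular g \<Longrightarrow> regular (f - g)"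
  unfolding regular_def using has_value_diff by blast

lemma regular_mult: "regular f \<Longrightarrow> regular g \<Longrightarrow> regular (f * g)"
  unfolding regular_def using has_value_mult by blast

text \<open>
  The only poles of the coefficients of \<open>T\<^sub>1\<close> are at \<open>Y\<^sup>2 = 1\<close>, off the spectrum.
\<close>

lemma has_value_phi:
  assumes "x \<in> spectrum"
  shows "has_value phi x ((1 - t * inverse (x\<^sup>2)) / (th * (1 - inverse (x\<^sup>2))))"
    and "has_value phi' x ((t - inverse (x\<^sup>2)) / (th * (1 - inverse (x\<^sup>2))))"
proof -
  have "inverse (x\<^sup>2) \<noteq> 1" using spectrum_sq_neq_1[OF assms] by (metis inverse_eq_1_iff)
  then have *: "th * (1 - inverse (x\<^sup>2)) \<noteq> 0" by simp
  have z: "has_value Ym2 x (inverse (x\<^sup>2))" using spectrum_neq_0[OF assms] by (rule has_value_Ym2)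
  have 1: "has_value 1 x 1" using has_value_cst[of 1] by simp
  show "has_value phi x ((1 - t * inverse (x\<^sup>2)) / (th * (1 - inverse (x\<^sup>2))))"
    unfolding phi_def by (intro has_value_divide has_value_diff has_value_mult has_value_cst z 1 *)
  show "has_value phi' x ((t - inverse (x\<^sup>2)) / (th * (1 - inverse (x\<^sup>2))))"
    unfolding phi'_def by (intro has_value_divide has_value_diff has_value_mult has_value_cst z 1 *)
qed

lemma regular_phi: "regular phi" and regular_phi': "regular phi'"
  unfolding regular_def using has_value_phi by blast+

lemma has_value_subst_gs:
  assumes "x \<noteq> 0" "has_value f (inverse x) v" shows "has_value (subst gs f) x v"
proof -
  have "has_value gs x (inverse x)" unfolding gs_def using assms(1) by (rule has_value_Yinv)
  from has_value_subst[OF gs_nonconst this assms(2)] show ?thesis .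
qed

lemma has_value_subst_gp:
  assumes "x \<noteq> 0" "has_value f (inverse qh * inverse x) v" shows "has_value (subst gp f) x v"
proof -
  have "has_value gp x (inverse qh * inverse x)"
    unfolding gp_def by (intro has_value_mult has_value_cst has_value_Yinv assms(1))
  from has_value_subst[OF gp_nonconst this assms(2)] show ?thesis .
qed

lemma regular_subst_gs: assumes "regular f" shows "regular (subst gs f)"
  unfolding regular_def
proof
  fix x assume x: "x \<in> spectrum"
  from regularE[OF assms spectrum_inverse[OF x]] obtain v where "has_value f (inverse x) v" .
  then show "\<exists>v. has_value (subst gs f) x v"
    using has_value_subst_gs[OF spectrum_neq_0[OF x]] by blast
qed

lemma regular_subst_gp: assumes "regular f" shows "regular (subst gp f)"
  unfolding regular_def
proof
  fix x assume x: "x \<in> spectrum"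
  from regularE[OF assms spectrum_qh[OF spectrum_inverse[OF x]]]
  obtain v where "has_value f (inverse qh * inverse x) v" .
  then show "\<exists>v. has_value (subst gp f) x v"
    using has_value_subst_gp[OF spectrum_neq_0[OF x]] by blast
qed

text \<open>
  A submodule of \<open>H \<one>\<^sub>0\<close> for the integral algebra. For elements with regular coefficients, passing to the
  quotient amounts to evaluating the coefficient of \<open>\<eta>\<^sup>k \<one>\<^sub>0\<close> at \<open>ev k\<close>, so the quotient has one dimension for each \<open>k\<close>, like the polynomial
  representation.
\<close>

inductive_set vanishing :: "'h set" where
  zero: "0 \<in> vanishing"
| step: "regular f \<Longrightarrow> has_value f (ev k) 0 \<Longrightarrow> h \<in> vanishing \<Longrightarrow> e f * (et k * u0) + h \<in> vanishing"

lemma vanishing_add: "x \<in> vanishing \<Longrightarrow> y \<in> vanishing \<Longrightarrow> x + y \<in> vanishing"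
proof (induction rule: vanishing.induct)
  case (step f k h)
  then show ?case using vanishing.step[of f k "h + y"] by (simp only: add.assoc)
qed simp

lemma vanishing_base: "regular f \<Longrightarrow> has_value f (ev k) 0 \<Longrightarrow> e f * (et k * u0) \<in> vanishing"
  using vanishing.step[OF _ _ vanishing.zero] by simp

lemma vanishing_regular_mult: "x \<in> vanishing \<Longrightarrow> regular g \<Longrightarrow> e g * x \<in> vanishing"
proof (induction rule: vanishing.induct)
  case (step f k h)
  obtain v where "has_value g (ev k) v" using \<open>regular g\<close> ev_in_spectrum by (rule regularE)
  then have "has_value (g * f) (ev k) 0"
    using has_value_mult step(2) by fastforce
  from vanishing.step[OF regular_mult[OF \<open>regular g\<close> step(1)] this step(4)[OF \<open>regular g\<close>]]
  show ?case by (simp only: distrib_left e_mult mult.assoc)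
qed (simp add: vanishing.zero)

lemma s_e_et_one0: "s * (e f * (et k * u0)) = e (subst gs f) * (et (- k) * u0)"
  by (simp only: mult_assoc_cong[OF s_commute] mult.assoc mult_assoc_cong[OF s_et] s_one0)

lemma p_e_et_one0: "p * (e f * (et k * u0)) = e (subst gp f) * (et (1 - k) * u0)"
  by (simp only: mult_assoc_cong[OF p_commute] mult.assoc mult_assoc_cong[OF p_et] s_one0)

lemma T1_e_et_one0:
  "T1 H * (e f * (et k * u0)) = e (phi * subst gs f) * (et (- k) * u0)
     + e ((phi' - cst (inverse th)) * f) * (et k * u0)"
proof -
  have "T1 H * (e f * (et k * u0))
      = e phi * (s * (e f * (et k * u0))) + e (phi' - cst (inverse th)) * (e f * (et k * u0))"
    by (simp only: T1_eq distrib_right mult.assoc)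
  then show ?thesis by (simp only: s_e_et_one0 e_mult mult.assoc)
qed

lemma has_value_mult_0: "has_value f x 0 \<Longrightarrow> has_value g x v \<Longrightarrow> has_value (f * g) x 0"
  using has_value_mult[of f x 0 g v] by simp

text \<open>
  The generator \<open>T\<^sub>1\<close> sends the coefficient \<open>f\<close> of \<open>\<eta>\<^sup>k \<one>\<^sub>0\<close> to \<open>phi f(1/Y)\<close> at \<open>\<eta>\<^sup>-\<^sup>k \<one>\<^sub>0\<close>. For \<open>k \<noteq> 0\<close> the eigenvalues at
  \<open>k\<close> and \<open>-k\<close> are inverse to each other, so vanishing is inherited. For \<open>k = 0\<close> they are not, but there
  \<open>phi\<close> itself vanishes, because \<open>ev 0\<^sup>2 = t\<close>.
\<close>

lemma vanishing_T1: "x \<in> vanishing \<Longrightarrow> T1 H * x \<in> vanishing"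
proof (induction rule: vanishing.induct)
  case (step f k h)
  have psi: "regular (phi' - cst (inverse th))"
    by (intro regular_diff regular_phi' regular_cst)
  have "has_value (phi * subst gs f) (ev (- k)) 0"
  proof (cases "k = 0")
    case True
    have "has_value phi (ev (- k)) 0"
      using has_value_phi(1)[OF ev_in_spectrum, of 0] True by (simp add: ev_0)
    moreover obtain v where "has_value (subst gs f) (ev (- k)) v"
      using regularE[OF regular_subst_gs[OF step(1)] ev_in_spectrum] .
    ultimately show ?thesis by (rule has_value_mult_0)
  next
    case False
    then have "inverse (ev (- k)) = ev k" by (simp add: ev_minus)
    then have "has_value (subst gs f) (ev (- k)) 0"
      using has_value_subst_gs[of "ev (- k)" f 0] step(2) spectrum_neq_0[OF ev_in_spectrum] by simp
    moreover obtain v where "has_value phi (ev (- k)) v"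
      using regularE[OF regular_phi ev_in_spectrum] .
    ultimately show ?thesis using has_value_mult_0 by (metis mult.commute)
  qed
  then have "e (phi * subst gs f) * (et (- k) * u0) \<in> vanishing"
    by (intro vanishing_base regular_mult regular_phi regular_subst_gs step(1))
  moreover have "e (phi' - cst (inverse th)) * (e f * (et k * u0)) \<in> vanishing"
    by (intro vanishing_regular_mult vanishing_base step(1,2) psi)
  ultimately have "T1 H * (e f * (et k * u0)) \<in> vanishing"
    unfolding T1_e_et_one0 e_mult mult.assoc by (rule vanishing_add)
  then show ?case
    unfolding distrib_left using step(4) by (rule vanishing_add)
qed (simp add: vanishing.zero)

lemma vanishing_p: "x \<in> vanishing \<Longrightarrow> p * x \<in> vanishing"
proof (induction rule: vanishing.induct)
  case (step f k h)
  have "inverse qh * inverse (ev (1 - k)) = ev k"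
    using ev_one_minus[of "1 - k"] by simp
  then have "has_value (subst gp f) (ev (1 - k)) 0"
    using has_value_subst_gp[of "ev (1 - k)" f 0] step(2) spectrum_neq_0[OF ev_in_spectrum] by simp
  then have "p * (e f * (et k * u0)) \<in> vanishing"
    unfolding p_e_et_one0 by (intro vanishing_base regular_subst_gp step(1))
  then show ?case
    unfolding distrib_left using step(4) by (rule vanishing_add)
qed (simp add: vanishing.zero)

lemma vanishing_diff: "x \<in> vanishing \<Longrightarrow> y \<in> vanishing \<Longrightarrow> x - y \<in> vanishing"
  using vanishing_add[of x "e (cst (- 1)) * y"] vanishing_regular_mult[OF _ regular_cst, of y "- 1"]
  by (simp add: cst_minus e_minus)

lemma vanishing_T1inv: "x \<in> vanishing \<Longrightarrow> T1inv H * x \<in> vanishing"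
  unfolding T1inv_eq left_diff_distrib by (intro vanishing_diff vanishing_T1 vanishing_regular_mult regular_cst)

lemma vanishing_daha_int: "a \<in> daha_int H \<Longrightarrow> x \<in> vanishing \<Longrightarrow> a * x \<in> vanishing"
proof (induction arbitrary: x rule: daha_int.induct)
  case (scal c) then show ?case unfolding scal_def by (intro vanishing_regular_mult regular_cst)
next
  case X then show ?case by (simp only: X_eq mult.assoc vanishing_p vanishing_T1inv)
next
  case Xinv then show ?case by (simp only: Xinv_eq mult.assoc vanishing_p vanishing_T1)
next
  case Y then show ?case unfolding Y_def by (intro vanishing_regular_mult regular_Yvar)
next
  case Yinv then show ?case unfolding Yinv_def by (intro vanishing_regular_mult regular_Yinv)
next
  case Tpi then show ?case unfolding Tpi_eq mult.assoc by (intro vanishing_regular_mult regular_Yvar vanishing_T1inv)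
next
  case Tpiinv then show ?case unfolding Tpiinv_eq Tpi_eq mult.assoc by (intro vanishing_regular_mult regular_Yvar vanishing_T1inv)
next
  case (add a b) then show ?case unfolding distrib_right by (intro vanishing_add) blast+
next
  case (mult a b) then show ?case by (simp only: mult.assoc)
qed (auto intro: vanishing_T1 vanishing_T1inv)

lemma T1inv_one0: "T1inv H * u0 = e (cst (inverse th)) * u0"
proof -
  have "T1inv H * u0 = e (cst th) * u0 - e (cst \<delta>) * u0"
    by (simp only: T1inv_eq left_diff_distrib T1_one0)
  also have "\<dots> = e (cst (th - \<delta>)) * u0"
    by (simp only: cst_diff e_diff left_diff_distrib)
  finally show ?thesis by simp
qed

lemma Tpi_one0: "(Tpi H - 1) * u0 \<in> vanishing"
proof -
  have "(Tpi H - 1) * u0 = e (Yvar * cst (inverse th) - cst 1) * (et 0 * u0)"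
    by (simp only: left_diff_distrib Tpi_eq mult.assoc T1inv_one0 e_diff e_mult et_0 mult_1_left cst_1 e_1)
  moreover have "has_value (Yvar * cst (inverse th) - cst 1) (ev 0) (th * inverse th - 1)"
    unfolding ev_0 by (intro has_value_diff has_value_mult has_value_Yvar has_value_cst)
  moreover have "regular (Yvar * cst (inverse th) - cst 1)"
    by (intro regular_diff regular_mult regular_Yvar regular_cst)
  ultimately show ?thesis
    using vanishing_base[of "Yvar * cst (inverse th) - cst 1" 0] by simp
qed

text \<open>
  The first generator of the annihilator kills \<open>\<one>\<^sub>0\<close>, and \<open>(T\<^sub>\<pi> - 1) \<one>\<^sub>0 = (t\<^sup>-\<^sup>1\<^sup>/\<^sup>2 Y - 1) \<one>\<^sub>0\<close> vanishes at \<open>ev 0 = t\<^sup>1\<^sup>/\<^sup>2\<close>.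
\<close>

lemma ann_one0: assumes "x \<in> ann_1Y th H" shows "x * u0 \<in> vanishing"
proof -
  obtain a b where ab: "x = a * (T1 H - scal H th) + b * (Tpi H - 1)" "b \<in> daha_int H"
    using assms unfolding ann_1Y_def mem_Collect_eq by (elim exE conjE)
  have "(T1 H - scal H th) * u0 = 0"
    by (simp add: left_diff_distrib T1_one0 scal_def)
  then have "x * u0 = b * ((Tpi H - 1) * u0)"
    by (simp add: ab(1) distrib_right mult.assoc)
  then show ?thesis using vanishing_daha_int[OF ab(2) Tpi_one0] by simp
qed

text \<open>
  Adds one term to a finite linear combination whose index may or may not already occur in it.
\<close>

lemma sum_insert_update:
  fixes G :: "'a \<Rightarrow> 'b::ring_1" and c :: "'a \<Rightarrow> 'c::ab_group_add"
  assumes "finite K" and c0: "\<And>j. j \<notin> K \<Longrightarrow> c j = 0"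
    and f: "f 0 = 0" "\<And>a b. f (a + b) = f a + (f b :: 'b)"
  shows "(\<Sum>j\<in>insert k K. f ((c(k := a + c k)) j) * G j) = f a * G k + (\<Sum>j\<in>K. f (c j) * G j)"
proof -
  have "(\<Sum>j\<in>insert k K. f ((c(k := a + c k)) j) * G j)
      = f (a + c k) * G k + (\<Sum>j\<in>K - {k}. f ((c(k := a + c k)) j) * G j)"
    using assms(1) by (subst sum.insert_remove) simp_all
  also have "(\<Sum>j\<in>K - {k}. f ((c(k := a + c k)) j) * G j) = (\<Sum>j\<in>K - {k}. f (c j) * G j)"
    by (intro sum.cong refl) auto
  also have "f (a + c k) * G k + (\<Sum>j\<in>K - {k}. f (c j) * G j)
      = f a * G k + (\<Sum>j\<in>K. f (c j) * G j)"
    using assms(1) c0[of k] by (cases "k \<in> K") (simp_all add: f distrib_right add.assoc sum.remove[of K k])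
  finally show ?thesis .
qed

lemma vanishing_representation:
  "x \<in> vanishing \<Longrightarrow> \<exists>K f. finite K \<and> (\<forall>k. k \<notin> K \<longrightarrow> f k = 0) \<and> (\<forall>k. has_value (f k) (ev k) 0)
     \<and> x = (\<Sum>k\<in>K. e (f k) * (et k * u0))"
proof (induction rule: vanishing.induct)
  case zero
  have "has_value 0 x 0" for x using has_value_cst[of 0] by simp
  then show ?case by (intro exI[of _ "{}"] exI[of _ "\<lambda>_. 0"]) simp
next
  case (step g m h)
  then obtain K f where K: "finite K" "\<And>k. k \<notin> K \<Longrightarrow> f k = 0" "\<And>k. has_value (f k) (ev k) 0"
    "h = (\<Sum>k\<in>K. e (f k) * (et k * u0))" by blast
  have "e g * (et m * u0) + h = (\<Sum>k\<in>insert m K. e ((f(m := g + f m)) k) * (et k * u0))"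
    by (subst sum_insert_update) (simp_all add: K e_add)
  moreover have "has_value ((f(m := g + f m)) k) (ev k) 0" for k
    using K(3)[of k] has_value_add[OF step(2) K(3)[of m]] by simp
  ultimately show ?case
    using K by (intro exI[of _ "insert m K"] exI[of _ "f(m := g + f m)"]) simp
qed

lemma vanishing_constants:
  assumes "finite K" "(\<Sum>k\<in>K. e (cst (d k)) * (et k * u0)) \<in> vanishing" "m \<in> K"
  shows "d m = 0"
proof -
  obtain K' f where K': "finite K'" "\<And>k. k \<notin> K' \<Longrightarrow> f k = 0" "\<And>k. has_value (f k) (ev k) 0"
    "(\<Sum>k\<in>K. e (cst (d k)) * (et k * u0)) = (\<Sum>k\<in>K'. e (f k) * (et k * u0))"
    using vanishing_representation[OF assms(2)] by metis
  define d' where "d' k = (if k \<in> K then d k else 0)" for k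
  have "(\<Sum>k\<in>K. e (cst (d k)) * (et k * u0)) = (\<Sum>k\<in>K \<union> K'. e (cst (d' k)) * (et k * u0))"
    using assms(1) K'(1) by (intro sum.mono_neutral_cong_left) (auto simp: d'_def)
  moreover have "(\<Sum>k\<in>K'. e (f k) * (et k * u0)) = (\<Sum>k\<in>K \<union> K'. e (f k) * (et k * u0))"
    using assms(1) K'(1,2) by (intro sum.mono_neutral_left) auto
  ultimately have "(\<Sum>k\<in>K \<union> K'. e (cst (d' k)) * (et k * u0)) - (\<Sum>k\<in>K \<union> K'. e (f k) * (et k * u0)) = 0"
    using K'(4) by simp
  then have "(\<Sum>k\<in>K \<union> K'. e (cst (d' k) - f k) * et k * u0) = 0"
    by (simp only: e_diff left_diff_distrib sum_subtractf mult.assoc)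
  from left_et_one0_independent[OF _ inj_on_id2 this, of m] have "cst (d' m) = f m"
    using assms K'(1) by simp
  with K'(3)[of m] have "0 = d' m" by (metis has_value_cst_unique)
  then show ?thesis using assms(3) by (simp add: d'_def)
qed

end

section \<open>Eigenvectors built by intertwiners\<close>

context localized_DAHA
begin

sublocale cs: vector_space "\<lambda>c h. e (cst c) * h"
  by unfold_locales
    (simp_all only: e_add e_mult cst_add cst_mult distrib_left distrib_right mult.assoc cst_1 e_1 mult_1_left)

text \<open>
  The complex span of the powers of \<open>X\<close> with exponents in \<open>A\<close>; all leading-term bookkeeping for Laurent
  polynomials in \<open>X\<close> takes place here.
\<close>

definition X_span :: "int set \<Rightarrow> 'h set" where
  "X_span A = cs.span (Xp ` A)"

lemma X_span_add: "x \<in> X_span A \<Longrightarrow> y \<in> X_span A \<Longrightarrow> x + y \<in> X_span A"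
  and X_span_diff: "x \<in> X_span A \<Longrightarrow> y \<in> X_span A \<Longrightarrow> x - y \<in> X_span A"
  and X_span_scale: "x \<in> X_span A \<Longrightarrow> e (cst c) * x \<in> X_span A"
  and X_span_0: "0 \<in> X_span A"
  unfolding X_span_def by (rule cs.span_add cs.span_diff cs.span_scale cs.span_zero; assumption?)+

lemma X_span_mono: "A \<subseteq> B \<Longrightarrow> X_span A \<subseteq> X_span B"
  unfolding X_span_def by (intro cs.span_mono image_mono)

lemma Xp_X_span: "k \<in> A \<Longrightarrow> Xp k \<in> X_span A"
  unfolding X_span_def by (intro cs.span_base imageI)

lemma X_span_induct [consumes 1, case_names zero step]:
  assumes "v \<in> X_span A" "P 0" "\<And>c k x. k \<in> A \<Longrightarrow> P x \<Longrightarrow> P (e (cst c) * Xp k + x)"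
  shows "P v"
  using assms(1)[unfolded X_span_def]
proof (rule cs.span_induct_alt)
  fix c x y assume x: "x \<in> Xp ` A" and y: "P y"
  from x obtain k where "x = Xp k" "k \<in> A" by (rule imageE)
  then show "P (e (cst c) * x + y)" using assms(3) y by simp
qed (rule assms(2))

lemma Xp_add: "Xp (j + k) = Xp j * Xp k"
  by (rule zpow_add[OF X_Xinv Xinv_X])

lemma X_Xp: "X H * Xp k = Xp (k + 1)" and Xinv_Xp: "Xinv H * Xp k = Xp (k - 1)"
  using Xp_add[of 1 k] Xp_add[of "- 1" k] by (simp_all add: add.commute)

lemma X_span_mult:
  assumes "v \<in> X_span A" "\<And>k. k \<in> A \<Longrightarrow> h * Xp k \<in> X_span B" shows "h * v \<in> X_span B"
  using assms(1)
proof (induction rule: X_span_induct)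
  case zero show ?case by (simp add: X_span_0)
next
  case (step c k x)
  have "h * (e (cst c) * Xp k + x) = e (cst c) * (h * Xp k) + h * x"
    unfolding distrib_left by (simp only: e_cst_central[of c h, symmetric] flip: mult.assoc)
  then show ?case using assms(2)[OF step(1)] step(2) by (simp only: X_span_add X_span_scale)
qed

lemma daha_int_1: "1 \<in> daha_int H"
  using daha_int.scal[of H 1] by (simp add: scal_def)

lemma daha_int_p: "p \<in> daha_int H"
  unfolding p_def' by (intro daha_int.intros)

lemma daha_int_cst: "e (cst c) \<in> daha_int H"
  using daha_int.scal[of H c] by (simp add: scal_def)

lemma daha_int_Yvar: "e Yvar \<in> daha_int H" and daha_int_Yinv: "e (inverse Yvar) \<in> daha_int H"
  using daha_int.Y[of H] daha_int.Yinv[of H] by (simp_all add: Y_def Yinv_def)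

lemma daha_int_diff: "a \<in> daha_int H \<Longrightarrow> b \<in> daha_int H \<Longrightarrow> a - b \<in> daha_int H"
  using daha_int.add[OF _ daha_int.mult[OF daha_int_cst[of "- 1"]], of a b]
  by (simp add: cst_minus e_minus)

text \<open>
  The part of the annihilator of \<open>\<one>\<^sub>Y\<close> that also annihilates \<open>\<one>\<^sub>0\<close>. Congruences modulo this left ideal are
  therefore valid in the polynomial representation and turn into equations after multiplication by \<open>\<one>\<^sub>0\<close>.
\<close>

definition T1_ideal :: "'h set" where
  "T1_ideal = {a * (T1 H - e (cst th)) | a. a \<in> daha_int H}"

lemma T1_ideal_I: "a \<in> daha_int H \<Longrightarrow> a * (T1 H - e (cst th)) \<in> T1_ideal"
  unfolding T1_ideal_def mem_Collect_eq by (intro exI conjI) (rule refl)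

lemma T1_ideal_E: assumes "x \<in> T1_ideal" obtains a where "x = a * (T1 H - e (cst th))" "a \<in> daha_int H"
  using assms unfolding T1_ideal_def mem_Collect_eq by (elim exE conjE)

lemma T1_ideal_mult: assumes "a \<in> daha_int H" "x \<in> T1_ideal" shows "a * x \<in> T1_ideal"
proof -
  from assms(2) obtain b where "x = b * (T1 H - e (cst th))" "b \<in> daha_int H" by (rule T1_ideal_E)
  then show ?thesis using T1_ideal_I[OF daha_int.mult[OF assms(1)], of b] by (simp only: mult.assoc)
qed

lemma T1_ideal_add: assumes "x \<in> T1_ideal" "y \<in> T1_ideal" shows "x + y \<in> T1_ideal"
proof -
  from assms(1) obtain a where "x = a * (T1 H - e (cst th))" "a \<in> daha_int H" by (rule T1_ideal_E)
  moreover from assms(2) obtain b where "y = b * (T1 H - e (cst th))" "b \<in> daha_int H" by (rule T1_ideal_E)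
  ultimately show ?thesis using T1_ideal_I[OF daha_int.add, of a b] by (simp only: distrib_right)
qed

lemma T1_ideal_0: "0 \<in> T1_ideal"
  using T1_ideal_I[OF daha_int_cst[of 0]] by simp

lemma T1_ideal_one0: "x \<in> T1_ideal \<Longrightarrow> x * u0 = 0"
  by (erule T1_ideal_E) (simp add: mult.assoc left_diff_distrib T1_one0)

abbreviation ann :: "'h set" where "ann \<equiv> ann_1Y th H"

lemma ann_I: "a \<in> daha_int H \<Longrightarrow> b \<in> daha_int H \<Longrightarrow> a * (T1 H - e (cst th)) + b * (Tpi H - 1) \<in> ann"
  unfolding ann_1Y_def scal_def mem_Collect_eq by (intro exI conjI) (rule refl)

lemma ann_E:
  assumes "x \<in> ann"
  obtains a b where "a \<in> daha_int H" "b \<in> daha_int H" "x = a * (T1 H - e (cst th)) + b * (Tpi H - 1)"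
  using assms unfolding ann_1Y_def scal_def mem_Collect_eq by (elim exE conjE)

lemma ann_mult: assumes "c \<in> daha_int H" "x \<in> ann" shows "c * x \<in> ann"
proof -
  from assms(2) obtain a b where ab: "a \<in> daha_int H" "b \<in> daha_int H"
    "x = a * (T1 H - e (cst th)) + b * (Tpi H - 1)" by (rule ann_E)
  then show ?thesis
    using ann_I[OF daha_int.mult[OF assms(1), of a] daha_int.mult[OF assms(1), of b]]
    by (simp only: mult.assoc distrib_left)
qed

lemma ann_add: assumes "x \<in> ann" "y \<in> ann" shows "x + y \<in> ann"
proof -
  from assms(1) obtain a b where x: "a \<in> daha_int H" "b \<in> daha_int H"
    "x = a * (T1 H - e (cst th)) + b * (Tpi H - 1)" by (rule ann_E)
  from assms(2) obtain c d where y: "c \<in> daha_int H" "d \<in> daha_int H"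
    "y = c * (T1 H - e (cst th)) + d * (Tpi H - 1)" by (rule ann_E)
  have "x + y = (a + c) * (T1 H - e (cst th)) + (b + d) * (Tpi H - 1)"
    unfolding x(3) y(3) distrib_right by (simp only: ac_simps)
  then show ?thesis
    using ann_I[OF daha_int.add[OF x(1) y(1)] daha_int.add[OF x(2) y(2)]] by simp
qed

lemma T1_ideal_ann: "x \<in> T1_ideal \<Longrightarrow> x \<in> ann"
proof -
  assume "x \<in> T1_ideal"
  then obtain a where "x = a * (T1 H - e (cst th))" "a \<in> daha_int H" by (rule T1_ideal_E)
  then show ?thesis using ann_I[OF _ daha_int_cst[of 0], of a] by simp
qed

lemma ann_scale: "x \<in> ann \<Longrightarrow> e (cst c) * x \<in> ann"
  by (rule ann_mult[OF daha_int_cst])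

lemma ann_diff: "x \<in> ann \<Longrightarrow> y \<in> ann \<Longrightarrow> x - y \<in> ann"
  using ann_add[of x "e (cst (- 1)) * y"] ann_scale[of y "- 1"]
  by (simp add: cst_minus e_minus)

lemma T1_ideal_scale: "x \<in> T1_ideal \<Longrightarrow> e (cst c) * x \<in> T1_ideal"
  by (rule T1_ideal_mult[OF daha_int_cst])

lemma T1_X: "T1 H * X H = Xinv H * T1inv H"
proof -
  have "T1 H * X H * T1 H * T1inv H = Xinv H * T1inv H" by (simp only: T1_X_T1)
  then show ?thesis by (simp only: mult.assoc T1_T1inv mult_1_right)
qed

lemma T1_Xinv: "T1 H * Xinv H = e (cst \<delta>) * Xinv H + X H * T1 H"
proof -
  have "T1 H * Xinv H = (T1 H * T1 H) * (X H * T1 H)"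
    by (simp only: T1_X_T1[symmetric] mult.assoc)
  also have "\<dots> = e (cst \<delta>) * (T1 H * X H * T1 H) + X H * T1 H"
    by (simp only: T1_sq distrib_right mult.assoc mult_1_left)
  finally show ?thesis by (simp only: T1_X_T1)
qed

text \<open>
  Leading terms of the Demazure-Lusztig operator. For a positive exponent, \<open>T\<^sub>1 X = X\<^sup>-\<^sup>1 (T\<^sub>1 - (t\<^sup>1\<^sup>/\<^sup>2 - t\<^sup>-\<^sup>1\<^sup>/\<^sup>2))\<close> gives an
  induction in which the extreme term is shifted and all other exponents stay strictly between.
\<close>

lemma T1_Xp_pos:
  "\<exists>r \<in> X_span {- int n - 1<..<int n + 1}.
     T1 H * Xp (int n + 1) - (e (cst (inverse th)) * Xp (- int n - 1) + r) \<in> T1_ideal"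
proof (induction n)
  case 0
  have "T1 H * X H - (e (cst (inverse th)) * Xinv H) = Xinv H * (T1 H - e (cst \<delta>) - e (cst (inverse th)))"
    by (simp only: T1_X T1inv_eq right_diff_distrib e_cst_central[of "inverse th" "Xinv H"])
  also have "\<dots> = Xinv H * (T1 H - e (cst th))"
    by (simp add: cst_diff e_diff)
  also have "\<dots> \<in> T1_ideal" by (intro T1_ideal_I daha_int.intros)
  finally show ?case by (intro bexI[of _ 0]) (simp_all add: X_span_0)
next
  case (Suc n)
  then obtain r where r: "r \<in> X_span {- int n - 1<..<int n + 1}"
    "T1 H * Xp (int n + 1) - (e (cst (inverse th)) * Xp (- int n - 1) + r) \<in> T1_ideal" by blast
  define r' where "r' = Xinv H * r - e (cst \<delta>) * Xp (int n)"
  have "T1 H * Xp (int n + 1 + 1) = T1 H * X H * Xp (int n + 1)"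
    by (simp only: mult.assoc X_Xp)
  also have "\<dots> = Xinv H * (T1 H * Xp (int n + 1)) - e (cst \<delta>) * (Xinv H * Xp (int n + 1))"
    by (simp only: T1_X T1inv_eq right_diff_distrib left_diff_distrib mult.assoc
        e_cst_central[of \<delta> "Xinv H", symmetric] flip: mult.assoc)
  finally have "T1 H * Xp (int n + 1 + 1) - (e (cst (inverse th)) * Xp (- int n - 1 - 1) + r')
     = Xinv H * (T1 H * Xp (int n + 1) - (e (cst (inverse th)) * Xp (- int n - 1) + r))"
    unfolding r'_def
    by (simp add: right_diff_distrib distrib_left Xinv_Xp
        mult_assoc_cong[OF e_cst_central[of "inverse th" "Xinv H", symmetric]] mult.assoc)
  also have "\<dots> \<in> T1_ideal" by (intro T1_ideal_mult daha_int.intros r(2))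
  finally have "T1 H * Xp (int (Suc n) + 1) - (e (cst (inverse th)) * Xp (- int (Suc n) - 1) + r') \<in> T1_ideal"
    by (simp add: algebra_simps)
  moreover have "r' \<in> X_span {- int (Suc n) - 1<..<int (Suc n) + 1}"
    unfolding r'_def
    by (intro X_span_diff X_span_scale Xp_X_span X_span_mult[OF r(1)]) (auto simp: Xinv_Xp intro!: Xp_X_span)
  ultimately show ?case by blast
qed

text \<open>
  The analogous induction for a nonpositive exponent \<open>-n\<close>; here the term \<open>X\<^sup>-\<^sup>n\<close> itself survives, which is why the
  bound includes \<open>-n\<close> but not \<open>n\<close>.
\<close>

lemma T1_Xp_neg:
  "\<exists>r \<in> X_span {- int n..<int n}. T1 H * Xp (- int n) - (e (cst th) * Xp (int n) + r) \<in> T1_ideal"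
proof (induction n)
  case 0
  have "1 * (T1 H - e (cst th)) \<in> T1_ideal" by (intro T1_ideal_I daha_int_1)
  then show ?case by (intro bexI[of _ 0]) (simp_all add: X_span_0)
next
  case (Suc n)
  then obtain r where r: "r \<in> X_span {- int n..<int n}"
    "T1 H * Xp (- int n) - (e (cst th) * Xp (int n) + r) \<in> T1_ideal" by blast
  define r' where "r' = X H * r + e (cst \<delta>) * Xp (- int n - 1)"
  have "T1 H * Xp (- int n - 1) = T1 H * Xinv H * Xp (- int n)"
    by (simp only: mult.assoc Xinv_Xp)
  also have "\<dots> = e (cst \<delta>) * Xp (- int n - 1) + X H * (T1 H * Xp (- int n))"
    by (simp only: T1_Xinv distrib_right mult.assoc Xinv_Xp)
  finally have "T1 H * Xp (- int n - 1) - (e (cst th) * Xp (int n + 1) + r')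
     = X H * (T1 H * Xp (- int n) - (e (cst th) * Xp (int n) + r))"
    unfolding r'_def
    by (simp add: right_diff_distrib distrib_left X_Xp
        mult_assoc_cong[OF e_cst_central[of th "X H", symmetric]] mult.assoc)
  also have "\<dots> \<in> T1_ideal" by (intro T1_ideal_mult daha_int.intros r(2))
  finally have "T1 H * Xp (- int (Suc n)) - (e (cst th) * Xp (int (Suc n)) + r') \<in> T1_ideal"
    by (simp add: algebra_simps minus_diff_commute)
  moreover have "r' \<in> X_span {- int (Suc n)..<int (Suc n)}"
    unfolding r'_def
    by (intro X_span_add X_span_scale Xp_X_span X_span_mult[OF r(1)]) (auto simp: X_Xp intro!: Xp_X_span)
  ultimately show ?case by blast
qed

lemma T1_Xp: "\<exists>r \<in> X_span {- \<bar>k\<bar>..\<bar>k\<bar>}. T1 H * Xp k - r \<in> T1_ideal"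
proof (cases "k > 0")
  case True
  define n where "n = nat (k - 1)"
  then have k: "k = int n + 1" using True by simp
  obtain r where r: "r \<in> X_span {- int n - 1<..<int n + 1}"
    "T1 H * Xp (int n + 1) - (e (cst (inverse th)) * Xp (- int n - 1) + r) \<in> T1_ideal"
    using T1_Xp_pos by blast
  have "r \<in> X_span {- \<bar>k\<bar>..\<bar>k\<bar>}"
    by (rule subsetD[OF X_span_mono r(1)]) (auto simp: k)
  then have "e (cst (inverse th)) * Xp (- int n - 1) + r \<in> X_span {- \<bar>k\<bar>..\<bar>k\<bar>}"
    by (intro X_span_add X_span_scale Xp_X_span) (auto simp: k)
  with r(2) show ?thesis unfolding k by blast
next
  case False
  define n where "n = nat (- k)"
  then have k: "k = - int n" using False by simp
  obtain r where r: "r \<in> X_span {- int n..<int n}"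
    "T1 H * Xp (- int n) - (e (cst th) * Xp (int n) + r) \<in> T1_ideal"
    using T1_Xp_neg by blast
  have "r \<in> X_span {- \<bar>k\<bar>..\<bar>k\<bar>}"
    by (rule subsetD[OF X_span_mono r(1)]) (auto simp: k)
  then have "e (cst th) * Xp (int n) + r \<in> X_span {- \<bar>k\<bar>..\<bar>k\<bar>}"
    by (intro X_span_add X_span_scale Xp_X_span) (auto simp: k)
  with r(2) show ?thesis unfolding k by blast
qed

lemma T1_X_span:
  assumes "v \<in> X_span A" "\<And>k. k \<in> A \<Longrightarrow> \<exists>r \<in> X_span B. T1 H * Xp k - r \<in> T1_ideal"
  shows "\<exists>r \<in> X_span B. T1 H * v - r \<in> T1_ideal"
  using assms(1)
proof (induction rule: X_span_induct)
  case zero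
  show ?case by (intro bexI[of _ 0]) (simp_all add: T1_ideal_0 X_span_0)
next
  case (step c k x)
  obtain r where r: "r \<in> X_span B" "T1 H * Xp k - r \<in> T1_ideal" using assms(2)[OF step(1)] by blast
  obtain r' where r': "r' \<in> X_span B" "T1 H * x - r' \<in> T1_ideal" using step(2) by blast
  have "T1 H * (e (cst c) * Xp k + x) - (e (cst c) * r + r')
      = e (cst c) * (T1 H * Xp k - r) + (T1 H * x - r')"
    by (simp add: distrib_left right_diff_distrib
        mult_assoc_cong[OF e_cst_central[of c "T1 H", symmetric]] mult.assoc)
  also have "\<dots> \<in> T1_ideal" by (intro T1_ideal_add T1_ideal_scale r r')
  finally show ?case using X_span_add[OF X_span_scale[OF r(1)] r'(1)] by blast
qed

text \<open>
  The exponents below \<open>m\<close> in the order \<open>0, 1, -1, 2, -2, \<dots>\<close> in which the eigenvectors are constructed.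
\<close>

definition lower_exps :: "int \<Rightarrow> int set" where
  "lower_exps m = (if m > 0 then {- m<..<m} else {m<..- m})"

text \<open>
  The properties carried through the construction: \<open>v\<close> is a monic Laurent polynomial in \<open>X\<close> with lower terms
  below \<open>m\<close>, it represents an eigenvector in the polynomial representation, and modulo \<open>vanishing\<close> it is a nonzero
  multiple of \<open>\<eta>\<^sup>m \<one>\<^sub>0\<close>.
\<close>

definition eigenpoly :: "int \<Rightarrow> 'h \<Rightarrow> bool" where
  "eigenpoly m v \<longleftrightarrow> v - Xp m \<in> X_span (lower_exps m) \<and> (e Yvar - e (cst (ev m))) * v \<in> ann
     \<and> (\<exists>c. c \<noteq> 0 \<and> v * u0 - e (cst c) * (et m * u0) \<in> vanishing)"

lemma eigenpolyD:
  assumes "eigenpoly m v"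
  shows "v - Xp m \<in> X_span (lower_exps m)" "(e Yvar - e (cst (ev m))) * v \<in> ann"
    "\<exists>c. c \<noteq> 0 \<and> v * u0 - e (cst c) * (et m * u0) \<in> vanishing"
  using assms unfolding eigenpoly_def by blast+

lemma eigenpoly_0: "eigenpoly 0 1"
proof -
  have "(e Yvar - e (cst (ev 0))) * 1 = Tpi H * (T1 H - e (cst th)) + e (cst th) * (Tpi H - 1)"
    by (simp add: ev_0 right_diff_distrib Tpi_T1 e_cst_central[of th "Tpi H"])
  also have "\<dots> \<in> ann" by (intro ann_I daha_int.intros daha_int_cst)
  finally have "(e Yvar - e (cst (ev 0))) * 1 \<in> ann" .
  moreover have "\<exists>c. c \<noteq> 0 \<and> 1 * u0 - e (cst c) * (et 0 * u0) \<in> vanishing"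
    by (intro exI[of _ 1]) (simp add: vanishing.zero)
  ultimately show ?thesis unfolding eigenpoly_def by (simp add: X_span_0)
qed

lemma ann_Yinv:
  assumes "(e Yvar - e (cst y)) * v \<in> ann" "y \<noteq> 0"
  shows "(e (inverse Yvar) - e (cst (inverse y))) * v \<in> ann"
proof -
  have "inverse Yvar - cst (inverse y) = cst (- inverse y) * inverse Yvar * (Yvar - cst y)"
    unfolding cst_minus cst_inverse using assms(2) by (simp add: field_simps)
  then have "(e (inverse Yvar) - e (cst (inverse y))) * v
      = e (cst (- inverse y)) * (e (inverse Yvar) * ((e Yvar - e (cst y)) * v))"
    by (simp only: e_mult mult.assoc flip: e_diff)
  also have "\<dots> \<in> ann"
    by (intro ann_mult[OF daha_int_cst] ann_mult[OF daha_int_Yinv] assms(1))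
  finally show ?thesis .
qed

lemma e_cst_left_commute: "e (cst c) * (h * x) = h * (e (cst c) * x)"
  by (simp only: e_cst_central[of c h] flip: mult.assoc)

text \<open>
  The intertwiner \<open>p\<close> belongs to the integral algebra and moves \<open>Y\<close> to \<open>q\<^sup>-\<^sup>1\<^sup>/\<^sup>2 Y\<^sup>-\<^sup>1\<close>, which takes the \<open>k\<close>-th eigenvalue
  to the \<open>(1-k)\<close>-th.
\<close>

lemma ann_p:
  assumes "(e Yvar - e (cst (ev k))) * v \<in> ann"
  shows "(e Yvar - e (cst (ev (1 - k)))) * (p * v) \<in> ann"
proof -
  let ?y = "ev k"
  have y: "?y \<noteq> 0" using spectrum_neq_0 ev_in_spectrum by blast
  have "subst gp (cst (inverse qh) * (inverse Yvar - cst (inverse ?y))) = Yvar - cst (ev (1 - k))"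
    unfolding ev_one_minus by (simp add: gp.subst_simps cst_inverse cst_mult right_diff_distrib)
  then have "e (Yvar - cst (ev (1 - k))) * p
      = p * e (cst (inverse qh) * (inverse Yvar - cst (inverse ?y)))"
    by (simp only: p_commute)
  then have "(e Yvar - e (cst (ev (1 - k)))) * (p * v)
      = p * (e (cst (inverse qh)) * ((e (inverse Yvar) - e (cst (inverse ?y))) * v))"
    by (simp only: mult.assoc[symmetric] e_diff[symmetric]) (simp only: e_mult mult.assoc)
  also have "\<dots> \<in> ann"
    by (intro ann_mult[OF daha_int_p] ann_mult[OF daha_int_cst] ann_Yinv assms y)
  finally show ?thesis .
qed

lemma Y_T1: "e Yvar * T1 H = T1 H * e (inverse Yvar) + e (cst \<delta>) * e Yvar"
proof -
  have "e Yvar * T1inv H = T1 H * e (inverse Yvar)" using Tpi_eq Tpi_eq' by simp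
  then show ?thesis
    by (simp only: T1inv_eq right_diff_distrib e_cst_central[of \<delta> "e Yvar"] diff_eq_eq)
qed

text \<open>
  The value at \<open>Y = y\<close> of the correction term that makes \<open>T\<^sub>1\<close> an intertwiner. On a \<open>y\<close>-eigenvector the operator
  \<open>T\<^sub>1 + T1_shift y\<close> acts like \<open>\<tau>\<^sub>1\<close>, yet it lies in the integral algebra.
\<close>

definition T1_shift :: "complex \<Rightarrow> complex" where
  "T1_shift y = inverse th * (1 - t) / (1 - inverse (y\<^sup>2))"

lemma ann_T1:
  assumes "(e Yvar - e (cst y)) * v \<in> ann" "y \<noteq> 0" "y\<^sup>2 \<noteq> 1"
  shows "(e Yvar - e (cst (inverse y))) * (T1 H * v + e (cst (T1_shift y)) * v) \<in> ann"
proof -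
  let ?c = "T1_shift y"
  have "1 - inverse (y\<^sup>2) \<noteq> 0"
    using assms(3) by (metis inverse_eq_1_iff right_minus_eq)
  then have scalar: "(\<delta> + ?c) * y = ?c * inverse y"
    using assms(2) unfolding T1_shift_def
    by (simp add: divide_simps) (simp add: algebra_simps power2_eq_square)
  have "(e Yvar - e (cst (inverse y))) * (T1 H * v + e (cst ?c) * v)
     = T1 H * ((e (inverse Yvar) - e (cst (inverse y))) * v)
       + (e (cst (\<delta> + ?c))) * ((e Yvar - e (cst y)) * v)"
  proof -
    have 1: "e Yvar * (T1 H * v) = T1 H * (e (inverse Yvar) * v) + e (cst \<delta>) * (e Yvar * v)"
      using mult_assoc_cong[OF Y_T1, of v] by (simp only: distrib_right mult.assoc)
    have 2: "e (cst (inverse y)) * (e (cst ?c) * v) = e (cst (\<delta> + ?c)) * (e (cst y) * v)"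
      using scalar by (simp only: mult.commute[of "inverse y"] flip: mult.assoc e_mult cst_mult)
    have 3: "e (cst (\<delta> + ?c)) = e (cst \<delta>) + e (cst ?c)"
      by (simp only: cst_add e_add)
    show ?thesis
      unfolding left_diff_distrib right_diff_distrib distrib_left distrib_right 1 2
        e_cst_left_commute[of "inverse y" "T1 H" v] e_cst_left_commute[of ?c "e Yvar" v, symmetric]
      by (simp only: 3 distrib_right) (simp only: algebra_simps)
  qed
  also have "\<dots> \<in> ann"
    by (intro ann_add ann_mult[OF daha_int.T1] ann_scale ann_Yinv assms)
  finally show ?thesis .
qed

text \<open>
  Apply \<open>p\<close> and normalize. Modulo the ideal, \<open>T\<^sub>1 X\<^sup>-\<^sup>l\<close> has top term \<open>t\<^sup>1\<^sup>/\<^sup>2 X\<^sup>l\<close>, so \<open>p X\<^sup>-\<^sup>l = X T\<^sub>1 X\<^sup>-\<^sup>l\<close> has top term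
  \<open>t\<^sup>1\<^sup>/\<^sup>2 X\<^sup>l\<^sup>+\<^sup>1\<close>.
\<close>

lemma eigenpoly_up:
  assumes "eigenpoly (- int l) v"
  obtains w where "eigenpoly (int l + 1) w" "w * u0 = e (cst (inverse th)) * (p * (v * u0))"
proof -
  let ?c = "e (cst (inverse th))"
  define v' where "v' = v - Xp (- int l)"
  have v': "v' \<in> X_span {- int l<..int l}"
    using eigenpolyD(1)[OF assms] by (simp add: v'_def lower_exps_def split: if_splits)
  obtain r where r: "r \<in> X_span {- int l..<int l}"
    "T1 H * Xp (- int l) - (e (cst th) * Xp (int l) + r) \<in> T1_ideal" using T1_Xp_neg by blast
  have "\<exists>r' \<in> X_span {- int l..<int l}. T1 H * v' - r' \<in> T1_ideal"
  proof (rule T1_X_span[OF v'])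
    fix k assume k: "k \<in> {- int l<..int l}"
    show "\<exists>r \<in> X_span {- int l..<int l}. T1 H * Xp k - r \<in> T1_ideal"
    proof (cases "k = int l")
      case True
      define n where "n = l - 1"
      have n: "int l = int n + 1" "- int l = - int n - 1" using k True by (auto simp: n_def)
      obtain r where r: "r \<in> X_span {- int n - 1<..<int n + 1}"
        "T1 H * Xp (int n + 1) - (?c * Xp (- int n - 1) + r) \<in> T1_ideal"
        using T1_Xp_pos by blast
      have "r \<in> X_span {- int l..<int l}"
        by (rule subsetD[OF X_span_mono r(1)]) (auto simp: n)
      then have "?c * Xp (- int n - 1) + r \<in> X_span {- int l..<int l}"
        by (intro X_span_add X_span_scale Xp_X_span) (auto simp: n)
      with r(2) show ?thesis unfolding True n(1) by blast
    next
      case False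
      then have "X_span {- \<bar>k\<bar>..\<bar>k\<bar>} \<subseteq> X_span {- int l..<int l}"
        using k by (intro X_span_mono) auto
      then show ?thesis using T1_Xp[of k] by blast
    qed
  qed
  then obtain r' where r': "r' \<in> X_span {- int l..<int l}" "T1 H * v' - r' \<in> T1_ideal" by blast
  define w where "w = Xp (int l + 1) + ?c * (X H * (r + r'))"
  have Xr: "?c * (X H * (r + r')) \<in> X_span (lower_exps (int l + 1))"
    by (rule X_span_scale, rule X_span_mult[OF X_span_add[OF r(1) r'(1)]])
       (auto simp: X_Xp lower_exps_def intro!: Xp_X_span)
  have "?c * (e (cst th) * x) = x" for x
    by (simp flip: mult.assoc e_mult cst_mult)
  then have th: "?c * (X H * (e (cst th) * x)) = X H * x" for x
    by (simp only: e_cst_left_commute[of th "X H", symmetric])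
  have "X H * ((T1 H * Xp (- int l) - (e (cst th) * Xp (int l) + r)) + (T1 H * v' - r')) \<in> T1_ideal"
    by (intro T1_ideal_mult daha_int.intros T1_ideal_add r r')
  then have "?c * (X H * ((T1 H * Xp (- int l) - (e (cst th) * Xp (int l) + r)) + (T1 H * v' - r'))) \<in> T1_ideal"
    by (rule T1_ideal_scale)
  also have "?c * (X H * ((T1 H * Xp (- int l) - (e (cst th) * Xp (int l) + r)) + (T1 H * v' - r')))
     = ?c * (p * v) - w"
    unfolding w_def v'_def p_def'
    by (simp only: distrib_left right_diff_distrib th X_Xp mult.assoc) (simp add: algebra_simps)
  finally have pw: "?c * (p * v) - w \<in> T1_ideal" .
  then have "(?c * (p * v) - w) * u0 = 0" by (rule T1_ideal_one0)
  then have wu: "w * u0 = ?c * (p * (v * u0))"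
    by (simp add: left_diff_distrib mult.assoc)
  have "eigenpoly (int l + 1) w"
    unfolding eigenpoly_def
  proof (intro conjI)
    show "w - Xp (int l + 1) \<in> X_span (lower_exps (int l + 1))"
      using Xr by (simp add: w_def)
    let ?Y = "e Yvar - e (cst (ev (int l + 1)))"
    have "?Y * (p * v) \<in> ann"
      using ann_p[OF eigenpolyD(2)[OF assms]] by (simp add: add.commute)
    moreover have "?Y * (?c * (p * v) - w) \<in> ann"
      by (rule ann_mult[OF daha_int_diff[OF daha_int_Yvar daha_int_cst] T1_ideal_ann[OF pw]])
    ultimately have "?c * (?Y * (p * v)) - ?Y * (?c * (p * v) - w) \<in> ann"
      by (intro ann_diff ann_scale)
    also have "?c * (?Y * (p * v)) = ?Y * (?c * (p * v))"
      by (rule e_cst_left_commute)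
    also have "?Y * (?c * (p * v)) - ?Y * (?c * (p * v) - w) = ?Y * w"
      unfolding right_diff_distrib[of ?Y] by simp
    finally show "?Y * w \<in> ann" .
    obtain c where c: "c \<noteq> 0" "v * u0 - e (cst c) * (et (- int l) * u0) \<in> vanishing"
      using eigenpolyD(3)[OF assms] by blast
    have "p * (e (cst c) * (et (- int l) * u0)) = e (cst c) * (et (int l + 1) * u0)"
      by (simp only: p_e_et_one0 gp.subst_cst) (simp add: add.commute)
    then have "?c * (p * (v * u0 - e (cst c) * (et (- int l) * u0)))
        = w * u0 - e (cst (inverse th * c)) * (et (int l + 1) * u0)"
      by (simp only: right_diff_distrib wu cst_mult e_mult mult.assoc)
    moreover have "?c * (p * (v * u0 - e (cst c) * (et (- int l) * u0))) \<in> vanishing"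
      by (intro vanishing_regular_mult regular_cst vanishing_p c(2))
    ultimately have "w * u0 - e (cst (inverse th * c)) * (et (int l + 1) * u0) \<in> vanishing" by simp
    then show "\<exists>c. c \<noteq> 0 \<and> w * u0 - e (cst c) * (et (int l + 1) * u0) \<in> vanishing"
      using c(1) by (intro exI[of _ "inverse th * c"]) simp
  qed
  then show thesis using wu by (rule that)
qed

text \<open>
  Apply \<open>T\<^sub>1\<close> plus its shift and normalize. On \<open>\<eta>\<^sup>l \<one>\<^sub>0\<close> this produces a multiple of \<open>\<eta>\<^sup>l \<one>\<^sub>0\<close> whose coefficient vanishes
  at \<open>ev l\<close> by the choice of the shift, and \<open>phi \<eta>\<^sup>-\<^sup>l \<one>\<^sub>0\<close>. The latter does not vanish at \<open>ev (-l)\<close> since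
  \<open>q\<close> is not a root of unity.
\<close>

lemma eigenpoly_down:
  assumes "eigenpoly (int n + 1) v"
  obtains w where "eigenpoly (- int n - 1) w"
    "w * u0 = e (cst th) * (T1 H * (v * u0) + e (cst (T1_shift (ev (int n + 1)))) * (v * u0))"
proof -
  let ?l = "int n + 1"
  let ?y = "ev ?l"
  let ?k = "e (cst (T1_shift ?y))" and ?c = "e (cst th)" and ?i = "e (cst (inverse th))"
  have ml: "- int n - 1 = - ?l" by simp
  define v' where "v' = v - Xp ?l"
  have v': "v' \<in> X_span {- ?l<..<?l}"
    using eigenpolyD(1)[OF assms] by (simp add: v'_def lower_exps_def split: if_splits)
  obtain r where r: "r \<in> X_span {- ?l<..<?l}"
    "T1 H * Xp ?l - (?i * Xp (- ?l) + r) \<in> T1_ideal" using T1_Xp_pos[of n] unfolding ml by blast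
  have "\<exists>r' \<in> X_span {- ?l<..<?l}. T1 H * v' - r' \<in> T1_ideal"
  proof (rule T1_X_span[OF v'])
    fix k assume k: "k \<in> {- ?l<..<?l}"
    have "X_span {- \<bar>k\<bar>..\<bar>k\<bar>} \<subseteq> X_span {- ?l<..<?l}"
      using k by (intro X_span_mono) auto
    then show "\<exists>r \<in> X_span {- ?l<..<?l}. T1 H * Xp k - r \<in> T1_ideal" using T1_Xp[of k] by blast
  qed
  then obtain r' where r': "r' \<in> X_span {- ?l<..<?l}" "T1 H * v' - r' \<in> T1_ideal" by blast
  define w where "w = Xp (- ?l) + ?c * (r + r' + ?k * v)"
  have sub: "X_span {- ?l<..<?l} \<subseteq> X_span (lower_exps (- ?l))"
    by (intro X_span_mono) (auto simp: lower_exps_def)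
  have "Xp ?l + v' \<in> X_span (lower_exps (- ?l))"
    using sub v' by (intro X_span_add Xp_X_span) (auto simp: lower_exps_def)
  then have v: "v \<in> X_span (lower_exps (- ?l))" by (simp add: v'_def)
  have w_low: "?c * (r + r' + ?k * v) \<in> X_span (lower_exps (- ?l))"
    using sub r(1) r'(1) v by (intro X_span_scale X_span_add) auto
  have th: "?c * (?i * x) = x" for x
    by (simp flip: mult.assoc e_mult cst_mult)
  define h where "h = T1 H * v + ?k * v"
  have "?c * ((T1 H * Xp ?l - (?i * Xp (- ?l) + r)) + (T1 H * v' - r')) \<in> T1_ideal"
    by (intro T1_ideal_scale T1_ideal_add r r')
  also have "?c * ((T1 H * Xp ?l - (?i * Xp (- ?l) + r)) + (T1 H * v' - r')) = ?c * h - w"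
    unfolding w_def v'_def h_def
    by (simp only: distrib_left right_diff_distrib th) (simp add: algebra_simps)
  finally have hw: "?c * h - w \<in> T1_ideal" .
  then have "(?c * h - w) * u0 = 0" by (rule T1_ideal_one0)
  then have wu: "w * u0 = ?c * (T1 H * (v * u0) + ?k * (v * u0))"
    by (simp add: left_diff_distrib mult.assoc h_def distrib_right)
  have ev_l: "ev (- ?l) = inverse ?y" by (rule ev_minus) simp
  have y: "?y \<noteq> 0" "?y\<^sup>2 \<noteq> 1" using spectrum_neq_0 spectrum_sq_neq_1 ev_in_spectrum by blast+
  have "eigenpoly (- ?l) w"
    unfolding eigenpoly_def
  proof (intro conjI)
    show "w - Xp (- ?l) \<in> X_span (lower_exps (- ?l))"
      using w_low by (simp add: w_def)
    let ?Y = "e Yvar - e (cst (ev (- ?l)))"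
    have "?Y * h \<in> ann"
      unfolding h_def ev_l by (intro ann_T1 eigenpolyD(2)[OF assms] y)
    moreover have "?Y * (?c * h - w) \<in> ann"
      by (rule ann_mult[OF daha_int_diff[OF daha_int_Yvar daha_int_cst] T1_ideal_ann[OF hw]])
    ultimately have "?c * (?Y * h) - ?Y * (?c * h - w) \<in> ann"
      by (intro ann_diff ann_scale)
    also have "?c * (?Y * h) = ?Y * (?c * h)"
      by (rule e_cst_left_commute)
    also have "?Y * (?c * h) - ?Y * (?c * h - w) = ?Y * w"
      unfolding right_diff_distrib[of ?Y] by simp
    finally show "?Y * w \<in> ann" .
    obtain c where c: "c \<noteq> 0" "v * u0 - e (cst c) * (et ?l * u0) \<in> vanishing"
      using eigenpolyD(3)[OF assms] by blast
    let ?B = "et ?l * u0" and ?B' = "et (- ?l) * u0"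
    define i where "i = inverse (?y\<^sup>2)"
    define a where "a = (1 - t * inverse i) / (th * (1 - inverse i))"
    have i: "i = t * q powi ?l"
      unfolding i_def ev_sq by (simp add: power_int_diff power_int_add field_simps)
    have i1: "i \<noteq> 1" "i \<noteq> 0" using y unfolding i_def by (auto simp: inverse_eq_1_iff)
    have "1 - t * inverse i \<noteq> 0"
    proof
      assume "1 - t * inverse i = 0"
      then have "q powi ?l * t powi 0 = 1" using i i1 by (auto simp: field_simps)
      from q_t_indep[OF this] show False by simp
    qed
    then have a: "a \<noteq> 0" using i1 unfolding a_def by (auto simp: inverse_eq_1_iff)
    have i': "inverse ((ev (- ?l))\<^sup>2) = inverse i"
      unfolding i_def ev_l by (simp add: power_inverse)
    \<comment> \<open>Modulo \<open>vanishing\<close>, replace \<open>phi\<close> by its value \<open>a\<close> at \<open>ev (-l)\<close>.\<close>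
    have 1: "e (phi - cst a) * ?B' \<in> vanishing"
    proof (rule vanishing_base)
      show "regular (phi - cst a)" by (intro regular_diff regular_phi regular_cst)
      have "has_value (phi - cst a) (ev (- ?l)) (a - a)"
        using has_value_diff[OF has_value_phi(1)[OF ev_in_spectrum, of "- ?l"] has_value_cst[of a]]
        unfolding i' a_def .
      then show "has_value (phi - cst a) (ev (- ?l)) 0" by simp
    qed
    have 2: "e (phi' - cst (inverse th) + cst (T1_shift ?y)) * ?B \<in> vanishing"
    proof (rule vanishing_base)
      show "regular (phi' - cst (inverse th) + cst (T1_shift ?y))" by (intro regular_add regular_diff regular_phi' regular_cst)
      have "(t - i) / (th * (1 - i)) - inverse th + T1_shift ?y = 0"
        using i1 unfolding T1_shift_def i_def[symmetric] by (simp add: divide_simps)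
      moreover have "has_value (phi' - cst (inverse th) + cst (T1_shift ?y)) ?y
          ((t - i) / (th * (1 - i)) - inverse th + T1_shift ?y)"
        unfolding i_def by (intro has_value_add has_value_diff has_value_cst has_value_phi(2) ev_in_spectrum)
      ultimately show "has_value (phi' - cst (inverse th) + cst (T1_shift ?y)) ?y 0" by simp
    qed
    have T1B: "T1 H * ?B = e phi * ?B' + e (phi' - cst (inverse th)) * ?B"
      using T1_e_et_one0[of 1 ?l] by simp
    have "T1 H * (v * u0 - e (cst c) * ?B) + ?k * (v * u0 - e (cst c) * ?B) \<in> vanishing"
      by (intro vanishing_add vanishing_T1 vanishing_regular_mult[OF _ regular_cst] c(2))
    moreover have "e (cst c) * (e (phi - cst a) * ?B' + e (phi' - cst (inverse th) + cst (T1_shift ?y)) * ?B) \<in> vanishing"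
      by (intro vanishing_regular_mult[OF _ regular_cst] vanishing_add 1 2)
    ultimately have "?c * ((T1 H * (v * u0 - e (cst c) * ?B) + ?k * (v * u0 - e (cst c) * ?B))
       + e (cst c) * (e (phi - cst a) * ?B' + e (phi' - cst (inverse th) + cst (T1_shift ?y)) * ?B)) \<in> vanishing"
      using vanishing_regular_mult[OF vanishing_add regular_cst] by blast
    also have "(T1 H * (v * u0 - e (cst c) * ?B) + ?k * (v * u0 - e (cst c) * ?B))
       + e (cst c) * (e (phi - cst a) * ?B' + e (phi' - cst (inverse th) + cst (T1_shift ?y)) * ?B)
       = T1 H * (v * u0) + ?k * (v * u0) - e (cst c) * (e (cst a) * ?B')"
      unfolding right_diff_distrib distrib_left e_cst_left_commute[of c "T1 H" ?B, symmetric]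
        e_cst_left_commute[of "T1_shift ?y" "e (cst c)" ?B] T1B e_add e_diff left_diff_distrib distrib_right
      by (simp only: algebra_simps)
    finally have "w * u0 - e (cst (th * c * a)) * ?B' \<in> vanishing"
      by (simp only: right_diff_distrib wu[symmetric] cst_mult e_mult mult.assoc)
    then show "\<exists>c. c \<noteq> 0 \<and> w * u0 - e (cst c) * ?B' \<in> vanishing"
      using c(1) a by (intro exI[of _ "th * c * a"]) simp
  qed
  then show thesis using wu unfolding ml[symmetric] by (rule that)
qed

section \<open>Identification of the electronic Macdonald polynomials\<close>


lemma laurent_X_add: "laurent_X H (P + Q) = laurent_X H P + laurent_X H Q"
  unfolding laurent_X_def scal_def
  by (rule setsum_keys_plus_distrib[where f = "\<lambda>k c. e (cst c) * Xp k"])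
     (simp_all only: cst_0 e_0 mult_zero_left cst_add e_add distrib_right)

lemma laurent_X_single: "laurent_X H (Poly_Mapping.single k c) = e (cst c) * Xp k"
  by (simp add: laurent_X_def scal_def)

lemma X_span_laurent:
  assumes "v \<in> X_span A"
  shows "\<exists>P. laurent_X H P = v \<and> (\<forall>k. k \<notin> A \<longrightarrow> Poly_Mapping.lookup P k = 0)"
  using assms
proof (induction rule: X_span_induct)
  case zero
  show ?case by (intro exI[of _ 0]) (simp add: laurent_X_def)
next
  case (step c k x)
  then obtain P where P: "laurent_X H P = x" "\<And>k. k \<notin> A \<Longrightarrow> Poly_Mapping.lookup P k = 0"
    by blast
  have "Poly_Mapping.lookup (Poly_Mapping.single k c + P) j = 0" if "j \<notin> A" for j
    using that step(1) P(2)[OF that] by (auto simp: lookup_add lookup_single when_def)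
  then show ?case
    by (intro exI[of _ "Poly_Mapping.single k c + P"])
       (simp add: laurent_X_add laurent_X_single P(1))
qed

lemma laurent_X_X_span: "laurent_X H P \<in> X_span UNIV"
  unfolding laurent_X_def scal_def X_span_def
  by (intro cs.span_sum cs.span_scale cs.span_base imageI UNIV_I)

lemma laurent_X_eq_0:
  assumes "laurent_X H P = 0" shows "P = 0"
proof -
  let ?c = "\<lambda>i. if snd i then 0 else cst (Poly_Mapping.lookup P (fst i))"
  have "(\<Sum>i\<in>Poly_Mapping.keys P \<times> UNIV. e (?c i) * X_fam i)
      = (\<Sum>k\<in>Poly_Mapping.keys P. \<Sum>b\<in>UNIV. e (?c (k, b)) * X_fam (k, b))"
    by (simp only: sum.cartesian_product split_def prod.collapse)
  also have "\<dots> = laurent_X H P"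
    unfolding laurent_X_def scal_def by (intro sum.cong refl) (simp add: UNIV_bool X_fam_def)
  finally have "(\<Sum>i\<in>Poly_Mapping.keys P \<times> UNIV. e (?c i) * X_fam i) = 0"
    using assms by simp
  from X_fam_independent[OF finite_keys this]
  have "Poly_Mapping.lookup P k = 0" if "k \<in> Poly_Mapping.keys P" for k
    using that by (metis (no_types, lifting) SigmaI UNIV_I cst_eq_0_iff fst_conv snd_conv)
  then have "Poly_Mapping.keys P = {}"
    by (meson equals0I in_keys_iff)
  then show ?thesis by simp
qed

lemma laurent_X_inj: assumes "laurent_X H P = laurent_X H Q" shows "P = Q"
proof -
  have "laurent_X H (P - Q + Q) = laurent_X H (P - Q) + laurent_X H Q" by (rule laurent_X_add)
  then have "laurent_X H (P - Q) = 0" using assms by simp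
  then show ?thesis using laurent_X_eq_0 by fastforce
qed

text \<open>
  Powers of \<open>X\<close> are independent, so the coefficient of a Laurent polynomial can be read off in the algebra.
\<close>

lemma lookup_leading:
  assumes "laurent_X H P - e (cst c) * Xp m \<in> X_span A" "m \<notin> A"
  shows "Poly_Mapping.lookup P m = c"
proof -
  obtain Q where Q: "laurent_X H Q = laurent_X H P - e (cst c) * Xp m" "Poly_Mapping.lookup Q m = 0"
    using X_span_laurent[OF assms(1)] assms(2) by blast
  then have "laurent_X H (Poly_Mapping.single m c + Q) = laurent_X H P"
    by (simp add: laurent_X_add laurent_X_single)
  then have "P = Poly_Mapping.single m c + Q" by (rule laurent_X_inj[symmetric])
  then show ?thesis using Q(2) by (simp add: lookup_add)
qed

lemma eigenpoly_ex_nat: "(\<exists>v. eigenpoly (- int n) v) \<and> (\<exists>v. eigenpoly (int n + 1) v)"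
proof (induction n)
  case 0
  have "eigenpoly (- int 0) 1" using eigenpoly_0 by simp
  then show ?case using eigenpoly_up by blast
next
  case (Suc n)
  then obtain v where "eigenpoly (int n + 1) v" by blast
  then obtain w where "eigenpoly (- int n - 1) w" by (rule eigenpoly_down)
  then have w: "eigenpoly (- int (Suc n)) w" by (simp add: algebra_simps minus_diff_commute)
  then obtain w' where "eigenpoly (int (Suc n) + 1) w'" by (rule eigenpoly_up)
  with w show ?case by blast
qed

lemma eigenpoly_ex: "\<exists>v. eigenpoly k v"
proof (cases "k > 0")
  case True
  then have "k = int (nat (k - 1)) + 1" by simp
  then show ?thesis using eigenpoly_ex_nat[of "nat (k - 1)"] by simp
next
  case False
  then have "k = - int (nat (- k))" by simp
  then show ?thesis using eigenpoly_ex_nat[of "nat (- k)"] by simp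
qed

definition eigenvec :: "int \<Rightarrow> 'h" where "eigenvec k = (SOME v. eigenpoly k v)"

lemma eigenpoly_eigenvec: "eigenpoly k (eigenvec k)"
  unfolding eigenvec_def using eigenpoly_ex by (rule someI_ex)

text \<open>
  Triangularity: each eigenvector is a power of \<open>X\<close> plus earlier powers, so the eigenvectors span all Laurent
  polynomials.
\<close>

lemma Xp_span_eigenvec: "Xp k \<in> cs.span (range eigenvec)"
proof -
  have lower: "Xp m \<in> cs.span (range eigenvec)"
    if "\<And>j. j \<in> lower_exps m \<Longrightarrow> Xp j \<in> cs.span (range eigenvec)" for m
  proof -
    have "X_span (lower_exps m) \<subseteq> cs.span (range eigenvec)"
      unfolding X_span_def using that by (intro cs.span_minimal cs.subspace_span) auto
    then have "eigenvec m - Xp m \<in> cs.span (range eigenvec)"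
      using eigenpolyD(1)[OF eigenpoly_eigenvec] by blast
    then have "eigenvec m - (eigenvec m - Xp m) \<in> cs.span (range eigenvec)"
      by (rule cs.span_diff[OF cs.span_base[OF rangeI]])
    then show ?thesis by simp
  qed
  have "\<forall>k. \<bar>k\<bar> \<le> int n \<longrightarrow> Xp k \<in> cs.span (range eigenvec)" for n
  proof (induction n)
    case 0
    show ?case using lower[of 0] by (auto simp: lower_exps_def)
  next
    case (Suc n)
    have pos: "Xp (int n + 1) \<in> cs.span (range eigenvec)"
      by (rule lower) (use Suc in \<open>auto simp: lower_exps_def\<close>)
    have neg: "Xp (- int n - 1) \<in> cs.span (range eigenvec)"
    proof (rule lower)
      fix j assume "j \<in> lower_exps (- int n - 1)"
      then have "\<bar>j\<bar> \<le> int n \<or> j = int n + 1" by (auto simp: lower_exps_def)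
      then show "Xp j \<in> cs.span (range eigenvec)" using Suc pos by blast
    qed
    show ?case
    proof (intro allI impI)
      fix k assume "\<bar>k\<bar> \<le> int (Suc n)"
      then have "\<bar>k\<bar> \<le> int n \<or> k = int n + 1 \<or> k = - int n - 1" by linarith
      then show "Xp k \<in> cs.span (range eigenvec)" using Suc pos neg by blast
    qed
  qed
  from this[of "nat \<bar>k\<bar>"] show ?thesis by simp
qed

lemma span_eigenvec_representation:
  assumes "h \<in> cs.span (range eigenvec)"
  shows "\<exists>K c. finite K \<and> (\<forall>k. k \<notin> K \<longrightarrow> c k = 0) \<and> h = (\<Sum>k\<in>K. e (cst (c k)) * eigenvec k)"
  using assms
proof (rule cs.span_induct_alt)
  show "\<exists>K c. finite K \<and> (\<forall>k. k \<notin> K \<longrightarrow> c k = 0) \<and> 0 = (\<Sum>k\<in>K. e (cst (c k)) * eigenvec k)"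
    by (intro exI[of _ "{}"] exI[of _ "\<lambda>_. 0"]) simp
next
  fix a x y
  assume x: "x \<in> range eigenvec"
    and y: "\<exists>K c. finite K \<and> (\<forall>k. k \<notin> K \<longrightarrow> c k = 0) \<and> y = (\<Sum>k\<in>K. e (cst (c k)) * eigenvec k)"
  from x obtain m where m: "x = eigenvec m" by (rule rangeE)
  from y obtain K c where K: "finite K" "\<And>k. k \<notin> K \<Longrightarrow> c k = 0" "y = (\<Sum>k\<in>K. e (cst (c k)) * eigenvec k)"
    by blast
  have "(\<Sum>k\<in>insert m K. e (cst ((c(m := a + c m)) k)) * eigenvec k)
      = e (cst a) * eigenvec m + (\<Sum>k\<in>K. e (cst (c k)) * eigenvec k)"
    by (rule sum_insert_update[where f = "\<lambda>a. e (cst a)"]) (simp_all add: K cst_add e_add)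
  then show "\<exists>K c. finite K \<and> (\<forall>k. k \<notin> K \<longrightarrow> c k = 0) \<and> e (cst a) * x + y = (\<Sum>k\<in>K. e (cst (c k)) * eigenvec k)"
    using K by (intro exI[of _ "insert m K"] exI[of _ "c(m := a + c m)"]) (simp add: m)
qed

text \<open>
  One-dimensionality of the eigenspaces. Expand the eigenvector in the \<open>eigenvec k\<close> and multiply
  \<open>(Y - ev m) P(X)\<close> by \<open>\<one>\<^sub>0\<close>. Modulo \<open>vanishing\<close> this is a combination of the \<open>\<eta>\<^sup>k \<one>\<^sub>0\<close> with constant coefficients
  proportional to \<open>ev k - ev m\<close>. Constants that vanish at a point are zero, so only \<open>k = m\<close> remains.
\<close>

lemma eigenvector_multiple:
  assumes "(e Yvar - e (cst (ev m))) * laurent_X H P \<in> ann"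
  shows "\<exists>c. laurent_X H P = e (cst c) * eigenvec m"
proof -
  let ?Y = "e Yvar - e (cst (ev m))"
  have "X_span UNIV \<subseteq> cs.span (range eigenvec)"
    unfolding X_span_def using Xp_span_eigenvec by (intro cs.span_minimal cs.subspace_span) auto
  then have "laurent_X H P \<in> cs.span (range eigenvec)" using laurent_X_X_span by blast
  then obtain K c where K: "finite K" "\<And>k. k \<notin> K \<Longrightarrow> c k = 0"
    "laurent_X H P = (\<Sum>k\<in>K. e (cst (c k)) * eigenvec k)"
    using span_eigenvec_representation by blast
  obtain g where g: "\<And>k. g k \<noteq> 0" "\<And>k. eigenvec k * u0 - e (cst (g k)) * (et k * u0) \<in> vanishing"
    using eigenpolyD(3)[OF eigenpoly_eigenvec] by metis
  define d where "d k = c k * (ev k - ev m)" for k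
  have vanishing_sum: "(\<Sum>k\<in>K. f k) \<in> vanishing" if "\<And>k. f k \<in> vanishing" for f
    using \<open>finite K\<close> by (induction rule: finite_induct) (simp_all add: that vanishing_add vanishing.zero)
  have eig: "(e Yvar - e (cst (ev k))) * eigenvec k * u0 \<in> vanishing" for k
    by (rule ann_one0[OF eigenpolyD(2)[OF eigenpoly_eigenvec]])
  have split: "?Y * (e (cst (c k)) * eigenvec k) * u0
      = e (cst (c k)) * ((e Yvar - e (cst (ev k))) * eigenvec k * u0) + e (cst (d k)) * (eigenvec k * u0)" for k
  proof -
    have Y: "?Y = (e Yvar - e (cst (ev k))) + e (cst (ev k - ev m))"
      by (simp only: cst_diff e_diff) simp
    have "?Y * (e (cst (c k)) * eigenvec k) = e (cst (c k)) * (?Y * eigenvec k)"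
      by (rule e_cst_left_commute[symmetric])
    also have "\<dots> = e (cst (c k)) * (((e Yvar - e (cst (ev k))) + e (cst (ev k - ev m))) * eigenvec k)"
      by (simp only: Y)
    finally have "?Y * (e (cst (c k)) * eigenvec k) * u0
        = e (cst (c k)) * (((e Yvar - e (cst (ev k))) + e (cst (ev k - ev m))) * eigenvec k) * u0"
      by (simp only:)
    then show ?thesis
      by (simp only: d_def distrib_left distrib_right mult.assoc cst_mult e_mult)
  qed
  have "?Y * laurent_X H P * u0 = (\<Sum>k\<in>K. ?Y * (e (cst (c k)) * eigenvec k) * u0)"
    unfolding K(3) by (simp only: sum_distrib_left sum_distrib_right)
  also have "\<dots> = (\<Sum>k\<in>K. e (cst (c k)) * ((e Yvar - e (cst (ev k))) * eigenvec k * u0))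
      + (\<Sum>k\<in>K. e (cst (d k)) * (eigenvec k * u0))"
    by (simp only: split sum.distrib)
  finally have "?Y * laurent_X H P * u0 - (\<Sum>k\<in>K. e (cst (c k)) * ((e Yvar - e (cst (ev k))) * eigenvec k * u0))
     = (\<Sum>k\<in>K. e (cst (d k)) * (eigenvec k * u0))" by simp
  moreover have "?Y * laurent_X H P * u0
      - (\<Sum>k\<in>K. e (cst (c k)) * ((e Yvar - e (cst (ev k))) * eigenvec k * u0)) \<in> vanishing"
    by (intro vanishing_diff vanishing_sum vanishing_regular_mult[OF _ regular_cst] eig ann_one0 assms)
  ultimately have 1: "(\<Sum>k\<in>K. e (cst (d k)) * (eigenvec k * u0)) \<in> vanishing" by simp
  have 2: "(\<Sum>k\<in>K. e (cst (d k)) * (eigenvec k * u0 - e (cst (g k)) * (et k * u0))) \<in> vanishing"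
    by (intro vanishing_sum vanishing_regular_mult[OF _ regular_cst] g(2))
  have "(\<Sum>k\<in>K. e (cst (d k * g k)) * (et k * u0))
      = (\<Sum>k\<in>K. e (cst (d k)) * (eigenvec k * u0))
        - (\<Sum>k\<in>K. e (cst (d k)) * (eigenvec k * u0 - e (cst (g k)) * (et k * u0)))"
    by (simp only: sum_subtractf[symmetric] right_diff_distrib cst_mult e_mult mult.assoc) simp
  also have "\<dots> \<in> vanishing" by (rule vanishing_diff[OF 1 2])
  finally have S: "(\<Sum>k\<in>K. e (cst (d k * g k)) * (et k * u0)) \<in> vanishing" .
  have "d k * g k = 0" if "k \<in> K" for k
    by (rule vanishing_constants[OF K(1) S that])
  then have c0: "c k = 0" if "k \<noteq> m" for k
    using that g(1)[of k] K(2)[of k] ev_inj[of k m] unfolding d_def by (cases "k \<in> K") auto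
  have "laurent_X H P = (\<Sum>k\<in>insert m K. e (cst (c k)) * eigenvec k)"
    unfolding K(3) using K(1,2) by (intro sum.mono_neutral_left) auto
  also have "\<dots> = (\<Sum>k\<in>{m}. e (cst (c k)) * eigenvec k)"
    using K(1) c0 by (intro sum.mono_neutral_right) auto
  finally show ?thesis by auto
qed

lemma normalized_eigenvector:
  assumes "(e Yvar - e (cst (ev m))) * laurent_X H P \<in> ann" "Poly_Mapping.lookup P m = 1"
  shows "laurent_X H P = eigenvec m"
proof -
  have lower_exps: "m \<notin> lower_exps m" by (simp add: lower_exps_def)
  obtain c where c: "laurent_X H P = e (cst c) * eigenvec m"
    using eigenvector_multiple[OF assms(1)] by blast
  have "e (cst c) * (eigenvec m - Xp m) \<in> X_span (lower_exps m)"
    by (intro X_span_scale eigenpolyD(1) eigenpoly_eigenvec)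
  then have "Poly_Mapping.lookup P m = c"
    using lookup_leading[OF _ lower_exps, of P c] by (simp only: right_diff_distrib c)
  then show ?thesis using c assms(2) by simp
qed

text \<open>
  The definite description in the definition of \<open>E\<^sub>m\<close> is satisfied by the constructed polynomial and, the
  eigenspace being one-dimensional and the coefficient of \<open>X\<^sup>m\<close> fixed, by no other.
\<close>

lemma E_X_eigenpoly: assumes "eigenpoly m v" shows "E_X qh th H m = v"
proof -
  have lower_exps: "m \<notin> lower_exps m" by (simp add: lower_exps_def)
  have "Xp m + (v - Xp m) \<in> X_span UNIV"
    using eigenpolyD(1)[OF assms] X_span_mono[of "lower_exps m" UNIV] by (intro X_span_add Xp_X_span) auto
  then obtain P where P: "laurent_X H P = v"
    using X_span_laurent[of v UNIV] by auto
  have P1: "Poly_Mapping.lookup P m = 1"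
    using lookup_leading[OF _ lower_exps, of P 1] eigenpolyD(1)[OF assms] by (simp add: P)
  have eq: "poly_rep_eq th H (Y H * laurent_X H Q) (scal H (ev m) * laurent_X H Q)
      \<longleftrightarrow> (e Yvar - e (cst (ev m))) * laurent_X H Q \<in> ann" for Q
    unfolding poly_rep_eq_def by (simp only: left_diff_distrib Y_def scal_def)
  have eig: "(e Yvar - e (cst (ev m))) * laurent_X H P \<in> ann"
    using eigenpolyD(2)[OF assms] by (simp only: P)
  have "electronic qh th H m = P"
    unfolding electronic_def eq
  proof (rule the_equality)
    fix Q assume "(e Yvar - e (cst (ev m))) * laurent_X H Q \<in> ann \<and> Poly_Mapping.lookup Q m = 1"
    then have "laurent_X H Q = laurent_X H P"
      using normalized_eigenvector[of m Q] normalized_eigenvector[OF eig P1] by simp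
    then show "Q = P" by (rule laurent_X_inj)
  qed (use eig P1 in blast)
  then show ?thesis unfolding E_X_def using P by simp
qed

abbreviation E :: "int \<Rightarrow> 'h" where "E \<equiv> E_X qh th H"

lemma E_0: "E 0 = 1"
  using eigenpoly_0 by (rule E_X_eigenpoly)

text \<open>
  The two moves from one eigenvector to the next. They are congruences modulo \<open>T1_ideal\<close> and become equations after
  multiplication by \<open>\<one>\<^sub>0\<close>.
\<close>

lemma E_up: "E (int l + 1) * u0 = e (cst (inverse th)) * (p * (E (- int l) * u0))"
proof -
  obtain v where v: "eigenpoly (- int l) v" using eigenpoly_ex by blast
  obtain w where "eigenpoly (int l + 1) w" "w * u0 = e (cst (inverse th)) * (p * (v * u0))"
    using v by (rule eigenpoly_up)
  then show ?thesis using E_X_eigenpoly v by simp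
qed

lemma E_down: "E (- int n - 1) * u0
    = e (cst th) * (T1 H * (E (int n + 1) * u0) + e (cst (T1_shift (ev (int n + 1)))) * (E (int n + 1) * u0))"
proof -
  obtain v where v: "eigenpoly (int n + 1) v" using eigenpoly_ex by blast
  obtain w where "eigenpoly (- int n - 1) w"
    "w * u0 = e (cst th) * (T1 H * (v * u0) + e (cst (T1_shift (ev (int n + 1)))) * (v * u0))"
    using v by (rule eigenpoly_down)
  then show ?thesis using E_X_eigenpoly v by simp
qed

end

section \<open>Recursion of the expansion coefficients\<close>

lemma qpoch_Suc: "qpoch z q (Suc n) = qpoch z q n * (1 - z * q ^ n)"
  by (simp add: qpoch_def)

text \<open>
  The heart of the recursion for \<open>D_minus\<close>, with \<open>z = Y\<^sup>-\<^sup>2\<close>, \<open>u = q\<^sup>j\<close>, \<open>w = q\<^sup>l\<^sup>-\<^sup>j\<close> and \<open>T = t\<close>: what is left once the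
  common linear factors and constants have been cancelled.
\<close>

lemma D_minus_rec_identity:
  fixes z u w T :: "'a::field"
  assumes "w \<noteq> 0" "T \<noteq> 0" "1 - u * w \<noteq> 0" "1 - T * w \<noteq> 0"
  shows "(1 - z / (T * w)) * (1 - u / w * z)
    = (1 - w) * (1 - T * (u * w)) / ((1 - u * w) * (1 - T * w)) * (1 - u / (T * w) * z) * (1 - z / w)
      + (1 - T) * w * (1 - u) / ((1 - u * w) * (1 - T * w)) * (1 - z / (T * w\<^sup>2)) * (1 - u * z)"
proof -
  have "T * w\<^sup>2 * ((1 - u * w) * (1 - T * w)) * ((1 - z / (T * w)) * (1 - u / w * z))
     = T * w\<^sup>2 * ((1 - w) * (1 - T * (u * w)) * (1 - u / (T * w) * z) * (1 - z / w)
      + (1 - T) * w * (1 - u) * (1 - z / (T * w\<^sup>2)) * (1 - u * z))"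
    using assms(1,2) by (simp add: field_simps power2_eq_square)
  then have "(1 - u * w) * (1 - T * w) * ((1 - z / (T * w)) * (1 - u / w * z))
     = (1 - w) * (1 - T * (u * w)) * (1 - u / (T * w) * z) * (1 - z / w)
      + (1 - T) * w * (1 - u) * (1 - z / (T * w\<^sup>2)) * (1 - u * z)"
    using assms(1,2) by (simp add: mult.assoc)
  then have "(1 - z / (T * w)) * (1 - u / w * z)
     = ((1 - w) * (1 - T * (u * w)) * (1 - u / (T * w) * z) * (1 - z / w)
      + (1 - T) * w * (1 - u) * (1 - z / (T * w\<^sup>2)) * (1 - u * z)) / ((1 - u * w) * (1 - T * w))"
    using assms(3,4) by (simp add: eq_divide_eq mult_ac)
  then show ?thesis by (simp add: add_divide_distrib mult_ac)
qed

text \<open>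
  The corresponding identity for the symmetrized coefficients.
\<close>

lemma K_identity:
  fixes z u w :: "'a::field"
  assumes "u \<noteq> 0" "1 - u * w \<noteq> 0"
  shows "1 - w / u * z
    = (1 - w) / (1 - u * w) * (1 - w * z) + w * ((1 - u) / (1 - u * w)) * (1 - z / u)"
proof -
  have "u * (1 - u * w) * (1 - w / u * z) = u * ((1 - w) * (1 - w * z) + w * (1 - u) * (1 - z / u))"
    using assms(1) by (simp add: field_simps)
  then have "(1 - u * w) * (1 - w / u * z) = (1 - w) * (1 - w * z) + w * (1 - u) * (1 - z / u)"
    using assms(1) by simp
  then have "1 - w / u * z = ((1 - w) * (1 - w * z) + w * (1 - u) * (1 - z / u)) / (1 - u * w)"
    using assms(2) by (simp add: eq_divide_eq mult_ac)
  then show ?thesis by (simp add: add_divide_distrib mult_ac)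
qed

text \<open>
  Puts an identity between products of linear factors over the denominators that occur in the recursion.
\<close>

lemma two_term_fraction:
  fixes k b l1 l3 l5 m1 m2 m3 \<beta> \<gamma> :: "'a::field"
  assumes "m1 \<noteq> 0" "m2 \<noteq> 0" "m3 \<noteq> 0" "l1 * m3 = \<beta> * l3 * m2 + \<gamma> * l5 * m1"
  shows "k * b * l1 / (m1 * m2) = k * (b * \<beta>) * l3 / (m3 * m1) + k * (b * \<gamma>) * l5 / (m3 * m2)"
proof -
  have "k * (b * \<beta>) * l3 / (m3 * m1) + k * (b * \<gamma>) * l5 / (m3 * m2)
      = k * b * (\<beta> * l3 * m2 + \<gamma> * l5 * m1) / (m1 * m2 * m3)"
    using assms(1-3) by (simp add: field_simps)
  also have "\<dots> = k * b * l1 / (m1 * m2)"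
    unfolding assms(4)[symmetric] using assms(3) by simp
  finally show ?thesis ..
qed

context localized_DAHA
begin

text \<open>
  All coefficients are products of linear factors in \<open>Y\<^sup>-\<^sup>2\<close>. Integral exponents keep track of the shifts
  \<open>Y \<mapsto> q\<^sup>k\<^sup>/\<^sup>2 Y\<close>, which just translate \<open>m\<close>.
\<close>

definition lin_factor :: "complex \<Rightarrow> int \<Rightarrow> ratfun" where
  "lin_factor c m = 1 - cst (c * q powi m) * Ym2"

definition factor_prod :: "complex \<Rightarrow> int \<Rightarrow> nat \<Rightarrow> ratfun" where
  "factor_prod c m n = (\<Prod>i<n. lin_factor c (m + int i))"

lemma lin_factor_neq_0 [simp]: "lin_factor c m \<noteq> 0"
  by (simp add: lin_factor_def)

lemma factor_prod_neq_0 [simp]: "factor_prod c m n \<noteq> 0"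
  by (simp add: factor_prod_def)

lemma factor_prod_0 [simp]: "factor_prod c m 0 = 1"
  by (simp add: factor_prod_def)

lemma factor_prod_Suc: "factor_prod c m (Suc n) = factor_prod c m n * lin_factor c (m + int n)"
  by (simp add: factor_prod_def)

lemma factor_prod_Suc_shift: "factor_prod c m (Suc n) = lin_factor c m * factor_prod c (m + 1) n"
  unfolding factor_prod_def by (subst prod.lessThan_Suc_shift) (simp add: add_ac)

lemma q_neq_0: "q \<noteq> 0" and t_neq_0: "t \<noteq> 0"
  by simp_all

lemma qpoch_eq_factor_prod:
  assumes "w = cst (c * q powi m) * Ym2" shows "qpoch w (cst q) n = factor_prod c m n"
  unfolding qpoch_def factor_prod_def lin_factor_def assms
  by (intro prod.cong refl)
     (simp add: power_int_add cst_mult cst_power mult_ac)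

lemma subst_gsh_lin_factor: "subst (gsh k) (lin_factor c m) = lin_factor c (m - k)"
proof -
  have "c * q powi m * q powi (- k) = c * q powi (m - k)"
    by (simp add: power_int_diff power_int_minus divide_inverse)
  then show ?thesis
    unfolding lin_factor_def by (simp add: gsh.subst_simps subst_gsh_Ym2 flip: mult.assoc cst_mult)
qed

lemma subst_gs_lin_factor:
  assumes "c \<noteq> 0"
  shows "subst gs (lin_factor c m) = - cst (c * q powi m) * inverse Ym2 * lin_factor (inverse c) (- m)"
proof -
  have "cst (c * q powi m) * cst (inverse c * q powi (- m)) = 1"
    using assms by (simp only: power_int_minus cst_mult[symmetric]) (simp add: mult_ac)
  then have "- cst (c * q powi m) * inverse Ym2 * lin_factor (inverse c) (- m)
      = 1 - cst (c * q powi m) * inverse Ym2"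
    unfolding lin_factor_def by (simp add: right_diff_distrib) (simp add: algebra_simps)
  then show ?thesis
    unfolding lin_factor_def by (simp add: gs.subst_simps subst_gs_Ym2)
qed

text \<open>
  Inverting \<open>Y\<close> reverses the order of the factors, at the cost of a monomial in \<open>Y\<^sup>2\<close> with a sign and a quadratic power
  of \<open>q\<close>. These cancel in a quotient of two products of equal length, which is why the closed forms below
  are grouped into such quotients.
\<close>

lemma subst_gs_factor_prod_ratio:
  assumes "c \<noteq> 0" "d \<noteq> 0"
  shows "subst gs (factor_prod c m n / factor_prod d k n)
    = cst ((c / d) ^ n * q powi (int n * (m - k))) * (factor_prod (inverse c) (1 - m - int n) n / factor_prod (inverse d) (1 - k - int n) n)"
proof (induction n)
  case (Suc n)
  have ratio: "subst gs (lin_factor c (m + int n) / lin_factor d (k + int n))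
      = cst ((c / d) * q powi (m - k)) * (lin_factor (inverse c) (- m - int n) / lin_factor (inverse d) (- k - int n))"
    using assms
    by (simp add: gs.subst_divide subst_gs_lin_factor cst_mult cst_divide power_int_add power_int_diff mult.assoc)
  have const: "(c / d) ^ n * q powi (int n * (m - k)) * ((c / d) * q powi (m - k))
      = (c / d) ^ Suc n * q powi (int (Suc n) * (m - k))"
    by (simp add: distrib_right power_int_add)
  have "subst gs (factor_prod c m (Suc n) / factor_prod d k (Suc n))
      = subst gs (factor_prod c m n / factor_prod d k n) * subst gs (lin_factor c (m + int n) / lin_factor d (k + int n))"
    by (simp add: factor_prod_Suc flip: gs.subst_mult)
  also have "\<dots> = cst ((c / d) ^ n * q powi (int n * (m - k)) * ((c / d) * q powi (m - k)))
      * ((lin_factor (inverse c) (- m - int n) * factor_prod (inverse c) (1 - m - int n) n)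
         / (lin_factor (inverse d) (- k - int n) * factor_prod (inverse d) (1 - k - int n) n))"
    unfolding Suc ratio cst_mult by (simp add: mult_ac)
  also have "lin_factor (inverse c) (- m - int n) * factor_prod (inverse c) (1 - m - int n) n
      = factor_prod (inverse c) (1 - m - int (Suc n)) (Suc n)"
    by (simp add: factor_prod_Suc_shift algebra_simps)
  also have "lin_factor (inverse d) (- k - int n) * factor_prod (inverse d) (1 - k - int n) n
      = factor_prod (inverse d) (1 - k - int (Suc n)) (Suc n)"
    by (simp add: factor_prod_Suc_shift algebra_simps)
  finally show ?case unfolding const .
qed simp

text \<open>
  The parts of the three product formulas that do not involve \<open>Y\<close>.
\<close>

definition D_plus_const :: "nat \<Rightarrow> nat \<Rightarrow> complex" where
  "D_plus_const l j = th powi (- (int l + 1)) * t ^ (l - j) * qt_binom q t l j * ((1 - t * q ^ (l - j)) / (1 - t * q ^ l))"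

definition D_minus_const :: "nat \<Rightarrow> nat \<Rightarrow> complex" where
  "D_minus_const l j = th powi (- int l) * (q * t) ^ j * qt_binom q t l j * ((1 - t * q ^ (l - j)) / (1 - t * q ^ l))"

definition K_const :: "nat \<Rightarrow> nat \<Rightarrow> complex" where
  "K_const l j = th powi (- (int l - 1)) * t powi (int l - 1 - int j) * qt_binom q t l j"

lemma Y_binom_eq:
  assumes "j \<le> l"
  shows "Y_binom q t l j = factor_prod (inverse t) (1 - int j) (l - j) * factor_prod t (int l - 2 * int j) j
     / (factor_prod 1 1 (l - j) * factor_prod 1 (- int j) j)"
proof -
  have 1: "qpoch (cst (inverse t) * Ym2 * cst (q powi (- (int j - 1)))) (cst q) (l - j) = factor_prod (inverse t) (1 - int j) (l - j)"
    by (rule qpoch_eq_factor_prod) (simp only: cst_mult mult_ac minus_diff_eq)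
  have 2: "qpoch (cst t * Ym2 * cst (q powi (int l - 2 * int j))) (cst q) j = factor_prod t (int l - 2 * int j) j"
    by (rule qpoch_eq_factor_prod) (simp only: cst_mult mult_ac)
  have 3: "qpoch (Ym2 * cst q) (cst q) (l - j) = factor_prod 1 1 (l - j)"
    by (rule qpoch_eq_factor_prod) (simp only: power_int_1_right mult_1_left mult.commute)
  have 4: "qpoch (Ym2 * cst (q powi (- int j))) (cst q) j = factor_prod 1 (- int j) j"
    by (rule qpoch_eq_factor_prod) (simp only: mult_1_left mult.commute)
  show ?thesis unfolding Y_binom_def 1 2 3 4 ..
qed

text \<open>
  The last factor in the definition of \<open>D_plus\<close> moves the second product one step along.
\<close>

lemma D_plus_eq:
  assumes "j \<le> l"
  shows "D_plus qh th l j = cst (D_plus_const l j)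
    * (factor_prod (inverse t) (1 - int j) (l - j) * factor_prod t (int l - 2 * int j + 1) j
      / (factor_prod 1 1 (l - j) * factor_prod 1 (- int j) j))"
proof -
  have lin1: "1 - cst t * Ym2 * cst (q ^ (l - j)) = lin_factor t (int l - 2 * int j + int j)"
    using assms by (simp add: lin_factor_def cst_mult mult_ac power_int_def nat_diff_distrib)
  have lin2: "1 - cst t * Ym2 * cst (q powi (int l - 2 * int j)) = lin_factor t (int l - 2 * int j)"
    by (simp add: lin_factor_def cst_mult mult_ac)
  have shift: "factor_prod t (int l - 2 * int j) j * (lin_factor t (int l - 2 * int j + int j) / lin_factor t (int l - 2 * int j))
      = factor_prod t (int l - 2 * int j + 1) j"
    using factor_prod_Suc[of t "int l - 2 * int j" j] factor_prod_Suc_shift[of t "int l - 2 * int j" j]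
    by (simp add: field_simps)
  show ?thesis
    unfolding D_plus_def Let_def lin1 lin2 Y_binom_eq[OF assms] shift[symmetric] D_plus_const_def cst_mult cst_divide
    by (simp add: mult_ac)
qed

lemma D_minus_eq:
  assumes "j \<le> l"
  shows "D_minus qh th l j = cst (D_minus_const l j)
    * ((factor_prod (inverse t) (int j - int l) j / factor_prod 1 1 j)
      * (factor_prod t (2 * int j - int l) (l - j) / factor_prod 1 (int j - int l) (l - j)))"
proof -
  have lin1: "1 - cst (inverse t) * Ym2 * cst (q powi (- (int l - int j))) = lin_factor (inverse t) (int j - int l)"
    by (simp add: lin_factor_def cst_mult mult_ac)
  have lin2: "1 - cst (inverse t) * Ym2 * cst (q powi (- (int l - 2 * int j))) = lin_factor (inverse t) (int j - int l + int j)"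
    by (simp add: lin_factor_def cst_mult mult_ac)
  have shift: "factor_prod (inverse t) (int j - int l + 1) j * (lin_factor (inverse t) (int j - int l) / lin_factor (inverse t) (int j - int l + int j))
      = factor_prod (inverse t) (int j - int l) j"
    using factor_prod_Suc[of "inverse t" "int j - int l" j] factor_prod_Suc_shift[of "inverse t" "int j - int l" j]
    by (simp add: field_simps)
  have Yb: "Y_binom q t l (l - j) = factor_prod (inverse t) (int j - int l + 1) j * factor_prod t (2 * int j - int l) (l - j)
     / (factor_prod 1 1 j * factor_prod 1 (int j - int l) (l - j))"
    using assms by (subst Y_binom_eq) (simp_all add: of_nat_diff algebra_simps)
  show ?thesis
    unfolding D_minus_def Let_def lin1 lin2 Yb shift[symmetric] D_minus_const_def cst_mult cst_divide
    by (simp add: mult_ac)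
qed

text \<open>
  The coefficient form of the first move. The powers of \<open>q\<close> produced by the two quotients add up to \<open>q\<^sup>-\<^sup>j\<close>,
  which cancels the power \<open>q\<^sup>j\<close> in the constant of \<open>D_minus\<close>.
\<close>

lemma D_plus_D_minus:
  assumes "j \<le> l"
  shows "subst gs (D_minus qh th l j) = cst th * D_plus qh th l j"
proof -
  have e: "int j * (int j - int l - 1) + int (l - j) * (2 * int j - int l - (int j - int l)) = - int j"
    using assms by (simp add: of_nat_diff algebra_simps)
  have "inverse t ^ j * q powi (int j * (int j - int l - 1)) * (t ^ (l - j) * q powi (int (l - j) * (2 * int j - int l - (int j - int l))))
     = inverse t ^ j * t ^ (l - j) * q powi (- int j)"
    unfolding e[symmetric] by (simp add: power_int_add)
  moreover have "D_minus_const l j * (inverse t ^ j * t ^ (l - j) * q powi (- int j)) = th * D_plus_const l j"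
  proof -
    have 1: "(q * t) ^ j * (inverse t ^ j * t ^ (l - j) * q powi (- int j)) = t ^ (l - j)"
      by (simp add: power_int_minus power_mult_distrib power_inverse field_simps)
    have 2: "th powi (- int l) = th * th powi (- (int l + 1))"
      by (simp add: power_int_minus power_int_diff field_simps)
    have "D_minus_const l j * (inverse t ^ j * t ^ (l - j) * q powi (- int j))
      = th powi (- int l) * ((q * t) ^ j * (inverse t ^ j * t ^ (l - j) * q powi (- int j)))
        * qt_binom q t l j * ((1 - t * q ^ (l - j)) / (1 - t * q ^ l))"
      unfolding D_minus_const_def by (simp only: mult_ac)
    also have "\<dots> = th * D_plus_const l j"
      unfolding 1 2 D_plus_const_def by (simp only: mult_ac)
    finally show ?thesis .
  qed
  ultimately have const: "D_minus_const l j * (inverse t ^ j * q powi (int j * (int j - int l - 1))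
      * (t ^ (l - j) * q powi (int (l - j) * (2 * int j - int l - (int j - int l))))) = th * D_plus_const l j"
    by (simp only:)
  have r1: "subst gs (factor_prod (inverse t) (int j - int l) j / factor_prod 1 1 j)
     = cst (inverse t ^ j * q powi (int j * (int j - int l - 1))) * (factor_prod t (int l - 2 * int j + 1) j / factor_prod 1 (- int j) j)"
    by (subst subst_gs_factor_prod_ratio) (simp_all add: algebra_simps)
  have "1 - (2 * int j - int l) - int (l - j) = 1 - int j" "1 - (int j - int l) - int (l - j) = 1"
    using assms by (simp_all add: of_nat_diff)
  then have r2: "subst gs (factor_prod t (2 * int j - int l) (l - j) / factor_prod 1 (int j - int l) (l - j))
     = cst (t ^ (l - j) * q powi (int (l - j) * (2 * int j - int l - (int j - int l))))
       * (factor_prod (inverse t) (1 - int j) (l - j) / factor_prod 1 1 (l - j))"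
    by (subst subst_gs_factor_prod_ratio) simp_all
  show ?thesis
    unfolding D_minus_eq[OF assms] D_plus_eq[OF assms] gs.subst_mult r1 r2 gs.subst_cst
    by (simp add: mult_ac flip: cst_mult const)
qed

text \<open>
  Read off from \<open>s\<^sup>2 = 1\<close> and the faithfulness of \<open>\<complex>(Y)\<close> on \<open>\<one>\<^sub>0\<close>.
\<close>

lemma gs_gs: "subst gs (subst gs f) = f"
proof -
  have "e (subst gs (subst gs f)) = e (subst gs (subst gs f)) * (s * s)" by (simp add: s_s)
  also have "\<dots> = s * (s * e f)" by (simp only: s_commute mult_assoc_cong[OF s_commute] mult.assoc)
  also have "\<dots> = e f" by (simp add: s_s flip: mult.assoc)
  finally have "e (subst gs (subst gs f) - f) * et 0 * u0 = 0" by (simp add: e_diff)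
  then show ?thesis
    using left_et_one0_independent[of "{0}" id "\<lambda>_. subst gs (subst gs f) - f" 0] by simp
qed

lemma D_minus_D_plus:
  assumes "j \<le> l"
  shows "subst gs (D_plus qh th l j) = cst (inverse th) * D_minus qh th l j"
proof -
  have "D_plus qh th l j = cst (inverse th) * subst gs (D_minus qh th l j)"
    unfolding D_plus_D_minus[OF assms] by (simp flip: mult.assoc cst_mult)
  then show ?thesis by (simp add: gs.subst_mult gs_gs)
qed

lemma one_minus_q_power_neq_0: "k > 0 \<Longrightarrow> 1 - q ^ k \<noteq> 0"
  using q_t_indep[of "int k" 0] by auto

lemma one_minus_t_q_power_neq_0: "1 - t * q ^ k \<noteq> 0"
  using q_t_indep[of "int k" 1] by (auto simp: mult.commute)

text \<open>
  The \<open>(q,t)\<close>-binomial coefficient is formed from these numbers like the ordinary one from factorials.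
\<close>

definition qpoch_ratio :: "nat \<Rightarrow> complex" where "qpoch_ratio n = qpoch q q n / qpoch t q n"

lemma qpoch_ratio_Suc: "qpoch_ratio (Suc n) = qpoch_ratio n * ((1 - q ^ Suc n) / (1 - t * q ^ n))"
  by (simp add: qpoch_ratio_def qpoch_Suc)

lemma qpoch_ratio_neq_0: "qpoch_ratio n \<noteq> 0"
proof (induction n)
  case (Suc n)
  then show ?case
    using one_minus_q_power_neq_0[of "Suc n"] one_minus_t_q_power_neq_0[of n]
    by (simp only: qpoch_ratio_Suc divide_eq_0_iff mult_eq_0_iff) simp
qed (simp add: qpoch_ratio_def qpoch_def)

lemma qt_binom_eq: "qt_binom q t l j = qpoch_ratio l / (qpoch_ratio j * qpoch_ratio (l - j))"
  by (simp add: qt_binom_def qpoch_ratio_def)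

lemma qt_binom_Suc_left:
  assumes "j \<le> n"
  shows "qt_binom q t (Suc n) j * ((1 - q ^ Suc (n - j)) / (1 - q ^ Suc n))
    = qt_binom q t n j * ((1 - t * q ^ (n - j)) / (1 - t * q ^ n))"
proof -
  have d: "Suc n - j = Suc (n - j)" using assms by simp
  define a b c f where "a = 1 - q ^ Suc (n - j)" "b = 1 - q ^ Suc n" "c = 1 - t * q ^ (n - j)" "f = 1 - t * q ^ n"
  have "a \<noteq> 0" "b \<noteq> 0" "c \<noteq> 0" "f \<noteq> 0"
    unfolding a_b_c_f_def using one_minus_q_power_neq_0 one_minus_t_q_power_neq_0 by blast+
  then show ?thesis
    unfolding qt_binom_eq d qpoch_ratio_Suc a_b_c_f_def[symmetric] using qpoch_ratio_neq_0 by (simp add: field_simps)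
qed

lemma qt_binom_Suc_right:
  assumes "i \<le> n"
  shows "qt_binom q t (Suc n) (Suc i) * ((1 - q ^ Suc i) / (1 - q ^ Suc n))
    = qt_binom q t n (n - i) * ((1 - t * q ^ i) / (1 - t * q ^ n))"
proof -
  have d: "Suc n - Suc i = n - i" "n - (n - i) = i" using assms by simp_all
  define a b c f where "a = 1 - q ^ Suc i" "b = 1 - q ^ Suc n" "c = 1 - t * q ^ i" "f = 1 - t * q ^ n"
  have "a \<noteq> 0" "b \<noteq> 0" "c \<noteq> 0" "f \<noteq> 0"
    unfolding a_b_c_f_def using one_minus_q_power_neq_0 one_minus_t_q_power_neq_0 by blast+
  then show ?thesis
    unfolding qt_binom_eq d qpoch_ratio_Suc a_b_c_f_def[symmetric] using qpoch_ratio_neq_0 by (simp add: field_simps)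
qed

lemma D_minus_const_step:
  assumes "j \<le> n"
  shows "inverse th * D_minus_const n j = D_minus_const (Suc n) j * ((1 - q ^ (Suc n - j)) * (1 - t * q ^ Suc n)
     / ((1 - q ^ Suc n) * (1 - t * q ^ (Suc n - j))))"
proof -
  have d: "Suc n - j = Suc (n - j)" using assms by simp
  have th: "th powi (- int (Suc n)) = inverse th * th powi (- int n)"
    by (simp add: power_int_minus power_int_diff field_simps)
  have ne: "1 - t * q ^ Suc n \<noteq> 0" "1 - t * q ^ Suc (n - j) \<noteq> 0"
    by (rule one_minus_t_q_power_neq_0)+
  have "D_minus_const (Suc n) j * ((1 - q ^ (Suc n - j)) * (1 - t * q ^ Suc n)
     / ((1 - q ^ Suc n) * (1 - t * q ^ (Suc n - j))))
    = inverse th * th powi (- int n) * (q * t) ^ j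
      * (qt_binom q t (Suc n) j * ((1 - q ^ Suc (n - j)) / (1 - q ^ Suc n)))
      * (((1 - t * q ^ Suc (n - j)) / (1 - t * q ^ Suc n)) * ((1 - t * q ^ Suc n) / (1 - t * q ^ Suc (n - j))))"
    unfolding D_minus_const_def th d by (simp only: times_divide_eq_left times_divide_eq_right divide_divide_eq_left mult_ac)
  also have "\<dots> = inverse th * th powi (- int n) * (q * t) ^ j
      * (qt_binom q t n j * ((1 - t * q ^ (n - j)) / (1 - t * q ^ n)))"
    unfolding qt_binom_Suc_left[OF assms] using ne by simp
  also have "\<dots> = inverse th * D_minus_const n j"
    unfolding D_minus_const_def by (simp only: mult_ac)
  finally show ?thesis ..
qed

lemma D_plus_const_step:
  assumes "i \<le> n"
  shows "t * q ^ Suc n * D_plus_const n (n - i) = D_minus_const (Suc n) (Suc i) * (q ^ (n - i) * (1 - q ^ Suc i) * (1 - t * q ^ Suc n)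
     / ((1 - q ^ Suc n) * (1 - t * q ^ (n - i))))"
proof -
  have d: "Suc n - Suc i = n - i" "n - (n - i) = i" using assms by simp_all
  have th: "th powi (- int (Suc n)) = th powi (- (int n + 1))" by (simp add: add.commute)
  have ne: "1 - t * q ^ Suc n \<noteq> 0" "1 - t * q ^ (n - i) \<noteq> 0"
    by (rule one_minus_t_q_power_neq_0)+
  have qt: "(q * t) ^ Suc i * q ^ (n - i) = t * q ^ Suc n * t ^ i"
    using assms by (simp add: power_mult_distrib mult_ac flip: power_add)
  have "D_minus_const (Suc n) (Suc i) * (q ^ (n - i) * (1 - q ^ Suc i) * (1 - t * q ^ Suc n)
     / ((1 - q ^ Suc n) * (1 - t * q ^ (n - i))))
    = th powi (- (int n + 1)) * ((q * t) ^ Suc i * q ^ (n - i))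
      * (qt_binom q t (Suc n) (Suc i) * ((1 - q ^ Suc i) / (1 - q ^ Suc n)))
      * (((1 - t * q ^ (n - i)) / (1 - t * q ^ Suc n)) * ((1 - t * q ^ Suc n) / (1 - t * q ^ (n - i))))"
    unfolding D_minus_const_def th d by (simp only: times_divide_eq_left times_divide_eq_right divide_divide_eq_left mult_ac)
  also have "\<dots> = th powi (- (int n + 1)) * (t * q ^ Suc n * t ^ i)
      * (qt_binom q t n (n - i) * ((1 - t * q ^ i) / (1 - t * q ^ n)))"
    unfolding qt_binom_Suc_right[OF assms] qt using ne by simp
  also have "\<dots> = t * q ^ Suc n * D_plus_const n (n - i)"
    unfolding D_plus_const_def d by (simp only: mult_ac)
  finally show ?thesis ..
qed

lemma K_const_step_left:
  assumes "j \<le> n"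
  shows "th * D_plus_const n j = K_const (Suc n) j * ((1 - q ^ Suc (n - j)) / (1 - q ^ Suc n))"
proof -
  have th: "th * th powi (- (int n + 1)) = th powi (- (int (Suc n) - 1))"
    by (simp add: power_int_minus power_int_diff field_simps)
  have t: "t ^ (n - j) = t powi (int (Suc n) - 1 - int j)"
    using assms by (simp add: power_int_def nat_diff_distrib)
  have "th * D_plus_const n j = th * th powi (- (int n + 1)) * t ^ (n - j) * (qt_binom q t n j * ((1 - t * q ^ (n - j)) / (1 - t * q ^ n)))"
    unfolding D_plus_const_def by (simp only: mult_ac)
  then show ?thesis
    unfolding qt_binom_Suc_left[OF assms, symmetric] th t K_const_def by (simp only: mult_ac)
qed

lemma K_const_step_right:
  assumes "i \<le> n"
  shows "inverse t * D_minus_const n (n - i) = K_const (Suc n) (Suc i) * (q ^ (n - i) * ((1 - q ^ Suc i) / (1 - q ^ Suc n)))"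
proof -
  have d: "n - (n - i) = i" using assms by simp
  have th: "th powi (- int n) = th powi (- (int (Suc n) - 1))" by simp
  have t: "inverse t * (q * t) ^ (n - i) = t powi (int (Suc n) - 1 - int (Suc i)) * q ^ (n - i)"
  proof -
    have "t powi (int (Suc n) - 1 - int (Suc i)) = t powi (int (n - i)) * inverse t"
    proof -
      have "int (Suc n) - 1 - int (Suc i) = int (n - i) - 1" using assms by simp
      then show ?thesis by (simp only: power_int_diff t_neq_0 simp_thms power_int_1_right divide_inverse)
    qed
    then show ?thesis by (simp add: power_mult_distrib)
  qed
  have "inverse t * D_minus_const n (n - i) = th powi (- int n) * (inverse t * (q * t) ^ (n - i))
      * (qt_binom q t n (n - i) * ((1 - t * q ^ i) / (1 - t * q ^ n)))"
    unfolding D_minus_const_def d by (simp only: mult_ac)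
  then show ?thesis
    unfolding qt_binom_Suc_right[OF assms, symmetric] th t K_const_def by (simp only: mult_ac)
qed

lemma phi_eq_lin_factor: "phi = lin_factor t 0 / (cst th * lin_factor 1 0)"
  and phi'_eq_lin_factor: "phi' = cst th * (lin_factor (inverse t) 0 / lin_factor 1 0)"
proof -
  have t: "cst t * cst (inverse t) = 1" by (simp flip: cst_mult)
  then have "cst t - Ym2 = cst t * (1 - cst (inverse t) * Ym2)"
    by (simp add: right_diff_distrib flip: mult.assoc)
  moreover have "cst t = cst th * cst th" by (simp add: power2_eq_square cst_mult)
  ultimately show "phi' = cst th * (lin_factor (inverse t) 0 / lin_factor 1 0)"
    unfolding phi'_def lin_factor_def by simp
qed (simp add: phi_def lin_factor_def)

text \<open>
  The coefficient of \<open>1\<close> in \<open>T\<^sub>1 + T1_shift (ev l)\<close>.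
\<close>

definition psi :: "nat \<Rightarrow> ratfun" where
  "psi l = phi' - cst (inverse th) + cst (T1_shift (ev (int l)))"

lemma psi_eq_lin_factor:
  "psi (Suc n) = cst (inverse th * (1 - t) * (t * q ^ Suc n) / (1 - t * q ^ Suc n))
    * (lin_factor (inverse t) (- int (Suc n)) / lin_factor 1 0)"
proof -
  define Q where "Q = t * q ^ Suc n"
  have Q: "1 - Q \<noteq> 0" "Q \<noteq> 0" unfolding Q_def using one_minus_t_q_power_neq_0[of "Suc n"] by simp_all
  have "inverse ((ev (int (Suc n)))\<^sup>2) = Q"
    unfolding ev_sq Q_def by (simp add: power_int_diff field_simps)
  then have T1_shift: "T1_shift (ev (int (Suc n))) = inverse th * (1 - t) / (1 - Q)"
    unfolding T1_shift_def by simp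
  have "inverse t * q powi (- int (Suc n)) = inverse Q"
    unfolding Q_def by (simp only: power_int_minus power_int_of_nat inverse_mult_distrib)
  then have lin_factor: "lin_factor (inverse t) (- int (Suc n)) = 1 - cst (inverse Q) * Ym2"
    unfolding lin_factor_def by simp
  have nz: "cst 1 - cst Q \<noteq> 0" using Q unfolding cst_diff[symmetric] by simp
  then have "psi (Suc n) = cst (inverse th * (1 - t)) * (cst Q - Ym2) / ((1 - cst Q) * (1 - Ym2))"
    unfolding psi_def T1_shift phi'_def cst_simps
    by (simp add: divide_simps) (simp add: algebra_simps)
  also have "cst Q - Ym2 = cst Q * (1 - cst (inverse Q) * Ym2)"
    using Q by (simp add: right_diff_distrib cst_inverse)
  finally show ?thesis
    unfolding lin_factor Q_def[symmetric] cst_mult cst_divide cst_diff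
    by (simp add: lin_factor_def)
qed

lemma subst_gsh_phi: "subst (gsh k) phi = lin_factor t (- k) / (cst th * lin_factor 1 (- k))"
  unfolding phi_eq_lin_factor by (simp add: gsh.subst_simps subst_gsh_lin_factor)

lemma subst_gsh_psi:
  "subst (gsh k) (psi (Suc n)) = cst (inverse th * (1 - t) * (t * q ^ Suc n) / (1 - t * q ^ Suc n))
    * (lin_factor (inverse t) (- int (Suc n) - k) / lin_factor 1 (- k))"
  unfolding psi_eq_lin_factor by (simp add: gsh.subst_mult gsh.subst_divide subst_gsh_lin_factor)

lemma lin_factor_eq: "c * q powi m = x \<Longrightarrow> lin_factor c m = 1 - cst x * Ym2"
  by (simp add: lin_factor_def)

text \<open>
  The generic case of the recursion, with \<open>l = n + 1\<close>, \<open>j = i + 1\<close> and \<open>l - j = m + 1\<close>, so that every product has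
  a factor to split off.
\<close>

lemma D_minus_rec_middle:
  fixes i m :: nat
  defines "n \<equiv> Suc (i + m)" and "j \<equiv> Suc i" and "k \<equiv> int m - int i"
  shows "D_minus qh th (Suc n) j
    = subst (gsh k) phi * D_minus qh th n j
      + cst th * (subst (gsh k) (psi (Suc n)) * D_plus qh th n (Suc m))"
proof -
  define u w where "u = q ^ j" and "w = q ^ Suc m"
  define \<beta> where "\<beta> = (1 - w) * (1 - t * (u * w)) / ((1 - u * w) * (1 - t * w))"
  define \<gamma> where "\<gamma> = (1 - t) * w * (1 - u) / ((1 - u * w) * (1 - t * w))"
  \<comment> \<open>The products \<open>P, R, Q, S\<close> occur in all three terms; the linear factors named below do not.\<close>
  define P R Q S B where "P = factor_prod (inverse t) (- int m) i" and "R = factor_prod t (1 - k) m"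
    and "Q = factor_prod 1 1 i" and "S = factor_prod 1 (- int m) m" and "B = cst (D_minus_const (Suc n) j)"
  define L1 L3 L5 M1 M2 M3 Lt where "L1 = lin_factor (inverse t) (- int m - 1)"
    and "L3 = lin_factor (inverse t) (- k)" and "L5 = lin_factor (inverse t) (- int (Suc n) - k)"
    and "M1 = lin_factor 1 (1 + int i)" and "M2 = lin_factor 1 (- int m - 1)" and "M3 = lin_factor 1 (- k)"
    and "Lt = lin_factor t (- k)"
  note atoms = P_def Q_def R_def S_def L1_def L3_def L5_def M1_def M2_def M3_def Lt_def
  have neq: "Q \<noteq> 0" "S \<noteq> 0" "M1 \<noteq> 0" "M2 \<noteq> 0" "M3 \<noteq> 0"
    unfolding atoms by simp_all
  have uw: "q ^ Suc n = u * w"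
    unfolding u_def w_def n_def j_def by (simp only: power_add[symmetric] add_Suc add_Suc_right)
  have w0: "w \<noteq> 0" "u \<noteq> 0" by (simp_all add: w_def u_def)
  have nz: "1 - u * w \<noteq> 0" "1 - t * w \<noteq> 0" "1 - t * (u * w) \<noteq> 0"
    unfolding uw[symmetric] using one_minus_q_power_neq_0[of "Suc n"]
      one_minus_t_q_power_neq_0[of "Suc n"] one_minus_t_q_power_neq_0[of "Suc m"]
    unfolding w_def by blast+
  have u: "u = q powi (1 + int i)" and w: "w = q powi (1 + int m)"
    unfolding u_def w_def j_def by (simp_all add: power_int_add)
  have e: "inverse t * q powi (- int m - 1) = 1 / (t * w)" "1 * q powi (- k) = u / w"
    "inverse t * q powi (- k) = u / (t * w)" "1 * q powi (- int m - 1) = 1 / w"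
    "inverse t * q powi (- int (Suc n) - k) = 1 / (t * w\<^sup>2)" "1 * q powi (1 + int i) = u"
  proof -
    have exps: "- int m - 1 = - (1 + int m)" "- k = 1 + int i + - (1 + int m)"
      "- int (Suc n) - k = - (1 + int m) + - (1 + int m)"
      unfolding k_def n_def by simp_all
    have p: "q powi (- int m - 1) = inverse w" "q powi (- k) = u * inverse w"
      "q powi (- int (Suc n) - k) = inverse w * inverse w"
      unfolding exps by (simp_all only: power_int_add[OF disjI1[OF q_neq_0]] power_int_minus u w)
    show "inverse t * q powi (- int m - 1) = 1 / (t * w)" "1 * q powi (- k) = u / w"
      "inverse t * q powi (- k) = u / (t * w)" "1 * q powi (- int m - 1) = 1 / w"
      "inverse t * q powi (- int (Suc n) - k) = 1 / (t * w\<^sup>2)"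
      unfolding p using w0(1) t_neq_0 by (simp_all add: field_simps power2_eq_square)
  qed (simp add: u)
  have nz': "1 - cst u * cst w \<noteq> 0" "1 - cst t * cst w \<noteq> 0"
    using nz(1,2) by (metis cst_1 cst_diff cst_eq_0_iff cst_mult)+
  have id: "L1 * M3 = cst \<beta> * L3 * M2 + cst \<gamma> * L5 * M1"
    unfolding L1_def M3_def L3_def M2_def L5_def M1_def e[THEN lin_factor_eq] \<beta>_def \<gamma>_def
    using D_minus_rec_identity[of "cst w" "cst t" "cst u" Ym2, OF _ _ nz'(1,2)] w0 t_neq_0
    by (simp add: cst_divide cst_mult cst_diff cst_power)
  have lhs: "D_minus qh th (Suc n) j = (P * Lt * R / (Q * S)) * B * L1 / (M1 * M2)"
  proof -
    have i1: "int j - int (Suc n) = - int m - 1" "2 * int j - int (Suc n) = - k" "Suc n - j = Suc m" "j \<le> Suc n"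
      unfolding j_def n_def k_def by simp_all
    have "- int m - 1 + 1 = - int m" "- k + 1 = 1 - k" by simp_all
    then show ?thesis
      unfolding D_minus_eq[OF i1(4)] i1(1-3) B_def[symmetric]
      unfolding j_def factor_prod_Suc[of 1 1 i] factor_prod_Suc_shift[of _ "- int m - 1"] factor_prod_Suc_shift[of _ "- k"]
      by (simp add: atoms mult_ac)
  qed
  have t1: "subst (gsh k) phi * D_minus qh th n j = (P * Lt * R / (Q * S)) * (B * cst \<beta>) * L3 / (M3 * M1)"
  proof -
    have i1: "int j - int n = - int m" "2 * int j - int n = 1 - k" "n - j = m" "j \<le> n"
      unfolding j_def n_def k_def by simp_all
    have i2: "- int m + int i = - k" unfolding k_def by simp
    have "Suc n - j = Suc m" unfolding j_def n_def by simp
    then have "inverse th * D_minus_const n j = D_minus_const (Suc n) j * \<beta>"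
      unfolding D_minus_const_step[OF i1(4)] \<beta>_def uw[symmetric] by (simp only: w_def)
    then have "cst (inverse th) * cst (D_minus_const n j) = B * cst \<beta>"
      by (simp only: B_def flip: cst_mult)
    moreover have "subst (gsh k) phi * D_minus qh th n j
       = (cst (inverse th) * cst (D_minus_const n j)) * ((P * Lt * R / (Q * S)) * L3 / (M3 * M1))"
      unfolding D_minus_eq[OF i1(4)] i1(1-3) subst_gsh_phi cst_inverse
      unfolding j_def factor_prod_Suc i2
      by (simp add: atoms field_simps)
    ultimately show ?thesis by (simp add: mult_ac)
  qed
  have t2: "cst th * (subst (gsh k) (psi (Suc n)) * D_plus qh th n (Suc m))
      = (P * Lt * R / (Q * S)) * (B * cst \<gamma>) * L5 / (M3 * M2)"
  proof -
    have i1: "1 - int (Suc m) = - int m" "int n - 2 * int (Suc m) + 1 = - k" "n - Suc m = i" "Suc m \<le> n"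
      "- int (Suc m) = - int m - 1"
      unfolding n_def k_def by simp_all
    have i2: "n - i = Suc m" "i \<le> n" unfolding n_def by simp_all
    have i3: "- int m - 1 + 1 = - int m" "- k + 1 = 1 - k" by simp_all
    have c: "t * (u * w) * D_plus_const n (Suc m) = D_minus_const (Suc n) j * (w * (1 - u) * (1 - t * (u * w)) / ((1 - u * w) * (1 - t * w)))"
      using D_plus_const_step[OF i2(2)] unfolding i2(1) uw j_def[symmetric] w_def[symmetric] u_def[symmetric] .
    have "th * (inverse th * (1 - t) * (t * (u * w)) / (1 - t * (u * w))) * D_plus_const n (Suc m)
        = (1 - t) / (1 - t * (u * w)) * (t * (u * w) * D_plus_const n (Suc m))"
      by simp
    also have "\<dots> = D_minus_const (Suc n) j * \<gamma>"
      unfolding c \<gamma>_def using nz(3) by (simp add: mult_ac)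
    finally have const: "cst th * cst (inverse th * (1 - t) * (t * (u * w)) / (1 - t * (u * w))) * cst (D_plus_const n (Suc m))
        = B * cst \<gamma>"
      by (simp only: B_def flip: cst_mult)
    have "cst th * (subst (gsh k) (psi (Suc n)) * D_plus qh th n (Suc m))
      = (cst th * cst (inverse th * (1 - t) * (t * (u * w)) / (1 - t * (u * w))) * cst (D_plus_const n (Suc m)))
        * ((P * Lt * R / (Q * S)) * L5 / (M3 * M2))"
      unfolding D_plus_eq[OF i1(4)] i1(1-3) i1(5) subst_gsh_psi uw
        factor_prod_Suc_shift[of _ "- int m - 1"] factor_prod_Suc_shift[of _ "- k"] i3
      by (simp add: atoms mult_ac)
    then show ?thesis unfolding const by (simp add: mult_ac)
  qed
  show ?thesis
    unfolding lhs t1 t2 by (rule two_term_fraction[OF neq(3,4,5) id])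
qed

lemma D_minus_rec_first:
  "D_minus qh th (Suc n) 0 = subst (gsh (int (Suc n))) phi * D_minus qh th n 0"
proof -
  have c: "inverse th * D_minus_const n 0 = D_minus_const (Suc n) 0"
    using D_minus_const_step[of 0 n] one_minus_q_power_neq_0[of "Suc n"] one_minus_t_q_power_neq_0[of "Suc n"] by simp
  have shift: "factor_prod d (- int (Suc n)) (Suc n) = lin_factor d (- int (Suc n)) * factor_prod d (- int n) n" for d
    by (subst factor_prod_Suc_shift) simp
  have i: "int 0 - int (Suc n) = - int (Suc n)" "2 * int 0 - int (Suc n) = - int (Suc n)"
    "int 0 - int n = - int n" "2 * int 0 - int n = - int n" "Suc n - 0 = Suc n" "n - 0 = n"
    by simp_all
  show ?thesis
    unfolding D_minus_eq[OF le0] subst_gsh_phi c[symmetric] cst_mult cst_inverse i shift factor_prod_0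
    by (simp only: times_divide_eq_left times_divide_eq_right divide_inverse inverse_mult_distrib mult_ac)
qed

lemma D_minus_rec_last:
  "D_minus qh th (Suc n) (Suc n)
    = cst th * (subst (gsh (- int (Suc n))) (psi (Suc n)) * D_plus qh th n 0)"
proof -
  have nz: "1 - q ^ Suc n \<noteq> 0" "1 - t * q ^ Suc n \<noteq> 0" "1 - t \<noteq> 0"
    using one_minus_q_power_neq_0[of "Suc n"] one_minus_t_q_power_neq_0[of "Suc n"]
      one_minus_t_q_power_neq_0[of 0] by simp_all
  have "D_minus_const (Suc n) (Suc n) = (1 - t) / (1 - t * q ^ Suc n) * (t * q ^ Suc n * D_plus_const n 0)"
    using D_plus_const_step[of n n] nz by simp
  also have "\<dots> = th * (inverse th * (1 - t) * (t * q ^ Suc n) / (1 - t * q ^ Suc n)) * D_plus_const n 0"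
    by simp
  finally have c: "D_minus_const (Suc n) (Suc n)
    = th * (inverse th * (1 - t) * (t * q ^ Suc n) / (1 - t * q ^ Suc n)) * D_plus_const n 0" .
  have i: "- int (Suc n) - - int (Suc n) = 0" "- (- int (Suc n)) = 1 + int n" "1 - int 0 = 1" "n - 0 = n"
    by simp_all
  have "cst th * (subst (gsh (- int (Suc n))) (psi (Suc n)) * D_plus qh th n 0)
    = cst (D_minus_const (Suc n) (Suc n)) * ((lin_factor (inverse t) 0 * factor_prod (inverse t) 1 n) / (factor_prod 1 1 n * lin_factor 1 (1 + int n)))"
    unfolding D_plus_eq[OF le0] subst_gsh_psi c cst_mult[of _ "D_plus_const n 0"] cst_mult[of th] i factor_prod_0
    by (simp only: times_divide_eq_left times_divide_eq_right divide_inverse inverse_mult_distrib mult_ac mult_1_right mult_1_left inverse_1)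
  also have "lin_factor (inverse t) 0 * factor_prod (inverse t) 1 n = factor_prod (inverse t) 0 (Suc n)"
    by (simp add: factor_prod_Suc_shift)
  also have "factor_prod 1 1 n * lin_factor 1 (1 + int n) = factor_prod 1 1 (Suc n)"
    by (simp add: factor_prod_Suc)
  also have "cst (D_minus_const (Suc n) (Suc n)) * (factor_prod (inverse t) 0 (Suc n) / factor_prod 1 1 (Suc n)) = D_minus qh th (Suc n) (Suc n)"
    unfolding D_minus_eq[OF le_refl] by simp
  finally show ?thesis ..
qed

text \<open>
  The coefficient form of the second move. At \<open>j = 0\<close> and \<open>j = n + 1\<close> only one of the two terms is present.
\<close>

lemma D_minus_rec:
  assumes "j \<le> Suc n"
  shows "D_minus qh th (Suc n) j
    = (if j \<le> n then subst (gsh (int (Suc n) - 2 * int j)) phi * D_minus qh th n j else 0)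
      + (if 1 \<le> j then cst th * (subst (gsh (int (Suc n) - 2 * int j)) (psi (Suc n)) * D_plus qh th n (Suc n - j)) else 0)"
proof -
  consider "j = 0" | "j = Suc n" | i m where "j = Suc i" "n = Suc (i + m)"
  proof (cases "j = 0 \<or> j = Suc n")
    case False
    then have "j = Suc (j - 1)" "n = Suc (j - 1 + (n - j))" using assms by auto
    then show ?thesis using that(3) by blast
  qed (use that in blast)
  then show ?thesis
  proof cases
    case 1 then show ?thesis using D_minus_rec_first[of n] by simp
  next
    case 2
    have "int (Suc n) - 2 * int (Suc n) = - int (Suc n)" by simp
    then show ?thesis unfolding 2 using D_minus_rec_last[of n] by simp
  next
    case (3 i m)
    have "int (Suc n) - 2 * int j = int m - int i" "Suc n - j = Suc m" "j \<le> n" "1 \<le> j"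
      using 3 by simp_all
    then show ?thesis using D_minus_rec_middle[of i m] 3 by simp
  qed
qed

lemma K_coeff_eq:
  assumes "j \<le> l"
  shows "K_coeff qh th l j = cst (K_const l j)
    * (factor_prod (inverse t) (1 - int j) (l - j) * factor_prod t (int l - 2 * int j) j / (factor_prod 1 1 (l - j) * factor_prod 1 (- int j) j))
    * (lin_factor 1 (int l - 2 * int j) / lin_factor (inverse t) (int l - 2 * int j))
    * (lin_factor (inverse t) 0 / lin_factor 1 0)"
proof -
  have lins: "1 - Ym2 * cst (q powi (int l - 2 * int j)) = lin_factor 1 (int l - 2 * int j)"
    "1 - cst (inverse t) * Ym2 * cst (q powi (int l - 2 * int j)) = lin_factor (inverse t) (int l - 2 * int j)"
    "1 - cst (inverse t) * Ym2 = lin_factor (inverse t) 0" "1 - Ym2 = lin_factor 1 0"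
    by (simp_all add: lin_factor_def cst_mult mult_ac)
  show ?thesis
    unfolding K_coeff_def Let_def lins Y_binom_eq[OF assms] K_const_def cst_mult
    by (simp only: mult_ac)
qed

lemma subst_gsh_phi_ratio:
  "subst (gsh k) (phi / phi') = cst (inverse t) * (lin_factor t (- k) / lin_factor (inverse t) (- k))"
proof -
  have "cst (inverse t * (th * th)) = 1"
    by (simp add: power2_eq_square field_simps)
  then have "cst (inverse t) * (cst th * cst th) = 1"
    by (simp only: cst_mult)
  then have "phi / phi' = cst (inverse t) * (lin_factor t 0 / lin_factor (inverse t) 0)"
    unfolding phi_eq_lin_factor phi'_eq_lin_factor by (simp add: field_simps)
  then show ?thesis by (simp add: gsh.subst_mult gsh.subst_divide subst_gsh_lin_factor)
qed

text \<open>
  Generic case again, with the same meaning of \<open>i\<close> and \<open>m\<close>.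
\<close>

lemma K_rec_middle:
  fixes i m :: nat
  defines "n \<equiv> Suc (i + m)" and "j \<equiv> Suc i" and "k \<equiv> int m - int i"
  shows "K_coeff qh th (Suc n) j
    = phi' * D_plus qh th n j
      + phi' * (subst (gsh (- k)) (phi / phi') * (cst (inverse th) * D_minus qh th n (Suc m)))"
proof -
  define u w where "u = q ^ j" and "w = q ^ Suc m"
  \<comment> \<open>As before, \<open>P, R, Q, S\<close> and \<open>F\<close> are common to all three terms.\<close>
  define P R Q S F B where "P = factor_prod (inverse t) (- int i) m" and "R = factor_prod t (k + 1) i"
    and "Q = factor_prod 1 1 m" and "S = factor_prod 1 (- int i) i" and "F = lin_factor (inverse t) 0 / lin_factor 1 0"
    and "B = cst (K_const (Suc n) j)"
  define L M1 M2 Lt Li where "L = lin_factor 1 k" and "M1 = lin_factor 1 (- int i - 1)" and "M2 = lin_factor 1 (1 + int m)"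
    and "Lt = lin_factor t k" and "Li = lin_factor (inverse t) k"
  note atoms = P_def Q_def R_def S_def L_def M1_def M2_def Lt_def Li_def
  have neq: "Q \<noteq> 0" "S \<noteq> 0" "M1 \<noteq> 0" "M2 \<noteq> 0" "Li \<noteq> 0"
    unfolding atoms by simp_all
  have uw: "q ^ Suc n = u * w"
    unfolding u_def w_def n_def j_def by (simp only: power_add[symmetric] add_Suc add_Suc_right)
  have u0: "u \<noteq> 0" by (simp add: u_def)
  have "1 - u * w \<noteq> 0"
    unfolding uw[symmetric] using one_minus_q_power_neq_0[of "Suc n"] by blast
  then have nz: "1 - cst u * cst w \<noteq> 0"
    by (metis cst_1 cst_diff cst_eq_0_iff cst_mult)
  define \<beta> \<gamma> where "\<beta> = (1 - w) / (1 - u * w)" and "\<gamma> = w * ((1 - u) / (1 - u * w))"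
  have u: "u = q powi (1 + int i)" and w: "w = q powi (1 + int m)"
    unfolding u_def w_def j_def by (simp_all add: power_int_add)
  have exps: "k = 1 + int m + - (1 + int i)" "- int i - 1 = - (1 + int i)"
    unfolding k_def by simp_all
  have p: "q powi k = w * inverse u" "q powi (- int i - 1) = inverse u"
    unfolding exps by (simp_all only: power_int_add[OF disjI1[OF q_neq_0]] power_int_minus u w)
  have e: "1 * q powi k = w / u" "1 * q powi (- int i - 1) = 1 / u" "1 * q powi (1 + int m) = w"
    unfolding p by (simp_all add: divide_inverse w)
  have id: "L = cst \<beta> * M2 + cst \<gamma> * M1"
    unfolding L_def M1_def M2_def e[THEN lin_factor_eq] \<beta>_def \<gamma>_def
    using K_identity[of "cst u" "cst w" Ym2, OF _ nz] u0
    by (simp add: cst_divide cst_mult cst_diff)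
  have lhs: "K_coeff qh th (Suc n) j = P * (Lt * R) * F / (Q * S) * B * L / (M1 * M2)"
  proof -
    have i1: "1 - int j = - int i" "int (Suc n) - 2 * int j = k" "Suc n - j = Suc m" "j \<le> Suc n"
      "- int j = - int i - 1" "- int i + int m = k" "- int i - 1 + 1 = - int i"
      unfolding j_def n_def k_def by simp_all
    have "K_coeff qh th (Suc n) j = B * ((P * Li) * (Lt * R) / ((Q * M2) * (M1 * S))) * (L / Li) * F"
      unfolding K_coeff_eq[OF i1(4)] i1(1-3,5) B_def[symmetric] F_def
      unfolding j_def factor_prod_Suc[of _ _ m] factor_prod_Suc_shift[of _ k] factor_prod_Suc_shift[of _ "- int i - 1"] i1(6,7) atoms ..
    then show ?thesis using neq by (simp add: mult_ac)
  qed
  have t1: "phi' * D_plus qh th n j = P * (Lt * R) * F / (Q * S) * (B * cst \<beta>) / M1"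
  proof -
    have i1: "1 - int j = - int i" "int n - 2 * int j + 1 = k" "n - j = m" "j \<le> n"
      "- int j = - int i - 1" "- int i - 1 + 1 = - int i"
      unfolding j_def n_def k_def by simp_all
    have "th * D_plus_const n j = K_const (Suc n) j * \<beta>"
      using K_const_step_left[OF i1(4)] unfolding i1(3) uw w_def[symmetric] \<beta>_def .
    then have const: "cst th * cst (D_plus_const n j) = B * cst \<beta>"
      by (simp only: B_def flip: cst_mult)
    have "phi' * D_plus qh th n j = (cst th * cst (D_plus_const n j)) * (F * (P * (Lt * R) / (Q * (M1 * S))))"
      unfolding D_plus_eq[OF i1(4)] i1(1-3,5) phi'_eq_lin_factor F_def
      unfolding j_def factor_prod_Suc_shift[of _ k] factor_prod_Suc_shift[of _ "- int i - 1"] i1(6) atoms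
      by (simp only: mult_ac)
    then show ?thesis unfolding const by (simp add: mult_ac)
  qed
  have t2: "phi' * (subst (gsh (- k)) (phi / phi') * (cst (inverse th) * D_minus qh th n (Suc m)))
      = P * (Lt * R) * F / (Q * S) * (B * cst \<gamma>) / M2"
  proof -
    have i1: "int (Suc m) - int n = - int i" "2 * int (Suc m) - int n = k + 1" "n - Suc m = i" "Suc m \<le> n"
      "- int i + int m = k" "- (- k) = k"
      unfolding n_def k_def by simp_all
    have i2: "n - i = Suc m" "i \<le> n" unfolding n_def by simp_all
    have tt: "th * inverse t * inverse th = inverse t" by simp
    have "th * inverse t * inverse th * D_minus_const n (Suc m) = K_const (Suc n) j * \<gamma>"
      using K_const_step_right[OF i2(2)]
      unfolding tt i2(1) uw j_def[symmetric] w_def[symmetric] u_def[symmetric] \<gamma>_def .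
    then have const: "cst th * cst (inverse t) * cst (inverse th) * cst (D_minus_const n (Suc m)) = B * cst \<gamma>"
      by (simp only: B_def flip: cst_mult)
    have "phi' * (subst (gsh (- k)) (phi / phi') * (cst (inverse th) * D_minus qh th n (Suc m)))
      = (cst th * cst (inverse t) * cst (inverse th) * cst (D_minus_const n (Suc m)))
        * (F * (Lt / Li) * ((P * Li) / (Q * M2) * (R / S)))"
      unfolding D_minus_eq[OF i1(4)] i1(1-3) subst_gsh_phi_ratio i1(6)
      unfolding phi'_eq_lin_factor F_def factor_prod_Suc[of _ _ m] i1(5) atoms
      by (simp only: mult_ac)
    then show ?thesis unfolding const using neq by (simp add: mult_ac)
  qed
  show ?thesis
    unfolding lhs t1 t2 id using neq by (simp add: field_simps)
qed

lemma K_rec_first: "K_coeff qh th (Suc n) 0 = phi' * D_plus qh th n 0"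
proof -
  have c: "K_const (Suc n) 0 = th * D_plus_const n 0"
    using K_const_step_left[of 0 n] one_minus_q_power_neq_0[of "Suc n"] by simp
  have i: "1 - int 0 = 1" "Suc n - 0 = Suc n" "n - 0 = n" "int (Suc n) - 2 * int 0 = 1 + int n"
    by simp_all
  show ?thesis
    unfolding K_coeff_eq[OF le0] D_plus_eq[OF le0] c phi'_eq_lin_factor i factor_prod_0 cst_mult factor_prod_Suc
    by (simp add: mult_ac)
qed

lemma K_rec_last:
  "K_coeff qh th (Suc n) (Suc n)
    = phi' * (subst (gsh (int (Suc n))) (phi / phi') * (cst (inverse th) * D_minus qh th n 0))"
proof -
  have tt: "th * inverse t * inverse th = inverse t" by simp
  have c: "K_const (Suc n) (Suc n) = th * inverse t * inverse th * D_minus_const n 0"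
    unfolding tt using K_const_step_right[of n n] one_minus_q_power_neq_0[of "Suc n"] by simp
  have shift: "factor_prod d (- int (Suc n)) (Suc n) = lin_factor d (- int (Suc n)) * factor_prod d (- int n) n" for d
    by (subst factor_prod_Suc_shift) simp
  have i: "int 0 - int n = - int n" "2 * int 0 - int n = - int n" "n - 0 = n"
    "Suc n - Suc n = 0" "int (Suc n) - 2 * int (Suc n) = - int (Suc n)"
    by simp_all
  show ?thesis
    unfolding K_coeff_eq[OF le_refl] D_minus_eq[OF le0] c subst_gsh_phi_ratio
    unfolding phi'_eq_lin_factor i factor_prod_0 cst_mult shift
    by (simp add: mult_ac)
qed

lemma K_rec:
  assumes "j \<le> Suc n"
  shows "K_coeff qh th (Suc n) j
    = (if j \<le> n then phi' * D_plus qh th n j else 0)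
      + (if 1 \<le> j then phi' * (subst (gsh (2 * int j - int (Suc n))) (phi / phi')
           * (cst (inverse th) * D_minus qh th n (Suc n - j))) else 0)"
proof -
  consider "j = 0" | "j = Suc n" | i m where "j = Suc i" "n = Suc (i + m)"
  proof (cases "j = 0 \<or> j = Suc n")
    case False
    then have "j = Suc (j - 1)" "n = Suc (j - 1 + (n - j))" using assms by auto
    then show ?thesis using that(3) by blast
  qed (use that in blast)
  then show ?thesis
  proof cases
    case 1 then show ?thesis using K_rec_first[of n] by simp
  next
    case 2
    have "2 * int (Suc n) - int (Suc n) = int (Suc n)" by simp
    then show ?thesis unfolding 2 using K_rec_last[of n] by simp
  next
    case (3 i m)
    have "2 * int j - int (Suc n) = - (int m - int i)" "Suc n - j = Suc m" "j \<le> n" "1 \<le> j"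
      using 3 by simp_all
    then show ?thesis using K_rec_middle[of i m] 3 by simp
  qed
qed

section \<open>The expansions\<close>

text \<open>
  Collects two sums whose terms belong to the exponents \<open>n + 1 - 2j\<close> and \<open>-(n + 1 - 2j)\<close>.
\<close>

lemma sum_two_terms_reindex:
  fixes a b :: "nat \<Rightarrow> 'x::comm_monoid_add"
  shows "(\<Sum>j=0..n. a j) + (\<Sum>j=0..n. b j)
    = (\<Sum>j=0..Suc n. (if j \<le> n then a j else 0) + (if 1 \<le> j then b (Suc n - j) else 0))"
proof -
  have "(\<Sum>j=0..n. a j) = (\<Sum>j=0..Suc n. if j \<le> n then a j else 0)"
    by (intro sum.mono_neutral_cong_left) auto
  moreover have "(\<Sum>j=0..n. b j) = (\<Sum>j=0..Suc n. if 1 \<le> j then b (Suc n - j) else 0)"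
  proof -
    have "(\<Sum>j=0..n. b j) = (\<Sum>j\<in>{1..Suc n}. b (Suc n - j))"
      by (rule sum.reindex_bij_witness[of _ "\<lambda>j. Suc n - j" "\<lambda>j. Suc n - j"]) auto
    also have "\<dots> = (\<Sum>j=0..Suc n. if 1 \<le> j then b (Suc n - j) else 0)"
      by (intro sum.mono_neutral_cong_left) auto
    finally show ?thesis .
  qed
  ultimately show ?thesis by (simp only: sum.distrib)
qed

lemma e_et: "e f * et k = et k * e (subst (gsh (- k)) f)"
proof -
  have "et (- k) * e f = e (subst (gsh (- k)) f) * et (- k)" by (rule et_commute)
  then have "et k * (et (- k) * e f) * et k = et k * (e (subst (gsh (- k)) f) * et (- k)) * et k"
    by (simp only:)
  moreover have inv: "et k * et (- k) = 1" "et (- k) * et k = 1"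
    by (simp_all flip: et_add)
  ultimately show ?thesis
    by (simp only: mult.assoc mult_assoc_cong[OF inv(1)] inv(2) mult_1_left mult_1_right)
qed

lemma p_et_e_one0: "p * (et k * e f * u0) = et (1 - k) * e (subst gs f) * u0"
  by (simp only: mult.assoc mult_assoc_cong[OF p_et] mult_assoc_cong[OF s_commute] s_one0)

lemma T1_shift_et_e_one0:
  "T1 H * (et k * e f * u0) + e (cst (T1_shift (ev (int l)))) * (et k * e f * u0)
    = et (- k) * e (subst (gsh k) phi * subst gs f) * u0
      + et k * e (subst (gsh (- k)) (psi l) * f) * u0"
proof -
  have "T1 H * (et k * e f * u0) + e (cst (T1_shift (ev (int l)))) * (et k * e f * u0)
    = e phi * (s * (et k * (e f * u0))) + e (psi l) * (et k * (e f * u0))"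
    by (simp only: T1_eq psi_def e_add distrib_right mult.assoc add.assoc)
  also have "s * (et k * (e f * u0)) = et (- k) * (e (subst gs f) * u0)"
    by (simp only: mult_assoc_cong[OF s_et] mult.assoc mult_assoc_cong[OF s_commute] s_one0)
  also have "e phi * (et (- k) * (e (subst gs f) * u0)) = et (- k) * e (subst (gsh k) phi * subst gs f) * u0"
    by (simp only: mult_assoc_cong[OF e_et] mult.assoc e_mult minus_minus)
  also have "e (psi l) * (et k * (e f * u0)) = et k * e (subst (gsh (- k)) (psi l) * f) * u0"
    by (simp only: mult_assoc_cong[OF e_et] mult.assoc e_mult)
  finally show ?thesis .
qed

lemma E_expansions:
  "E (- int l) * u0 = (\<Sum>j=0..l. et (- int l + 2 * int j) * e (D_minus qh th l j) * u0) \<and>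
   E (int l + 1) * u0 = (\<Sum>j=0..l. et (int l + 1 - 2 * int j) * e (D_plus qh th l j) * u0)"
proof (induction l)
  have up: "E (int l + 1) * u0 = (\<Sum>j=0..l. et (int l + 1 - 2 * int j) * e (D_plus qh th l j) * u0)"
    if "E (- int l) * u0 = (\<Sum>j=0..l. et (- int l + 2 * int j) * e (D_minus qh th l j) * u0)" for l
  proof -
    have "E (int l + 1) * u0
        = (\<Sum>j=0..l. e (cst (inverse th)) * (p * (et (- int l + 2 * int j) * e (D_minus qh th l j) * u0)))"
      unfolding E_up that by (simp only: sum_distrib_left)
    also have "\<dots> = (\<Sum>j=0..l. et (int l + 1 - 2 * int j) * e (D_plus qh th l j) * u0)"
    proof (rule sum.cong[OF refl])
      fix j assume "j \<in> {0..l}"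
      then have D: "D_plus qh th l j = cst (inverse th) * subst gs (D_minus qh th l j)"
        by (simp add: D_plus_D_minus flip: mult.assoc cst_mult)
      have i: "1 - (- int l + 2 * int j) = int l + 1 - 2 * int j" by simp
      show "e (cst (inverse th)) * (p * (et (- int l + 2 * int j) * e (D_minus qh th l j) * u0))
          = et (int l + 1 - 2 * int j) * e (D_plus qh th l j) * u0"
        unfolding p_et_e_one0 i D e_mult by (simp only: mult.assoc e_cst_left_commute)
    qed
    finally show ?thesis .
  qed
  {
    case 0
    have "E (- int 0) * u0 = (\<Sum>j=0..0. et (- int 0 + 2 * int j) * e (D_minus qh th 0 j) * u0)"
      using one_minus_t_q_power_neq_0[of 0]
      by (simp add: E_0 D_minus_eq[OF le_refl] D_minus_const_def qt_binom_eq qpoch_ratio_def qpoch_def)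
    with up[OF this] show ?case by blast
  next
    case (Suc n)
    have ns: "- int (Suc n) = - int n - 1" by simp
    define a where "a j = et (- int (Suc n) + 2 * int j)
      * e (subst (gsh (int (Suc n) - 2 * int j)) phi * (cst th * subst gs (D_plus qh th n j))) * u0" for j
    define b where "b j = et (int (Suc n) - 2 * int j)
      * e (cst th * (subst (gsh (2 * int j - int (Suc n))) (psi (Suc n)) * D_plus qh th n j)) * u0" for j
    have "E (- int (Suc n)) * u0
       = (\<Sum>j=0..n. e (cst th) * (T1 H * (et (int n + 1 - 2 * int j) * e (D_plus qh th n j) * u0)
          + e (cst (T1_shift (ev (int n + 1)))) * (et (int n + 1 - 2 * int j) * e (D_plus qh th n j) * u0)))"
      unfolding ns E_down Suc.IH[THEN conjunct2]
      by (simp only: sum_distrib_left sum.distrib distrib_left)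
    also have "\<dots> = (\<Sum>j=0..n. a j + b j)"
    proof (rule sum.cong[OF refl])
      fix j
      have i: "int n + 1 = int (Suc n)" "- (int (Suc n) - 2 * int j) = - int (Suc n) + 2 * int j"
        "- int (Suc n) + 2 * int j = 2 * int j - int (Suc n)"
        by simp_all
      show "e (cst th) * (T1 H * (et (int n + 1 - 2 * int j) * e (D_plus qh th n j) * u0)
          + e (cst (T1_shift (ev (int n + 1)))) * (et (int n + 1 - 2 * int j) * e (D_plus qh th n j) * u0)) = a j + b j"
        unfolding i(1) T1_shift_et_e_one0 a_def b_def
        unfolding i(2)
        unfolding i(3)
        by (simp only: distrib_left e_mult mult.assoc e_cst_left_commute)
    qed
    also have "\<dots> = (\<Sum>j=0..Suc n. (if j \<le> n then a j else 0) + (if 1 \<le> j then b (Suc n - j) else 0))"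
      unfolding sum.distrib[of a b] by (rule sum_two_terms_reindex)
    also have "\<dots> = (\<Sum>j=0..Suc n. et (- int (Suc n) + 2 * int j) * e (D_minus qh th (Suc n) j) * u0)"
    proof (rule sum.cong[OF refl])
      fix j assume "j \<in> {0..Suc n}"
      then have j: "j \<le> Suc n" by simp
      have gs: "cst th * subst gs (D_plus qh th n j) = D_minus qh th n j" if "j \<le> n"
        unfolding D_minus_D_plus[OF that] by (simp flip: mult.assoc cst_mult)
      have i: "int (Suc n) - 2 * int (Suc n - j) = - int (Suc n) + 2 * int j"
        "2 * int (Suc n - j) - int (Suc n) = int (Suc n) - 2 * int j"
        using j by (simp_all add: of_nat_diff)
      show "(if j \<le> n then a j else 0) + (if 1 \<le> j then b (Suc n - j) else 0)
        = et (- int (Suc n) + 2 * int j) * e (D_minus qh th (Suc n) j) * u0"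
        unfolding D_minus_rec[OF j] a_def b_def i
        by (simp add: gs e_add distrib_left distrib_right)
    qed
    finally have "E (- int (Suc n)) * u0
      = (\<Sum>j=0..Suc n. et (- int (Suc n) + 2 * int j) * e (D_minus qh th (Suc n) j) * u0)" .
    with up[OF this] show ?case by blast
  }
qed

text \<open>
  Expand the right factor as \<open>\<one>\<^sub>0 = (1 + s) phi'\<close>. The term with \<open>s\<close> is brought to the left, turning \<open>\<eta>\<^sup>k\<close> into
  \<open>\<eta>\<^sup>-\<^sup>k\<close>, where \<open>\<one>\<^sub>0 s = \<one>\<^sub>0 phi/phi'\<close> absorbs it. Hence no factor \<open>\<one>\<^sub>0\<close> remains on the right.
\<close>

lemma one0_et_e_one0:
  "u0 * (et k * e f * u0) = u0 * et k * e (phi' * f)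
     + u0 * et (- k) * e (phi' * (subst (gsh k) (phi / phi') * subst gs f))"
proof -
  have us: "u0 * s = u0 * e (phi / phi')"
  proof -
    have "u0 * s = (1 + s) * (e phi' * s)" by (simp only: one0_alt mult.assoc)
    also have "e phi' * s = s * e phi" by (simp only: s_commute subst_gs_phi)
    also have "(1 + s) * (s * e phi) = (1 + s) * e phi"
      by (simp add: distrib_right mult_assoc_cong[OF s_s] add.commute)
    also have "phi = phi' * (phi / phi')" by simp
    finally show ?thesis unfolding one0_alt by (simp only: e_mult mult.assoc) 
  qed
  have "u0 * (et k * e f * u0) = u0 * et k * e f * e phi' + u0 * et k * (e f * s) * e phi'"
    unfolding one0_alt[of ] by (simp only: distrib_left distrib_right mult.assoc mult_1_left mult_1_right)
  also have "e f * s = s * e (subst gs f)" by (simp only: s_commute gs_gs)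
  also have "u0 * et k * (s * e (subst gs f)) * e phi' = u0 * s * (et (- k) * e (subst gs f) * e phi')"
  proof -
    have es: "et k * s = s * et (- k)" by (simp add: s_et)
    show ?thesis by (simp only: mult.assoc mult_assoc_cong[OF es])
  qed
  also have "\<dots> = u0 * ((e (phi / phi') * et (- k)) * e (subst gs f) * e phi')"
    by (simp only: us mult.assoc)
  also have "e (phi / phi') * et (- k) = et (- k) * e (subst (gsh k) (phi / phi'))"
    using e_et[of "phi / phi'" "- k"] by simp
  finally show ?thesis by (simp add: mult.assoc mult.commute[of phi'] flip: e_mult)
qed

lemma K_expansion:
  "u0 * E (int (Suc n)) * u0
    = (\<Sum>j=0..Suc n. u0 * et (int (Suc n) - 2 * int j) * e (K_coeff qh th (Suc n) j))"
proof -
  define a where "a j = u0 * et (int (Suc n) - 2 * int j) * e (phi' * D_plus qh th n j)" for j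
  define b where "b j = u0 * et (2 * int j - int (Suc n))
     * e (phi' * (subst (gsh (int (Suc n) - 2 * int j)) (phi / phi') * subst gs (D_plus qh th n j)))" for j
  have sn: "int (Suc n) = int n + 1" by simp
  have "u0 * E (int (Suc n)) * u0 = u0 * (E (int n + 1) * u0)"
    unfolding sn by (rule mult.assoc)
  also have "\<dots> = (\<Sum>j=0..n. u0 * (et (int n + 1 - 2 * int j) * e (D_plus qh th n j) * u0))"
    unfolding E_expansions[THEN conjunct2] by (rule sum_distrib_left)
  also have "\<dots> = (\<Sum>j=0..n. a j + b j)"
  proof (rule sum.cong[OF refl])
    fix j
    have i: "- (int (Suc n) - 2 * int j) = 2 * int j - int (Suc n)" by simp
    show "u0 * (et (int n + 1 - 2 * int j) * e (D_plus qh th n j) * u0) = a j + b j"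
      unfolding sn[symmetric] one0_et_e_one0 a_def b_def i ..
  qed
  also have "\<dots> = (\<Sum>j=0..Suc n. (if j \<le> n then a j else 0) + (if 1 \<le> j then b (Suc n - j) else 0))"
    unfolding sum.distrib[of a b] by (rule sum_two_terms_reindex)
  also have "\<dots> = (\<Sum>j=0..Suc n. u0 * et (int (Suc n) - 2 * int j) * e (K_coeff qh th (Suc n) j))"
  proof (rule sum.cong[OF refl])
    fix j assume "j \<in> {0..Suc n}"
    then have j: "j \<le> Suc n" by simp
    have gs: "subst gs (D_plus qh th n (Suc n - j)) = cst (inverse th) * D_minus qh th n (Suc n - j)" if "1 \<le> j"
      using that by (intro D_minus_D_plus) simp
    have i: "2 * int (Suc n - j) - int (Suc n) = int (Suc n) - 2 * int j"
      "int (Suc n) - 2 * int (Suc n - j) = 2 * int j - int (Suc n)"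
      using j by (simp_all add: of_nat_diff)
    show "(if j \<le> n then a j else 0) + (if 1 \<le> j then b (Suc n - j) else 0)
        = u0 * et (int (Suc n) - 2 * int j) * e (K_coeff qh th (Suc n) j)"
      unfolding K_rec[OF j] a_def b_def i
      by (simp add: gs e_add distrib_left)
  qed
  finally show ?thesis .
qed

lemma et_one0_expansion_unique:
  assumes "finite A" "inj_on k A"
  shows "(\<Sum>j\<in>A. et (k j) * e (f j) * u0) = (\<Sum>j\<in>A. et (k j) * e (g j) * u0) \<longleftrightarrow> (\<forall>j\<in>A. g j = f j)"
proof
  assume "(\<Sum>j\<in>A. et (k j) * e (f j) * u0) = (\<Sum>j\<in>A. et (k j) * e (g j) * u0)"
  then have "(\<Sum>j\<in>A. et (k j) * e (g j - f j) * u0) = 0"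
    by (simp add: e_diff right_diff_distrib left_diff_distrib sum_subtractf)
  then show "\<forall>j\<in>A. g j = f j"
    using et_one0_independent[OF assms, of "\<lambda>j. g j - f j"] by simp
qed simp

lemma one0_et_expansion_unique:
  assumes "finite A" "inj_on k A"
  shows "(\<Sum>j\<in>A. u0 * et (k j) * e (f j)) = (\<Sum>j\<in>A. u0 * et (k j) * e (g j)) \<longleftrightarrow> (\<forall>j\<in>A. g j = f j)"
proof
  assume "(\<Sum>j\<in>A. u0 * et (k j) * e (f j)) = (\<Sum>j\<in>A. u0 * et (k j) * e (g j))"
  then have "(\<Sum>j\<in>A. u0 * et (k j) * e (g j - f j)) = 0"
    by (simp add: e_diff right_diff_distrib sum_subtractf)
  then show "\<forall>j\<in>A. g j = f j"
    using one0_et_independent[OF assms, of "\<lambda>j. g j - f j"] by simp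
qed simp

end

lemma all_ge_1_iff_all_Suc: "(\<forall>l\<ge>1. P l) \<longleftrightarrow> (\<forall>l. P (Suc l))"
  by (metis One_nat_def Suc_le_D Suc_le_mono le0)

theorem theorem5p4:
  fixes qh th :: complex
    and H :: "('h::ring_1) daha"
    and D Dm K :: "nat \<Rightarrow> nat \<Rightarrow> ratfun"
  assumes "generic_parameters qh th"
    and "localized_daha qh th H"
  shows
    "((\<forall>l\<ge>1. E_X qh th H (int l) * one0 th H =
         (\<Sum>j=0..l-1. eta th H (int l - 2 * int j) * emb H (D (l - 1) j) * one0 th H))
     \<longleftrightarrow> (\<forall>l. \<forall>j\<le>l. D l j = D_plus qh th l j)) \<and>
    ((\<forall>l. E_X qh th H (- int l) * one0 th H =
         (\<Sum>j=0..l. eta th H (- int l + 2 * int j) * emb H (Dm l j) * one0 th H))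
     \<longleftrightarrow> (\<forall>l. \<forall>j\<le>l. Dm l j = D_minus qh th l j)) \<and>
    ((\<forall>l\<ge>1. one0 th H * E_X qh th H (int l) * one0 th H =
         (\<Sum>j=0..l. one0 th H * eta th H (int l - 2 * int j) * emb H (K l j)))
     \<longleftrightarrow> (\<forall>l\<ge>1. \<forall>j\<le>l. K l j = K_coeff qh th l j))"
proof -
  interpret localized_DAHA qh th H
    using assms by unfold_locales
  have inj: "inj_on (\<lambda>j. m - 2 * int j) A" "inj_on (\<lambda>j. m + 2 * int j) A" for m A
    by (simp_all add: inj_on_def)
  have plus: "E (int (Suc l)) * u0 = (\<Sum>j=0..l. et (int (Suc l) - 2 * int j) * e (D l j) * u0)
      \<longleftrightarrow> (\<forall>j\<le>l. D l j = D_plus qh th l j)" for l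
  proof -
    have "E (int (Suc l)) * u0 = (\<Sum>j=0..l. et (int (Suc l) - 2 * int j) * e (D_plus qh th l j) * u0)"
      using E_expansions[of l] by (simp add: add.commute)
    then show ?thesis
      by (simp only: et_one0_expansion_unique[OF finite_atLeastAtMost inj(1)]) auto
  qed
  have minus: "E (- int l) * u0 = (\<Sum>j=0..l. et (- int l + 2 * int j) * e (Dm l j) * u0)
      \<longleftrightarrow> (\<forall>j\<le>l. Dm l j = D_minus qh th l j)" for l
    unfolding E_expansions[THEN conjunct1] et_one0_expansion_unique[OF finite_atLeastAtMost inj(2)]
    by auto
  have symm: "u0 * E (int (Suc l)) * u0 = (\<Sum>j=0..Suc l. u0 * et (int (Suc l) - 2 * int j) * e (K (Suc l) j))
      \<longleftrightarrow> (\<forall>j\<le>Suc l. K (Suc l) j = K_coeff qh th (Suc l) j)" for l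
    unfolding K_expansion one0_et_expansion_unique[OF finite_atLeastAtMost inj(1)]
    by auto
  show ?thesis
    unfolding all_ge_1_iff_all_Suc diff_Suc_1 plus minus symm by blast
qed

end
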